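(* Consider the Gaussian process state-space model with $\bm{x}_0\sim p(\bm{x}_0)=\mathcal{N}(\bm{\mu}_0,\bm{P}_0)$, $f\sim\mathcal{GP}(0,K_0)$ (independent of $\bm{x}_0$), $p(\bm{x}_{t+1}\mid\bm{x}_t,\bm{f})=\mathcal{N}(\bm{x}_{t+1}\mid\bm{F}(\bm{x}_t,f(\bm{x}_t)),\bm{\Sigma}_p)$ and $p(\bm{y}_t\mid\bm{x}_t)=\mathcal{N}(\bm{y}_t\mid\bm{g}(\bm{x}_t),\bm{\Sigma}_m)$. Let $q(\bm{x}_t,\bm{f})$ denote the approximation to the joint distribution of state and function values (after either a prediction step or a correction step) produced by the approximate recursion described in the context. In this recursion the transition model and the measurement model are replaced by their first-order linearizations. A finite set of inducing points $\bm{u}=\{u_i\}_{i=1}^{n_u}$, $u_i=f(\bm{x}_i)$, is initialized as an arbitrary finite set of function values (possibly empty), and it is augmented with the function value $f(\mathbb{E}_{q(\bm{x}_t,\bm{u})}[\bm{x}_t])$. Then, at every prediction step and every correction step, with $\bm{u}$ the current inducing-point set, the approximate distribution has the factorized form $$q(\bm{x}_t,\bm{f})=p(\bm{f}_{\neq u}\mid\bm{u})\,q(\bm{x}_t,\bm{u}),$$ where $\bm{f}_{\neq u}=\bm{f}\setminus\bm{u}$ denotes all function values except $\bm{u}$, and $p(\bm{f}_{\neq u}\mid\bm{u})$ is the GP prior conditional $$p(\bm{f}_{\neq u}\mid\bm{u})=\mathcal{N}\left(\bm{K}_{f_{\neq u}u}\bm{K}_{uu}^{-1}\bm{u},\ \bm{K}_{f_{\neq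 u}f_{\neq u}}-\bm{K}_{f_{\neq u}u}\bm{K}_{uu}^{-1}\bm{K}_{uf_{\neq u}}\right).$$ Furthermore, $q(\bm{x}_t,\bm{u})$ is a Gaussian distribution.
   Context: Setting. States $\bm{x}_t\in\mathbb{R}^{d_x}$, measurements $\bm{y}_t\in\mathbb{R}^{d_y}$. The maps $\bm{F}:\mathbb{R}^{d_x}\times\mathbb{R}\to\mathbb{R}^{d_x}$ and $\bm{g}:\mathbb{R}^{d_x}\to\mathbb{R}^{d_y}$ are known and differentiable, and $f:\mathbb{R}^{d_x}\to\mathbb{R}$ is unknown with a zero-mean Gaussian process prior with covariance function (kernel) $K_0$. The kernel is assumed differentiable and such that kernel matrices at finitely many distinct inputs are invertible. The matrices $\bm{P}_0,\bm{\Sigma}_p,\bm{\Sigma}_m$ are (positive definite) covariance matrices. $\bm{f}=\{f(\bm{x}):\bm{x}\in\mathbb{R}^{d_x}\}$ denotes the collection of all function values. Densities involving $\bm{f}$ or $\bm{f}_{\neq u}$ are understood as laws of processes, i.e. through arbitrary finite subcollections of function values. $p(\bm{f})$ is the GP prior. $\bm{K}_{ab}$ is the matrix of prior covariances (values of $K_0$) between the collections of function values $a$ and $b$. If $\bm{u}$ is empty, $p(\bm{f}_{\neq u}\mid\bm{u})$ means $p(\bm{f})$. Exact filtering. The exact prediction and correction steps are $$p(\bm{x}_{t+1},\bm{f}\mid\bm{y}_{1:t})=\int p(\bm{x}_{t+1}\mid\bm{x}_t,\bm{f})\,p(\bm{x}_t,\bm{f}\mid\bm{y}_{1:t})\,d\bm{x}_t,$$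 $$p(\bm{x}_{t+1},\bm{f}\mid\bm{y}_{1:t+1})=\frac{p(\bm{y}_{t+1}\mid\bm{x}_{t+1})\,p(\bm{x}_{t+1},\bm{f}\mid\bm{y}_{1:t})}{p(\bm{y}_{t+1}\mid\bm{y}_{1:t})}.$$ First-order linearization. For a Gaussian model $p(\bm{a}\mid\bm{b})=\mathcal{N}(\bm{a}\mid\bm{h}(\bm{b}),\bm{S})$ with $\bm{h}$ differentiable and $\bm{S}$ a covariance matrix, its first-order linearization around the mean $\bm{m}_b$ of $\bm{b}$ is $\mathcal{N}\left(\bm{a}\mid\bm{h}(\bm{m}_b)+\frac{\partial\bm{h}}{\partial\bm{b}}\big|_{\bm{m}_b}(\bm{b}-\bm{m}_b),\bm{S}\right)$. Approximate recursion. - Initialization: $q(\bm{x}_0,\bm{f})=p(\bm{x}_0)p(\bm{f})$, with $\bm{u}$ any finite set of function values (possibly empty). - Prediction step: given $q(\bm{x}_t,\bm{f})$, let $\bm{\mu}_t=\mathbb{E}_q[\bm{x}_t]$, $m_{f(\bm{x})}=\mathbb{E}_q[f(\bm{x})]$, $f_t=f(\bm{\mu}_t)$, $m_{f_t}=\mathbb{E}_q[f_t]$. The transition model is linearized around the mean of $\bm{x}_t$ and of the GP: $$q(\bm{x}_{t+1}\mid\bm{x}_t,f_t)=\mathcal{N}\left(\bm{x}_{t+1}\mid\bm{F}(\bm{\mu}_t,m_{f_t})+\bm{A}_x(\bm{x}_t-\bm{\mu}_t)+\bm{A}_f(f_t-m_{f_t}),\ \bm{\Sigma}_p\right),$$ with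 $\bm{A}_f=\frac{\partial\bm{F}(\bm{\mu}_t,f)}{\partial f}\big|_{f=m_{f_t}}$ and $\bm{A}_x=\frac{\partial}{\partial\bm{x}}\bm{F}(\bm{x},m_{f(\bm{x})})\big|_{\bm{x}=\bm{\mu}_t}$ (total derivative). The inducing-point set is replaced by $\bm{u}\cup\{f_t\}$, and the predicted distribution is $q^-(\bm{x}_{t+1},\bm{f})=\int q(\bm{x}_t,\bm{f})\,q(\bm{x}_{t+1}\mid\bm{x}_t,f_t)\,d\bm{x}_t$. This $q^-$ is the approximation "$q(\bm{x}_{t+1},\bm{f})$" of $p(\bm{x}_{t+1},\bm{f}\mid\bm{y}_{1:t})$. - Correction step: with $\bm{\mu}_{t+1}^-=\mathbb{E}_{q^-}[\bm{x}_{t+1}]$ and $\bm{C}_x=\frac{\partial\bm{g}}{\partial\bm{x}}\big|_{\bm{\mu}_{t+1}^-}$, the measurement model is replaced by $q(\bm{y}_{t+1}\mid\bm{x}_{t+1})=\mathcal{N}(\bm{y}_{t+1}\mid\bm{g}(\bm{\mu}_{t+1}^-)+\bm{C}_x(\bm{x}_{t+1}-\bm{\mu}_{t+1}^-),\bm{\Sigma}_m)$, and $q(\bm{x}_{t+1},\bm{f})\propto q^-(\bm{x}_{t+1},\bm{f})\,q(\bm{y}_{t+1}\mid\bm{x}_{t+1})$ (normalized). The inducing-point set is the one resulting from the prediction step. This $q$ approximates $p(\bm{x}_{t+1},\bm{f}\mid\bm{y}_{1:t+1})$. Here $q(\bm{x}_t,\bm{u})$ is the marginal of $q(\bm{x}_t,\bm{f})$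 on $(\bm{x}_t,\bm{u})$. *)

theory Defs
  imports "HOL-Probability.Probability"
begin

text \<open>
  The number of inducing points grows along the recursion, so matrices whose rows and columns are
  function values are indexed by a finite set \<open>I\<close> instead of a finite type. The determinant
  and the inverse below are the library's \<^const>\<open>det\<close> and \<^const>\<open>matrix_inv\<close> with
  \<^term>\<open>UNIV\<close> replaced by \<open>I\<close>.
\<close>

definition det_on :: "'i set \<Rightarrow> ('i \<Rightarrow> 'i \<Rightarrow> real) \<Rightarrow> real" where
  "det_on I S = (\<Sum>p | p permutes I. of_int (sign p) * (\<Prod>i\<in>I. S i (p i)))"

definition is_inverse_on ::
    "'i set \<Rightarrow> ('i \<Rightarrow> 'i \<Rightarrow> real) \<Rightarrow> ('i \<Rightarrow> 'i \<Rightarrow> real) \<Rightarrow> bool" where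
  "is_inverse_on I S T \<longleftrightarrow>
     (\<forall>i\<in>I. \<forall>j\<in>I. (\<Sum>k\<in>I. S i k * T k j) = of_bool (i = j) \<and>
                 (\<Sum>k\<in>I. T i k * S k j) = of_bool (i = j))"

definition invertible_on :: "'i set \<Rightarrow> ('i \<Rightarrow> 'i \<Rightarrow> real) \<Rightarrow> bool" where
  "invertible_on I S \<longleftrightarrow> (\<exists>T. is_inverse_on I S T)"

definition inv_on :: "'i set \<Rightarrow> ('i \<Rightarrow> 'i \<Rightarrow> real) \<Rightarrow> 'i \<Rightarrow> 'i \<Rightarrow> real" where
  "inv_on I S = (SOME T. is_inverse_on I S T)"

definition pos_def_on :: "'i set \<Rightarrow> ('i \<Rightarrow> 'i \<Rightarrow> real) \<Rightarrow> bool" where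
  "pos_def_on I S \<longleftrightarrow>
     (\<forall>i\<in>I. \<forall>j\<in>I. S i j = S j i) \<and>
     (\<forall>a. (\<exists>i\<in>I. a i \<noteq> 0) \<longrightarrow> (\<Sum>i\<in>I. \<Sum>j\<in>I. a i * S i j * a j) > 0)"

definition mvn_density ::
    "'i set \<Rightarrow> ('i \<Rightarrow> real) \<Rightarrow> ('i \<Rightarrow> 'i \<Rightarrow> real) \<Rightarrow> ('i \<Rightarrow> real) \<Rightarrow> real" where
  "mvn_density I m S z =
     exp (- (\<Sum>i\<in>I. \<Sum>j\<in>I. (z i - m i) * inv_on I S i j * (z j - m j)) / 2)
       / sqrt ((2 * pi) ^ card I * det_on I S)"

definition mvn :: "'i set \<Rightarrow> ('i \<Rightarrow> real) \<Rightarrow> ('i \<Rightarrow> 'i \<Rightarrow> real) \<Rightarrow> ('i \<Rightarrow> real) measure" where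
  "mvn I m S = density (Pi\<^sub>M I (\<lambda>_. lborel)) (\<lambda>z. ennreal (mvn_density I m S z))"

definition is_mvn :: "'i set \<Rightarrow> ('i \<Rightarrow> real) measure \<Rightarrow> bool" where
  "is_mvn I M \<longleftrightarrow> (\<exists>m S. pos_def_on I S \<and> M = mvn I m S)"

definition pos_def :: "real^'d^'d \<Rightarrow> bool" where
  "pos_def S \<longleftrightarrow> pos_def_on UNIV (\<lambda>i j. S $ i $ j)"

definition mvn_vec_density :: "real^'d \<Rightarrow> real^'d^'d \<Rightarrow> real^'d \<Rightarrow> real" where
  "mvn_vec_density m S x = mvn_density UNIV (($) m) (\<lambda>i j. S $ i $ j) (($) x)"

definition mvn_vec :: "real^'d \<Rightarrow> real^'d^'d \<Rightarrow> (real^'d) measure" where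
  "mvn_vec m S = density lborel (\<lambda>x. ennreal (mvn_vec_density m S x))"

definition covariance_function :: "('p \<Rightarrow> 'p \<Rightarrow> real) \<Rightarrow> bool" where
  "covariance_function K \<longleftrightarrow>
     (\<forall>p p'. K p p' = K p' p) \<and>
     (\<forall>J a. finite J \<longrightarrow> (\<Sum>p\<in>J. \<Sum>p'\<in>J. a p * K p p' * a p') \<ge> 0)"

text \<open>
  The law of a process \<open>f\<close> is a measure on the product space over all inputs. A function value
  \<open>f p\<close> is identified by its input \<open>p\<close>, so that a set of function values is given by a set of
  inputs, and in particular distinct elements of that set have distinct inputs.
\<close>

definition gaussian_process ::
    "('p \<Rightarrow> real) \<Rightarrow> ('p \<Rightarrow> 'p \<Rightarrow> real) \<Rightarrow> ('p \<Rightarrow> real) measure \<Rightarrow> bool" where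
  "gaussian_process m K P \<longleftrightarrow>
     prob_space P \<and>
     sets P = sets (Pi\<^sub>M UNIV (\<lambda>_. borel)) \<and>
     (\<forall>J. finite J \<longrightarrow> distr P (Pi\<^sub>M J (\<lambda>_. borel)) (\<lambda>f. restrict f J) = mvn J m K)"

text \<open>
  The finite-dimensional law of the values at \<open>J\<close> (disjoint from \<open>U\<close>) under
  \<open>\<N>(K\<^bsub>fu\<^esub> K\<^bsub>uu\<^esub>\<inverse> u, K\<^bsub>ff\<^esub> - K\<^bsub>fu\<^esub> K\<^bsub>uu\<^esub>\<inverse> K\<^bsub>uf\<^esub>)\<close>. For \<open>U = {}\<close> this is the prior law of these values.
\<close>

definition gp_conditional ::
    "('p \<Rightarrow> 'p \<Rightarrow> real) \<Rightarrow> 'p set \<Rightarrow> 'p set \<Rightarrow> ('p \<Rightarrow> real) \<Rightarrow> ('p \<Rightarrow> real) measure" where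
  "gp_conditional K U J u =
     mvn J (\<lambda>p. \<Sum>v\<in>U. \<Sum>w\<in>U. K p v * inv_on U K v w * u w)
           (\<lambda>p p'. K p p' - (\<Sum>v\<in>U. \<Sum>w\<in>U. K p v * inv_on U K v w * K w p'))"

definition is_prior_conditional ::
    "('p \<Rightarrow> real) measure \<Rightarrow> 'p set \<Rightarrow> ('p set \<Rightarrow> ('p \<Rightarrow> real) \<Rightarrow> ('p \<Rightarrow> real) measure) \<Rightarrow> bool" where
  "is_prior_conditional P U \<kappa> \<longleftrightarrow>
     (\<forall>J. finite J \<and> J \<inter> U = {} \<longrightarrow>
        distr P (Pi\<^sub>M U (\<lambda>_. borel) \<Otimes>\<^sub>M Pi\<^sub>M J (\<lambda>_. borel)) (\<lambda>f. (restrict f U, restrict f J)) =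
        distr P (Pi\<^sub>M U (\<lambda>_. borel)) (\<lambda>f. restrict f U) \<bind>
          (\<lambda>u. distr (\<kappa> J u) (Pi\<^sub>M U (\<lambda>_. borel) \<Otimes>\<^sub>M Pi\<^sub>M J (\<lambda>_. borel)) (\<lambda>h. (u, h))))"

type_synonym 'n joint_law = "((real^'n) \<times> (real^'n \<Rightarrow> real)) measure"

definition state_mean :: "'n::finite joint_law \<Rightarrow> real^'n" where
  "state_mean q = (\<integral>z. fst z \<partial>q)"

definition function_mean :: "'n::finite joint_law \<Rightarrow> real^'n \<Rightarrow> real" where
  "function_mean q p = (\<integral>z. snd z p \<partial>q)"

definition marginal_xu :: "(real^'n) set \<Rightarrow> 'n::finite joint_law \<Rightarrow> 'n joint_law" where
  "marginal_xu U q = distr q (borel \<Otimes>\<^sub>M Pi\<^sub>M U (\<lambda>_. borel)) (\<lambda>(x, f). (x, restrict f U))"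

definition factorizes ::
    "(real^'n) set \<Rightarrow> ((real^'n) set \<Rightarrow> (real^'n \<Rightarrow> real) \<Rightarrow> (real^'n \<Rightarrow> real) measure) \<Rightarrow>
     'n::finite joint_law \<Rightarrow> bool" where
  "factorizes U \<kappa> q \<longleftrightarrow>
     (\<forall>J. finite J \<and> J \<inter> U = {} \<longrightarrow>
        distr q (borel \<Otimes>\<^sub>M Pi\<^sub>M U (\<lambda>_. borel) \<Otimes>\<^sub>M Pi\<^sub>M J (\<lambda>_. borel))
          (\<lambda>(x, f). (x, restrict f U, restrict f J)) =
        marginal_xu U q \<bind>
          (\<lambda>(x, u). distr (\<kappa> J u) (borel \<Otimes>\<^sub>M Pi\<^sub>M U (\<lambda>_. borel) \<Otimes>\<^sub>M Pi\<^sub>M J (\<lambda>_. borel))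
             (\<lambda>h. (x, u, h))))"

text \<open>The index set \<open>UNIV <+> U\<close> lists the coordinates of \<open>x\<close> and the inducing values \<open>u\<close>.\<close>

definition gaussian_xu :: "(real^'n) set \<Rightarrow> 'n::finite joint_law \<Rightarrow> bool" where
  "gaussian_xu U r \<longleftrightarrow>
     is_mvn (UNIV <+> U)
       (distr r (Pi\<^sub>M (UNIV <+> U) (\<lambda>_. borel))
          (\<lambda>(x, u). restrict (case_sum (($) x) u) (UNIV <+> U)))"

text \<open>
  The Jacobian \<open>Ax\<close> is the total derivative at \<open>\<mu>\<close>: the posterior mean \<open>mf x\<close> of the function
  value varies with \<open>x\<close>.
\<close>

definition transition_mean ::
    "((real^'n) \<times> real \<Rightarrow> real^'n) \<Rightarrow> 'n::finite joint_law \<Rightarrow> real^'n \<Rightarrow> real \<Rightarrow> real^'n" where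
  "transition_mean F q x ft =
     (let \<mu> = state_mean q; mf = function_mean q;
          Ax = jacobian (\<lambda>x. F (x, mf x)) (at \<mu>);
          Af = vector_derivative (\<lambda>r. F (\<mu>, r)) (at (mf \<mu>))
      in F (\<mu>, mf \<mu>) + Ax *v (x - \<mu>) + (ft - mf \<mu>) *\<^sub>R Af)"

definition prediction ::
    "((real^'n) \<times> real \<Rightarrow> real^'n) \<Rightarrow> real^'n^'n \<Rightarrow> 'n::finite joint_law \<Rightarrow> 'n joint_law" where
  "prediction F Sp q =
     q \<bind> (\<lambda>(x, f). distr (mvn_vec (transition_mean F q x (f (state_mean q))) Sp)
                 (borel \<Otimes>\<^sub>M Pi\<^sub>M UNIV (\<lambda>_. borel)) (\<lambda>x'. (x', f)))"

definition linearized_likelihood ::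
    "(real^'n \<Rightarrow> real^'m) \<Rightarrow> real^'m^'m \<Rightarrow> real^'m \<Rightarrow> 'n::finite joint_law \<Rightarrow> real^'n \<Rightarrow> real" where
  "linearized_likelihood g Sm y q x =
     (let \<mu> = state_mean q; Cx = jacobian g (at \<mu>)
      in mvn_vec_density (g \<mu> + Cx *v (x - \<mu>)) Sm y)"

definition correction ::
    "(real^'n \<Rightarrow> real^'m) \<Rightarrow> real^'m^'m \<Rightarrow> real^'m \<Rightarrow> 'n::finite joint_law \<Rightarrow> 'n joint_law" where
  "correction g Sm y q =
     (let L = (\<lambda>(x, f). ennreal (linearized_likelihood g Sm y q x))
      in density q (\<lambda>z. L z / (\<integral>\<^sup>+ z'. L z' \<partial>q)))"

text \<open>
  A state of the recursion is a pair of the current approximation \<open>q\<close> and the current inducing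
  inputs \<open>U\<close>.
\<close>

definition predict_step ::
    "((real^'n) \<times> real \<Rightarrow> real^'n) \<Rightarrow> real^'n^'n \<Rightarrow>
     'n::finite joint_law \<times> (real^'n) set \<Rightarrow> 'n joint_law \<times> (real^'n) set" where
  "predict_step F Sp = (\<lambda>(q, U). (prediction F Sp q, insert (state_mean q) U))"

definition correct_step ::
    "(real^'n \<Rightarrow> real^'m) \<Rightarrow> real^'m^'m \<Rightarrow> real^'m \<Rightarrow>
     'n::finite joint_law \<times> (real^'n) set \<Rightarrow> 'n joint_law \<times> (real^'n) set" where
  "correct_step g Sm y = (\<lambda>(q, U). (correction g Sm y q, U))"

primrec corrected ::
    "((real^'n) \<times> real \<Rightarrow> real^'n) \<Rightarrow> (real^'n \<Rightarrow> real^'m) \<Rightarrow> real^'n^'n \<Rightarrow> real^'m^'m \<Rightarrow>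
     (nat \<Rightarrow> real^'m) \<Rightarrow> 'n::finite joint_law \<times> (real^'n) set \<Rightarrow> nat \<Rightarrow>
     'n joint_law \<times> (real^'n) set" where
  "corrected F g Sp Sm y s0 0 = s0"
| "corrected F g Sp Sm y s0 (Suc t) =
     correct_step g Sm (y (Suc t)) (predict_step F Sp (corrected F g Sp Sm y s0 t))"

text \<open>\<open>predicted \<dots> t\<close> is the approximation at time \<open>t + 1\<close> given \<open>y 1, \<dots>, y t\<close>.\<close>

definition predicted ::
    "((real^'n) \<times> real \<Rightarrow> real^'n) \<Rightarrow> (real^'n \<Rightarrow> real^'m) \<Rightarrow> real^'n^'n \<Rightarrow> real^'m^'m \<Rightarrow>
     (nat \<Rightarrow> real^'m) \<Rightarrow> 'n::finite joint_law \<times> (real^'n) set \<Rightarrow> nat \<Rightarrow>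
     'n joint_law \<times> (real^'n) set" where
  "predicted F g Sp Sm y s0 t = predict_step F Sp (corrected F g Sp Sm y s0 t)"

end

theory Submission
  imports Defs
begin

text \<open>
  The invariant is that the approximation \<open>q\<close> has a density with respect to
  \<open>lborel \<Otimes>\<^sub>M GP\<close> of the form \<open>exp (- r (x, u))\<close>, with \<open>r\<close> a quadratic polynomial in the state
  and the inducing values only. Since the density sees \<open>f\<close> only through \<open>u\<close>, the law of the other
  function values given \<open>(x, u)\<close> is that of the prior. The density of \<open>(x, u)\<close> with respect to
  Lebesgue measure is the exponential of \<open>- r\<close> minus the energy \<open>u K\<^sub>u\<^sub>u\<inverse> u / 2\<close> of the prior; the
  invariant also says that this sum is strictly convex, which makes it Gaussian. A correction adds a convex
  quadratic polynomial to \<open>r\<close>. A prediction adds the quadratic exponent of the linearized transition,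
  which involves the one new value \<open>f(\<mu>)\<close>, and integrates out the old state; this preserves
  quadratic exponents, because the partial minimum of a strictly convex quadratic polynomial is again one.
  Only the affine form of the linearizations in \<open>x\<close> and \<open>f(\<mu>)\<close> matters, not their coefficients.
\<close>

section \<open>Determinants, inverses and definiteness over a finite index set\<close>

text \<open>The values of \<open>f\<close> at all inputs have no joint Lebesgue density, so
  densities are taken against the prior law instead. This makes augmentation of the inducing set
  harmless: the exponent \<open>r\<close> stays the same and only the prior energy is read on a
  larger set. Convexity is demanded of \<open>r\<close> together with the prior energy because at
  the start \<open>r\<close> does not involve the inducing values at all. Two explicit computations
  are avoided. Block determinants: the determinant enters only as the normalizer of a Gaussian
  integral, which is computed by integrating out one coordinate at a time, and the product rule for
  normalizers under conditioning is read off from Fubini. Moment formulas: quadratic functions are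
  handled with existentially quantified coefficients, convexity is measured by a second difference,
  and the constant term of \<open>r\<close> is pinned down by total mass one.\<close>

lemma det_on_empty [simp]: "det_on {} S = 1"
  by (simp add: det_on_def)

text \<open>Composing each permutation with the transposition of \<open>a\<close> and
  \<open>k\<close> flips its sign and, the two rows being equal, keeps its product. So the
  determinant is its own negative.\<close>

lemma det_on_identical_rows:
  assumes I: "finite I" "a \<in> I" "k \<in> I" "a \<noteq> k" and eq: "S a = S k"
  shows "det_on I S = 0"
proof -
  let ?t = "Transposition.transpose a k"
  have t: "?t permutes I"
    using I by (intro permutes_swap_id)
  have "det_on I S = (\<Sum>p | p permutes I. of_int (sign (p \<circ> ?t)) * (\<Prod>i\<in>I. S i ((p \<circ> ?t) i)))"
    unfolding det_on_def by (rule sum_permutations_compose_right[OF t])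
  also have "\<dots> = (\<Sum>p | p permutes I. - (of_int (sign p) * (\<Prod>i\<in>I. S i (p i))))"
  proof (intro sum.cong refl)
    fix p assume "p \<in> {p. p permutes I}"
    then have p: "p permutes I" by simp
    have "sign (p \<circ> ?t) = sign p * sign ?t"
      using p t I by (intro sign_compose permutation_permutes[THEN iffD2] exI[of _ I]) auto
    moreover have "(\<Prod>i\<in>I. S i ((p \<circ> ?t) i)) = (\<Prod>i\<in>I. S (?t i) ((p \<circ> ?t) i))"
      using eq by (intro prod.cong) (auto simp: Transposition.transpose_def)
    moreover have "\<dots> = (\<Prod>i\<in>I. S i (p i))"
      using prod.permute[OF t, of "\<lambda>i. S i (p i)"] by (simp add: o_def)
    ultimately show "of_int (sign (p \<circ> ?t)) * (\<Prod>i\<in>I. S i ((p \<circ> ?t) i))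
        = - (of_int (sign p) * (\<Prod>i\<in>I. S i (p i)) :: real)"
      using I by (simp add: sign_swap_id)
  qed
  also have "\<dots> = - det_on I S"
    by (simp add: det_on_def sum_negf)
  finally show ?thesis by simp
qed

text \<open>Expanding the combination puts row \<open>k\<close> in place of row \<open>a\<close>;
  for \<open>k \<noteq> a\<close> this repeats a row, so only the term \<open>k = a\<close>
  survives.\<close>

lemma det_on_row_combination:
  assumes I: "finite I" "a \<in> I"
  shows "det_on I (S(a := \<lambda>j. \<Sum>k\<in>I. c k * S k j)) = c a * det_on I S"
proof -
  have split: "(\<Prod>i\<in>I. (S(a := r)) i (p i)) = r (p a) * (\<Prod>i\<in>I - {a}. S i (p i))" for r p
    by (subst prod.remove[OF I]) (auto intro!: prod.cong)
  have "det_on I (S(a := \<lambda>j. \<Sum>k\<in>I. c k * S k j)) = (\<Sum>k\<in>I. c k * det_on I (S(a := S k)))"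
    unfolding det_on_def split
    by (simp add: sum_distrib_left sum_distrib_right mult_ac, subst sum.swap, simp)
  also have "\<dots> = (\<Sum>k\<in>I. if k = a then c a * det_on I S else 0)"
    by (intro sum.cong refl) (auto simp: fun_upd_idem intro!: det_on_identical_rows[of I a] I)
  also have "\<dots> = c a * det_on I S"
    using I by simp
  finally show ?thesis .
qed

text \<open>A unit row kills every permutation that moves \<open>a\<close>, and those fixing
  \<open>a\<close> are the permutations of \<open>I\<close>.\<close>

lemma det_on_unit_row:
  assumes I: "finite I" "a \<notin> I"
  shows "det_on (insert a I) (S(a := \<lambda>j. of_bool (j = a))) = det_on I S"
proof -
  have "det_on (insert a I) (S(a := \<lambda>j. of_bool (j = a)))
      = (\<Sum>p | p permutes insert a I. of_int (sign p) * (of_bool (p a = a) * (\<Prod>i\<in>I. S i (p i))))"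
    unfolding det_on_def using I
    by (intro sum.cong refl) (auto intro!: prod.cong)
  also have "\<dots> = (\<Sum>p | p permutes I. of_int (sign p) * (\<Prod>i\<in>I. S i (p i)))"
  proof (rule sum.mono_neutral_cong_right)
    show "finite {p. p permutes insert a I}"
      using I by (simp add: finite_permutations)
    show "{p. p permutes I} \<subseteq> {p. p permutes insert a I}"
      by (auto intro: permutes_imp_permutes_insert)
    have "p a \<noteq> a" if "p permutes insert a I" "\<not> p permutes I" for p
      using that permutes_superset[of p "insert a I" I] by auto
    then show "\<forall>p\<in>{p. p permutes insert a I} - {p. p permutes I}.
        of_int (sign p) * (of_bool (p a = a) * (\<Prod>i\<in>I. S i (p i))) = (0 :: real)"
      by auto
  qed (use I in \<open>auto simp: permutes_not_in\<close>)
  finally show ?thesis by (simp add: det_on_def)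
qed

lemma det_on_cong:
  assumes "\<And>i j. i \<in> I \<Longrightarrow> j \<in> I \<Longrightarrow> S i j = T i j"
  shows "det_on I S = det_on I T"
  unfolding det_on_def using assms
  by (intro sum.cong refl arg_cong2[where f = "(*)"] prod.cong) (auto simp: permutes_in_image)

text \<open>Cramer's rule for a diagonal entry of the inverse: row \<open>a\<close> of
  \<open>T\<close> combines the rows of \<open>S\<close> into a unit row. It supplies the ratio of
  determinants when a Gaussian integral loses the coordinate \<open>a\<close>.\<close>

lemma det_on_minor:
  assumes I: "finite I" "a \<notin> I" and inv: "is_inverse_on (insert a I) S T"
  shows "det_on I S = T a a * det_on (insert a I) S"
proof -
  have "det_on I S = det_on (insert a I) (S(a := \<lambda>j. of_bool (j = a)))"
    using det_on_unit_row[OF I] by simp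
  also have "\<dots> = det_on (insert a I) (S(a := \<lambda>j. \<Sum>k\<in>insert a I. T a k * S k j))"
    using inv by (intro det_on_cong) (auto simp: is_inverse_on_def)
  also have "\<dots> = T a a * det_on (insert a I) S"
    using I by (intro det_on_row_combination) auto
  finally show ?thesis .
qed

section \<open>Positive definite forms and Schur complements\<close>

lemma pos_def_on_sym: "pos_def_on I S \<Longrightarrow> i \<in> I \<Longrightarrow> j \<in> I \<Longrightarrow> S i j = S j i"
  unfolding pos_def_on_def by blast

lemma pos_def_on_pos:
  "pos_def_on I S \<Longrightarrow> \<exists>i\<in>I. a i \<noteq> 0 \<Longrightarrow> 0 < (\<Sum>i\<in>I. \<Sum>j\<in>I. a i * S i j * a j)"
  unfolding pos_def_on_def by blast

lemma pos_def_on_nonneg: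
  assumes "pos_def_on I S"
  shows "0 \<le> (\<Sum>i\<in>I. \<Sum>j\<in>I. a i * S i j * a j)"
proof (cases "\<exists>i\<in>I. a i \<noteq> 0")
  case True
  then show ?thesis using pos_def_on_pos[OF assms] by (intro less_imp_le)
qed simp

lemma pos_def_on_subset:
  assumes S: "pos_def_on I S" and I: "finite I" "J \<subseteq> I"
  shows "pos_def_on J S"
  unfolding pos_def_on_def
proof (intro conjI allI impI)
  show "\<forall>i\<in>J. \<forall>j\<in>J. S i j = S j i"
    using pos_def_on_sym[OF S] I by blast
  fix a :: "'a \<Rightarrow> real" assume a: "\<exists>i\<in>J. a i \<noteq> 0"
  define b where "b = (\<lambda>i. if i \<in> J then a i else 0)"
  have "0 < (\<Sum>i\<in>I. \<Sum>j\<in>I. b i * S i j * b j)"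
    using a I by (intro pos_def_on_pos[OF S]) (auto simp: b_def)
  also have "\<dots> = (\<Sum>i\<in>J. \<Sum>j\<in>J. b i * S i j * b j)"
    using I finite_subset[OF I(2,1)]
    by (intro sum.mono_neutral_cong_right) (auto simp: b_def intro!: sum.mono_neutral_cong_right)
  finally show "0 < (\<Sum>i\<in>J. \<Sum>j\<in>J. a i * S i j * a j)"
    by (simp add: b_def)
qed

lemma pos_def_on_diag: "pos_def_on I S \<Longrightarrow> finite I \<Longrightarrow> i \<in> I \<Longrightarrow> 0 < S i i"
  using pos_def_on_pos[of "{i}" S "\<lambda>_. 1"] pos_def_on_subset[of I S "{i}"] by simp

text \<open>Completing the square in the single coordinate \<open>a\<close>; what remains on
  \<open>I\<close> is the Schur complement of the pivot \<open>T a a\<close>.\<close>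

lemma sum_insert_quadratic_form:
  fixes z :: "'i \<Rightarrow> real"
  assumes "finite I" "a \<notin> I" and sym: "\<And>i. i \<in> I \<Longrightarrow> T i a = T a i" and nz: "T a a \<noteq> 0"
  shows "(\<Sum>i\<in>insert a I. \<Sum>j\<in>insert a I. z i * T i j * z j)
     = T a a * (z a + (\<Sum>i\<in>I. T a i * z i) / T a a)\<^sup>2
       + (\<Sum>i\<in>I. \<Sum>j\<in>I. z i * (T i j - T i a * T a j / T a a) * z j)"
proof -
  let ?v = "\<Sum>i\<in>I. T a i * z i"
  have 1: "(\<Sum>i\<in>I. z i * T i a * z a) = z a * ?v" "(\<Sum>j\<in>I. z a * T a j * z j) = z a * ?v"
    using sym by (auto simp: sum_distrib_left mult_ac intro!: sum.cong)
  have "(\<Sum>i\<in>I. \<Sum>j\<in>I. z i * (T i a * T a j / T a a) * z j) = (\<Sum>i\<in>I. \<Sum>j\<in>I. (T a i * z i) * (T a j * z j)) / T a a"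
    unfolding sum_divide_distrib using sym by (intro sum.cong) auto
  also have "\<dots> = ?v\<^sup>2 / T a a"
    by (simp add: sum_product power2_eq_square)
  finally have 2: "(\<Sum>i\<in>I. \<Sum>j\<in>I. z i * (T i a * T a j / T a a) * z j) = ?v\<^sup>2 / T a a" .
  have "(\<Sum>i\<in>I. \<Sum>j\<in>I. z i * (T i j - T i a * T a j / T a a) * z j)
      = (\<Sum>i\<in>I. \<Sum>j\<in>I. z i * T i j * z j) - ?v\<^sup>2 / T a a"
    unfolding 2[symmetric] by (simp add: sum_subtractf algebra_simps)
  moreover have "T a a * (z a + ?v / T a a)\<^sup>2 = T a a * (z a)\<^sup>2 + 2 * (z a * ?v) + ?v\<^sup>2 / T a a"
    using nz by (simp add: power2_eq_square field_simps)
  moreover have "(\<Sum>i\<in>insert a I. \<Sum>j\<in>insert a I. z i * T i j * z j)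
      = T a a * (z a)\<^sup>2 + 2 * (z a * ?v) + (\<Sum>i\<in>I. \<Sum>j\<in>I. z i * T i j * z j)"
    using assms(1,2) by (simp add: sum.distrib 1 power2_eq_square)
  ultimately show ?thesis by simp
qed

lemma pos_def_on_schur:
  assumes T: "pos_def_on (insert a I) T" and I: "finite I" "a \<notin> I"
  shows "pos_def_on I (\<lambda>i j. T i j - T i a * T a j / T a a)"
  unfolding pos_def_on_def
proof (intro conjI allI impI)
  have pos: "T a a > 0" using pos_def_on_diag[OF T] I by auto
  show "\<forall>i\<in>I. \<forall>j\<in>I. T i j - T i a * T a j / T a a = T j i - T j a * T a i / T a a"
    using pos_def_on_sym[OF T] by (auto simp: mult.commute)
  fix z :: "'a \<Rightarrow> real" assume z: "\<exists>i\<in>I. z i \<noteq> 0"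
  \<comment> \<open>This value at \<open>a\<close> minimizes the form for fixed \<open>z\<close> on
    \<open>I\<close>, so the completed square vanishes.\<close>
  define w where "w = z(a := - (\<Sum>i\<in>I. T a i * z i) / T a a)"
  have wz: "i \<in> I \<Longrightarrow> w i = z i" for i using I by (auto simp: w_def)
  have wa: "w a + (\<Sum>i\<in>I. T a i * w i) / T a a = 0"
    using wz by (simp add: w_def)
  have sym: "T i a = T a i" if "i \<in> I" for i
    using pos_def_on_sym[OF T] that by simp
  have "0 < (\<Sum>i\<in>insert a I. \<Sum>j\<in>insert a I. w i * T i j * w j)"
    using z wz by (intro pos_def_on_pos[OF T]) auto
  also have "\<dots> = (\<Sum>i\<in>I. \<Sum>j\<in>I. w i * (T i j - T i a * T a j / T a a) * w j)"
    using sum_insert_quadratic_form[of I a T w] I pos sym by (simp add: wa)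
  finally show "0 < (\<Sum>i\<in>I. \<Sum>j\<in>I. z i * (T i j - T i a * T a j / T a a) * z j)"
    by (simp add: wz)
qed

text \<open>Gaussian elimination. Definiteness makes the pivot positive, and eliminating it leaves a
  definite system for the Schur complement, so \<open>S\<close> and \<open>b\<close> vary in the
  induction.\<close>

lemma pos_def_on_solve:
  assumes "finite I" "pos_def_on I S"
  shows "\<exists>x. \<forall>i\<in>I. (\<Sum>j\<in>I. S i j * x j) = b i"
  using assms
proof (induction I arbitrary: S b rule: finite_induct)
  case (insert a I)
  have pos: "S a a > 0" using pos_def_on_diag[OF insert.prems] insert.hyps by auto
  obtain x where x: "\<And>i. i \<in> I \<Longrightarrow> (\<Sum>j\<in>I. (S i j - S i a * S a j / S a a) * x j) = b i - S i a * b a / S a a"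
    using insert.IH[OF pos_def_on_schur[OF insert.prems insert.hyps], of "\<lambda>i. b i - S i a * b a / S a a"]
    by auto
  \<comment> \<open>Back substitution into the eliminated row \<open>a\<close>.\<close>
  define y where "y = x(a := (b a - (\<Sum>j\<in>I. S a j * x j)) / S a a)"
  have y: "j \<in> I \<Longrightarrow> y j = x j" for j using insert.hyps by (auto simp: y_def)
  have "(\<Sum>j\<in>insert a I. S i j * y j) = b i" if i: "i \<in> insert a I" for i
  proof (cases "i = a")
    case True
    then show ?thesis using insert.hyps pos y by (simp add: y_def field_simps)
  next
    case False
    then have i: "i \<in> I" using i by simp
    have "(\<Sum>j\<in>I. (S i j - S i a * S a j / S a a) * x j)
        = (\<Sum>j\<in>I. S i j * x j) - S i a / S a a * (\<Sum>j\<in>I. S a j * x j)"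
      by (simp add: sum_distrib_left sum_subtractf algebra_simps)
    then show ?thesis using x[OF i] insert.hyps pos y by (simp add: y_def field_simps)
  qed
  then show ?case by blast
qed auto

section \<open>Inverses over a finite index set\<close>

lemma is_inverse_on_mult:
  assumes "finite I" "is_inverse_on I S T" "\<And>i. i \<in> I \<Longrightarrow> (\<Sum>j\<in>I. S i j * x j) = b i" "i \<in> I"
  shows "x i = (\<Sum>j\<in>I. T i j * b j)"
proof -
  have "(\<Sum>j\<in>I. T i j * b j) = (\<Sum>j\<in>I. \<Sum>k\<in>I. T i j * S j k * x k)"
    using assms(3)[symmetric] by (intro sum.cong) (simp_all add: sum_distrib_left mult.assoc)
  also have "\<dots> = (\<Sum>k\<in>I. (\<Sum>j\<in>I. T i j * S j k) * x k)"
    by (subst sum.swap) (simp add: sum_distrib_right)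
  also have "\<dots> = (\<Sum>k\<in>I. of_bool (i = k) * x k)"
    using assms by (intro sum.cong) (auto simp: is_inverse_on_def)
  also have "\<dots> = x i" using assms by simp
  finally show ?thesis by simp
qed

lemma is_inverse_on_commute: "is_inverse_on I S T \<longleftrightarrow> is_inverse_on I T S"
  by (auto simp: is_inverse_on_def)

lemma is_inverse_on_unique:
  assumes "finite I" "is_inverse_on I S T" "is_inverse_on I S R" "i \<in> I" "j \<in> I"
  shows "T i j = R i j"
proof -
  have "R i j = (\<Sum>k\<in>I. T i k * of_bool (k = j))"
    using assms by (intro is_inverse_on_mult[of I S]) (auto simp: is_inverse_on_def)
  then show ?thesis using assms by simp
qed

lemma inv_on_inverse: "invertible_on I S \<Longrightarrow> is_inverse_on I S (inv_on I S)"
  unfolding invertible_on_def inv_on_def by (rule someI_ex[of "is_inverse_on I S"])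

text \<open>Solving for the unit vectors makes \<open>S\<close> times the transpose of
  \<open>T\<close> the identity, since the column index comes first in \<open>T\<close>. Symmetry of
  \<open>S\<close> gives \<open>T S = 1\<close>, and evaluating \<open>T S\<close> times the
  transpose of \<open>T\<close> in two ways shows that \<open>T\<close> is symmetric.\<close>

lemma pos_def_on_invertible:
  assumes I: "finite I" and S: "pos_def_on I S"
  shows "invertible_on I S"
proof -
  have "\<forall>j. \<exists>x. \<forall>i\<in>I. (\<Sum>k\<in>I. S i k * x k) = of_bool (i = j)"
    using pos_def_on_solve[OF assms] by (intro allI)
  then obtain T where T: "\<And>j i. i \<in> I \<Longrightarrow> (\<Sum>k\<in>I. S i k * T j k) = of_bool (i = j)"
    by metis
  have T': "(\<Sum>k\<in>I. T i k * S k j) = of_bool (i = j)" if "j \<in> I" for i j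
    using T[of j i] that pos_def_on_sym[OF S] by (auto simp: mult.commute intro!: sum.cong)
  have sym: "T j i = T i j" if "i \<in> I" "j \<in> I" for i j
  proof -
    have "T j i = (\<Sum>k\<in>I. of_bool (k = i) * T j k)" using I that by simp
    also have "\<dots> = (\<Sum>k\<in>I. (\<Sum>l\<in>I. T i l * S l k) * T j k)"
      using T' by (intro sum.cong) auto
    also have "\<dots> = (\<Sum>l\<in>I. T i l * (\<Sum>k\<in>I. S l k * T j k))"
      by (simp add: sum_distrib_left sum_distrib_right mult_ac, subst sum.swap, simp)
    also have "\<dots> = (\<Sum>l\<in>I. T i l * of_bool (l = j))"
      using T by (intro sum.cong) auto
    also have "\<dots> = T i j" using I that by simp
    finally show ?thesis .
  qed
  have "is_inverse_on I S T"
    unfolding is_inverse_on_def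
  proof (intro ballI conjI)
    fix i j assume ij: "i \<in> I" "j \<in> I"
    show "(\<Sum>k\<in>I. T i k * S k j) = of_bool (i = j)" using T' ij by simp
    have "(\<Sum>k\<in>I. S i k * T k j) = (\<Sum>k\<in>I. S i k * T j k)"
      using sym ij by (intro sum.cong) auto
    then show "(\<Sum>k\<in>I. S i k * T k j) = of_bool (i = j)" using T ij by simp
  qed
  then show ?thesis by (auto simp: invertible_on_def)
qed

text \<open>Substitute \<open>b = T a\<close>: the form of \<open>T\<close> at \<open>a\<close> is
  the form of \<open>S\<close> at \<open>b\<close>. Symmetry holds because the transpose of
  \<open>T\<close> also inverts the symmetric \<open>S\<close>.\<close>

lemma pos_def_on_inverse:
  assumes I: "finite I" and S: "pos_def_on I S" and T: "is_inverse_on I S T"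
  shows "pos_def_on I T"
proof -
  have sym: "T i j = T j i" if "i \<in> I" "j \<in> I" for i j
  proof (rule is_inverse_on_unique[OF I T _ that])
    show "is_inverse_on I S (\<lambda>i j. T j i)"
      unfolding is_inverse_on_def
    proof (intro ballI conjI)
      fix i j assume ij: "i \<in> I" "j \<in> I"
      have "(\<Sum>k\<in>I. S i k * T j k) = (\<Sum>k\<in>I. T j k * S k i)"
        using pos_def_on_sym[OF S] ij by (intro sum.cong) auto
      then show "(\<Sum>k\<in>I. S i k * T j k) = of_bool (i = j)"
        using T ij by (auto simp: is_inverse_on_def)
      have "(\<Sum>k\<in>I. T k i * S k j) = (\<Sum>k\<in>I. S j k * T k i)"
        using pos_def_on_sym[OF S] ij by (intro sum.cong) auto
      then show "(\<Sum>k\<in>I. T k i * S k j) = of_bool (i = j)"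
        using T ij by (auto simp: is_inverse_on_def)
    qed
  qed
  show ?thesis
    unfolding pos_def_on_def
  proof (intro conjI allI impI)
    show "\<forall>i\<in>I. \<forall>j\<in>I. T i j = T j i" using sym by auto
    fix a :: "'a \<Rightarrow> real" assume a: "\<exists>i\<in>I. a i \<noteq> 0"
    define b where "b = (\<lambda>i. \<Sum>j\<in>I. T i j * a j)"
    have ab: "a i = (\<Sum>j\<in>I. S i j * b j)" if "i \<in> I" for i
      using I T that by (intro is_inverse_on_mult[of I T]) (auto simp: b_def is_inverse_on_commute)
    have "\<exists>i\<in>I. b i \<noteq> 0"
    proof (rule ccontr)
      assume "\<not> (\<exists>i\<in>I. b i \<noteq> 0)"
      then have "\<forall>i\<in>I. a i = 0" using ab by simp
      then show False using a by blast
    qed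
    then have "0 < (\<Sum>i\<in>I. \<Sum>j\<in>I. b i * S i j * b j)"
      by (rule pos_def_on_pos[OF S])
    also have "\<dots> = (\<Sum>i\<in>I. b i * a i)"
      using ab by (simp add: sum_distrib_left mult_ac)
    also have "\<dots> = (\<Sum>i\<in>I. \<Sum>j\<in>I. a i * T i j * a j)"
      by (simp add: b_def sum_distrib_left mult_ac)
    finally show "0 < (\<Sum>i\<in>I. \<Sum>j\<in>I. a i * T i j * a j)" .
  qed
qed

section \<open>Conditioning and Gaussian integrals\<close>

text \<open>The kernel comes as semidefinite with invertible matrices, while Gaussian integrals need
  definiteness. If the form vanishes at \<open>a\<close>, moving from \<open>a\<close> against
  \<open>b = S a\<close> would make it negative unless \<open>b = 0\<close>, and invertibility then
  forces \<open>a = 0\<close>.\<close>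

lemma pos_def_onI_semidef:
  assumes I: "finite I" and sym: "\<And>i j. i \<in> I \<Longrightarrow> j \<in> I \<Longrightarrow> S i j = S j i"
    and nonneg: "\<And>a. 0 \<le> (\<Sum>i\<in>I. \<Sum>j\<in>I. a i * S i j * a j)" and inv: "invertible_on I S"
  shows "pos_def_on I S"
  unfolding pos_def_on_def
proof (intro conjI allI impI ballI sym)
  fix a :: "'a \<Rightarrow> real" assume a: "\<exists>i\<in>I. a i \<noteq> 0"
  define b where "b = (\<lambda>i. \<Sum>j\<in>I. S i j * a j)"
  define c where "c = (\<Sum>i\<in>I. (b i)\<^sup>2)"
  define d where "d = (\<Sum>i\<in>I. \<Sum>j\<in>I. b i * S i j * b j)"
  define e where "e = (\<Sum>i\<in>I. \<Sum>j\<in>I. a i * S i j * a j)"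
  have c1: "(\<Sum>i\<in>I. \<Sum>j\<in>I. b i * S i j * a j) = c"
    by (simp add: c_def b_def power2_eq_square sum_distrib_left mult_ac)
  have "(\<Sum>i\<in>I. \<Sum>j\<in>I. a i * S i j * b j) = (\<Sum>j\<in>I. \<Sum>i\<in>I. b j * S j i * a i)"
    by (subst sum.swap) (simp add: sym mult_ac cong: sum.cong)
  then have c2: "(\<Sum>i\<in>I. \<Sum>j\<in>I. a i * S i j * b j) = c" using c1 by simp
  have expand: "(\<Sum>i\<in>I. \<Sum>j\<in>I. (a i + t * b i) * S i j * (a j + t * b j))
      = e + t * (\<Sum>i\<in>I. \<Sum>j\<in>I. a i * S i j * b j) + t * (\<Sum>i\<in>I. \<Sum>j\<in>I. b i * S i j * a j) + t\<^sup>2 * d" for t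
    by (simp add: e_def d_def sum_distrib_left sum.distrib[symmetric] power2_eq_square algebra_simps cong: sum.cong)
  have quad: "0 \<le> e + 2 * t * c + t\<^sup>2 * d" for t
    using nonneg[of "\<lambda>i. a i + t * b i"] unfolding expand c1 c2 by (simp add: mult_ac)
  have "e \<noteq> 0"
  proof
    assume e: "e = 0"
    have "d \<ge> 0" using nonneg by (simp add: d_def)
    have "c \<ge> 0" by (simp add: c_def sum_nonneg)
    \<comment> \<open>The choice \<open>t = - c / d\<close> would minimize the quadratic in
      \<open>t\<close>; the denominator \<open>d + 1\<close> covers \<open>d = 0\<close> and still
      makes the value negative unless \<open>c = 0\<close>.\<close>
    have "0 \<le> 2 * (- c / (d + 1)) * c + (- c / (d + 1))\<^sup>2 * d"
      using quad[of "- c / (d + 1)"] e by simp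
    also have "\<dots> = - (c / (d + 1))\<^sup>2 * (d + 2)"
      using \<open>d \<ge> 0\<close> by (simp add: power2_eq_square divide_simps) (simp add: algebra_simps)
    finally have "(c / (d + 1))\<^sup>2 * (d + 2) \<le> 0" by simp
    then have "c = 0"
      using \<open>d \<ge> 0\<close> by (auto simp: mult_le_0_iff)
    then have b: "b i = 0" if "i \<in> I" for i
      using that I by (simp add: c_def sum_nonneg_eq_0_iff)
    have "a i = 0" if "i \<in> I" for i
      using is_inverse_on_mult[OF I inv_on_inverse[OF inv], of a "\<lambda>_. 0" i] b that
      by (simp add: b_def)
    then show False using a by blast
  qed
  then show "0 < (\<Sum>i\<in>I. \<Sum>j\<in>I. a i * S i j * a j)"
    using nonneg[of a] by (simp add: e_def)
qed

section \<open>Conditioning on a block of coordinates\<close>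

definition cond_mean :: "('i \<Rightarrow> 'i \<Rightarrow> real) \<Rightarrow> 'i set \<Rightarrow> ('i \<Rightarrow> real) \<Rightarrow> 'i \<Rightarrow> real" where
  "cond_mean S U u = (\<lambda>p. \<Sum>v\<in>U. \<Sum>w\<in>U. S p v * inv_on U S v w * u w)"

text \<open>The Schur complement of the block \<open>U\<close>. For \<open>S = K\<close> the two
  definitions are the moments that occur in \<open>gp_conditional\<close>.\<close>

definition cond_cov :: "('i \<Rightarrow> 'i \<Rightarrow> real) \<Rightarrow> 'i set \<Rightarrow> 'i \<Rightarrow> 'i \<Rightarrow> real" where
  "cond_cov S U = (\<lambda>p p'. S p p' - (\<Sum>v\<in>U. \<Sum>w\<in>U. S p v * inv_on U S v w * S w p'))"

lemma cond_cov_sum: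
  "(\<Sum>j\<in>J. cond_cov S U p j * a j)
     = (\<Sum>j\<in>J. S p j * a j) - (\<Sum>v\<in>U. S p v * (\<Sum>w\<in>U. inv_on U S v w * (\<Sum>j\<in>J. S w j * a j)))"
proof -
  have "(\<Sum>j\<in>J. (\<Sum>v\<in>U. \<Sum>w\<in>U. S p v * inv_on U S v w * S w j) * a j)
      = (\<Sum>j\<in>J. \<Sum>v\<in>U. \<Sum>w\<in>U. S p v * (inv_on U S v w * (S w j * a j)))"
    by (simp add: sum_distrib_right mult.assoc)
  also have "\<dots> = (\<Sum>v\<in>U. \<Sum>j\<in>J. \<Sum>w\<in>U. S p v * (inv_on U S v w * (S w j * a j)))"
    by (rule sum.swap)
  also have "\<dots> = (\<Sum>v\<in>U. \<Sum>w\<in>U. \<Sum>j\<in>J. S p v * (inv_on U S v w * (S w j * a j)))"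
    by (intro sum.cong refl sum.swap)
  finally show ?thesis
    by (simp add: cond_cov_def left_diff_distrib sum_subtractf sum_distrib_left)
qed

lemma cond_mean_alt: "cond_mean S U u p = (\<Sum>v\<in>U. S p v * (\<Sum>w\<in>U. inv_on U S v w * u w))"
  by (simp add: cond_mean_def sum_distrib_left mult.assoc)

lemma quadratic_form_alt:
  "(\<Sum>i\<in>I. \<Sum>j\<in>I. a i * S i j * a j) = (\<Sum>i\<in>I. a i * (\<Sum>j\<in>I. S i j * a j :: real))"
  by (simp add: sum_distrib_left mult.assoc)

context
  fixes S :: "'i \<Rightarrow> 'i \<Rightarrow> real" and U J :: "'i set"
  assumes fin: "finite U" "finite J" and disj: "J \<inter> U = {}" and S: "pos_def_on (U \<union> J) S"
begin

lemma pos_def_on_cond: "pos_def_on U S"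
  using fin by (intro pos_def_on_subset[OF S]) auto

lemma inv_on_cond: "is_inverse_on U S (inv_on U S)"
  using fin pos_def_on_cond by (intro inv_on_inverse pos_def_on_invertible)

lemma inv_on_cond_apply:
  assumes "v \<in> U"
  shows "(\<Sum>w\<in>U. S v w * (\<Sum>k\<in>U. inv_on U S w k * b k)) = b v"
  using fin inv_on_cond assms
  by (intro is_inverse_on_mult[of U "inv_on U S" S "b" _ v, symmetric]) (simp_all add: is_inverse_on_commute)

lemma pos_def_on_cond_cov: "pos_def_on J (cond_cov S U)"
  unfolding pos_def_on_def
proof (intro conjI allI impI ballI)
  fix i j assume ij: "i \<in> J" "j \<in> J"
  have symI: "inv_on U S v w = inv_on U S w v" if "v \<in> U" "w \<in> U" for v w
    using pos_def_on_sym[OF pos_def_on_inverse[OF fin(1) pos_def_on_cond inv_on_cond]] that by blast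
  have symS: "S v w = S w v" if "v \<in> U \<union> J" "w \<in> U \<union> J" for v w
    using pos_def_on_sym[OF S] that by blast
  have "(\<Sum>v\<in>U. \<Sum>w\<in>U. S i v * inv_on U S v w * S w j) = (\<Sum>w\<in>U. \<Sum>v\<in>U. S j w * inv_on U S w v * S v i)"
    by (subst sum.swap) (intro sum.cong refl, use ij in \<open>simp add: symI symS mult_ac\<close>)
  then show "cond_cov S U i j = cond_cov S U j i"
    using symS ij by (simp add: cond_cov_def)
next
  fix a :: "'i \<Rightarrow> real" assume a: "\<exists>i\<in>J. a i \<noteq> 0"
  define e where "e = (\<lambda>v. \<Sum>w\<in>U. inv_on U S v w * (\<Sum>j\<in>J. S w j * a j))"
  \<comment> \<open>Extending \<open>a\<close> by minus the solution of the \<open>U\<close> block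
    makes the rows in \<open>U\<close> vanish and leaves the form of the Schur complement on
    \<open>J\<close>.\<close>
  define b where "b = (\<lambda>i. if i \<in> J then a i else - e i)"
  have bJ: "i \<in> J \<Longrightarrow> b i = a i" and bU: "i \<in> U \<Longrightarrow> b i = - e i" for i
    using disj by (auto simp: b_def)
  have sum: "(\<Sum>j\<in>U \<union> J. S i j * b j) = (\<Sum>j\<in>J. S i j * a j) - (\<Sum>v\<in>U. S i v * e v)" for i
    using disj fin bJ bU by (subst sum.union_disjoint) (auto simp: sum_negf)
  have "0 < (\<Sum>i\<in>U \<union> J. \<Sum>j\<in>U \<union> J. b i * S i j * b j)"
    using a bJ by (intro pos_def_on_pos[OF S]) (metis UnI2)
  also have "\<dots> = (\<Sum>i\<in>U. b i * (\<Sum>j\<in>U \<union> J. S i j * b j)) + (\<Sum>i\<in>J. b i * (\<Sum>j\<in>U \<union> J. S i j * b j))"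
    unfolding quadratic_form_alt using fin disj by (intro sum.union_disjoint) auto
  also have "(\<Sum>i\<in>U. b i * (\<Sum>j\<in>U \<union> J. S i j * b j)) = 0"
    using inv_on_cond_apply by (intro sum.neutral) (simp add: sum e_def)
  also have "(\<Sum>i\<in>J. b i * (\<Sum>j\<in>U \<union> J. S i j * b j)) = (\<Sum>i\<in>J. a i * (\<Sum>j\<in>J. cond_cov S U i j * a j))"
    by (intro sum.cong refl) (simp add: bJ sum cond_cov_sum e_def)
  finally show "0 < (\<Sum>i\<in>J. \<Sum>j\<in>J. a i * cond_cov S U i j * a j)"
    by (simp add: quadratic_form_alt)
qed

text \<open>The exponent part of conditioning, without a formula for the block inverse. With
  \<open>a\<close> the solution of \<open>S a = z\<close>, the full form is the pairing of
  \<open>z\<close> with \<open>a\<close>. On \<open>J\<close>, \<open>z\<close> minus the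
  conditional mean is the conditional covariance applied to \<open>a\<close>; on \<open>U\<close>,
  \<open>a\<close> differs by \<open>e\<close> from the solution \<open>d\<close> of the
  \<open>U\<close> block. The two correction terms cancel because \<open>S\<close> is
  symmetric.\<close>

lemma quadratic_form_condition:
  "(\<Sum>i\<in>U \<union> J. \<Sum>j\<in>U \<union> J. z i * inv_on (U \<union> J) S i j * z j)
   = (\<Sum>i\<in>U. \<Sum>j\<in>U. z i * inv_on U S i j * z j)
     + (\<Sum>i\<in>J. \<Sum>j\<in>J. (z i - cond_mean S U z i) * inv_on J (cond_cov S U) i j * (z j - cond_mean S U z j))"
proof -
  let ?C = "cond_cov S U" and ?m = "cond_mean S U z"
  have finUJ: "finite (U \<union> J)" using fin by simp
  have inv: "is_inverse_on (U \<union> J) S (inv_on (U \<union> J) S)"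
    using S finUJ by (intro inv_on_inverse pos_def_on_invertible)
  have invC: "is_inverse_on J ?C (inv_on J ?C)"
    using pos_def_on_cond_cov fin by (intro inv_on_inverse pos_def_on_invertible)
  have symS: "S v w = S w v" if "v \<in> U \<union> J" "w \<in> U \<union> J" for v w
    using pos_def_on_sym[OF S] that by blast
  define a where "a = (\<lambda>i. \<Sum>j\<in>U \<union> J. inv_on (U \<union> J) S i j * z j)"
  have z: "z i = (\<Sum>j\<in>U \<union> J. S i j * a j)" if "i \<in> U \<union> J" for i
    using finUJ inv that
    by (intro is_inverse_on_mult[of "U \<union> J" "inv_on (U \<union> J) S"]) (auto simp: is_inverse_on_commute a_def)
  then have z: "z i = (\<Sum>j\<in>U. S i j * a j) + (\<Sum>j\<in>J. S i j * a j)" if "i \<in> U \<union> J" for i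
    using that fin disj by (subst z) (auto intro!: sum.union_disjoint)
  define d where "d = (\<lambda>v. \<Sum>w\<in>U. inv_on U S v w * z w)"
  define e where "e = (\<lambda>v. \<Sum>w\<in>U. inv_on U S v w * (\<Sum>j\<in>J. S w j * a j))"
  have Sd: "(\<Sum>w\<in>U. S v w * d w) = z v" if "v \<in> U" for v
    unfolding d_def by (rule inv_on_cond_apply[OF that])
  have Se: "(\<Sum>w\<in>U. S v w * e w) = (\<Sum>j\<in>J. S v j * a j)" if "v \<in> U" for v
    unfolding e_def by (rule inv_on_cond_apply[OF that])
  have "a v + e v = d v" if "v \<in> U" for v
    unfolding d_def using fin inv_on_cond that z Se
    by (intro is_inverse_on_mult[of U S]) (auto simp: distrib_left sum.distrib)
  then have d: "d v = a v + e v" if "v \<in> U" for v using that by simp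
  have m: "?m p = (\<Sum>v\<in>U. S p v * d v)" for p
    by (simp add: cond_mean_alt d_def)
  have zm: "z p - ?m p = (\<Sum>j\<in>J. ?C p j * a j)" if "p \<in> J" for p
    using z[of p] that by (simp add: cond_cov_sum m d distrib_left sum.distrib e_def)
  have "a p = (\<Sum>j\<in>J. inv_on J ?C p j * (z j - ?m j))" if "p \<in> J" for p
    using fin invC that zm by (intro is_inverse_on_mult[of J ?C]) auto
  then have R: "(\<Sum>i\<in>J. \<Sum>j\<in>J. (z i - ?m i) * inv_on J ?C i j * (z j - ?m j)) = (\<Sum>p\<in>J. (z p - ?m p) * a p)"
    by (simp add: quadratic_form_alt)
  have U: "(\<Sum>i\<in>U. \<Sum>j\<in>U. z i * inv_on U S i j * z j) = (\<Sum>i\<in>U. z i * d i)"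
    by (simp add: quadratic_form_alt d_def)
  \<comment> \<open>Both sides pair \<open>d\<close> with the part of \<open>S a\<close> on
    \<open>U\<close> that comes from \<open>J\<close>: on \<open>U\<close>, \<open>z\<close> is
    \<open>S d\<close> and \<open>S e\<close> is that part.\<close>
  have "(\<Sum>i\<in>U. z i * e i) = (\<Sum>i\<in>U. \<Sum>w\<in>U. S w i * d w * e i)"
    using symS by (intro sum.cong refl) (simp add: sum_distrib_right flip: Sd)
  also have "\<dots> = (\<Sum>w\<in>U. d w * (\<Sum>i\<in>U. S w i * e i))"
    by (subst sum.swap) (simp add: sum_distrib_left mult_ac)
  also have "\<dots> = (\<Sum>w\<in>U. \<Sum>j\<in>J. S j w * d w * a j)"
    using symS by (intro sum.cong refl) (simp only: Se, simp add: sum_distrib_left mult_ac)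
  also have "\<dots> = (\<Sum>j\<in>J. ?m j * a j)"
    by (subst sum.swap) (simp add: m sum_distrib_right)
  finally have e: "(\<Sum>i\<in>U. z i * e i) = (\<Sum>j\<in>J. ?m j * a j)" .
  have "(\<Sum>i\<in>U \<union> J. \<Sum>j\<in>U \<union> J. z i * inv_on (U \<union> J) S i j * z j) = (\<Sum>i\<in>U \<union> J. z i * a i)"
    by (simp only: quadratic_form_alt a_def)
  also have "\<dots> = (\<Sum>i\<in>U. z i * a i) + (\<Sum>i\<in>J. z i * a i)"
    using fin disj by (intro sum.union_disjoint) auto
  finally show ?thesis
    unfolding R U using e by (simp add: d distrib_left left_diff_distrib sum.distrib sum_subtractf)
qed

end

section \<open>Gaussian integrals\<close>

lemma nn_integral_gaussian_1:
  assumes "\<alpha> > 0"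
  shows "(\<integral>\<^sup>+ t. ennreal (exp (- (\<alpha> * (t - \<mu>)\<^sup>2) / 2)) \<partial>lborel) = ennreal (sqrt (2 * pi / \<alpha>))"
proof -
  define \<sigma> where "\<sigma> = 1 / sqrt \<alpha>"
  have \<sigma>: "\<sigma> > 0" "\<sigma>\<^sup>2 = 1 / \<alpha>" using assms by (auto simp: \<sigma>_def power_divide)
  interpret prob_space "density lborel (normal_density \<mu> \<sigma>)"
    by (rule prob_space_normal_density[OF \<sigma>(1)])
  have "exp (- (\<alpha> * (t - \<mu>)\<^sup>2) / 2) = sqrt (2 * pi / \<alpha>) * normal_density \<mu> \<sigma> t" for t
    using assms by (simp add: normal_density_def \<sigma>)
  then have "(\<integral>\<^sup>+ t. ennreal (exp (- (\<alpha> * (t - \<mu>)\<^sup>2) / 2)) \<partial>lborel)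
      = ennreal (sqrt (2 * pi / \<alpha>)) * (\<integral>\<^sup>+ t. normal_density \<mu> \<sigma> t \<partial>lborel)"
    using assms by (simp add: ennreal_mult nn_integral_cmult)
  also have "(\<integral>\<^sup>+ t. normal_density \<mu> \<sigma> t \<partial>lborel) = 1"
    using emeasure_space_1 by (simp add: emeasure_density)
  finally show ?thesis by simp
qed

lemma ennreal_exp_neg_half_add:
  "ennreal (exp (- (a + b) / 2)) = ennreal (exp (- b / 2)) * ennreal (exp (- a / 2))"
  by (simp add: ennreal_mult'[symmetric] exp_add[symmetric] add_divide_distrib)

text \<open>Dropping the coordinate \<open>a\<close> restricts the covariance \<open>S\<close> but
  replaces the precision \<open>T\<close> by its Schur complement.\<close>

lemma is_inverse_on_schur:
  assumes I: "finite I" "a \<notin> I" and inv: "is_inverse_on (insert a I) S T" and nz: "T a a \<noteq> 0"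
  shows "is_inverse_on I S (\<lambda>i j. T i j - T i a * T a j / T a a)"
  unfolding is_inverse_on_def
proof (intro ballI conjI)
  fix i j assume ij: "i \<in> I" "j \<in> I"
  have ST: "(\<Sum>k\<in>I. S i k * T k l) = of_bool (i = l) - S i a * T a l"
    and TS: "(\<Sum>k\<in>I. T l k * S k j) = of_bool (l = j) - T l a * S a j" if "l \<in> insert a I" for l
    using inv ij that I unfolding is_inverse_on_def by (auto simp: algebra_simps)
  have "(\<Sum>k\<in>I. S i k * (T k j - T k a * T a j / T a a))
      = (\<Sum>k\<in>I. S i k * T k j) - (\<Sum>k\<in>I. S i k * T k a) * T a j / T a a"
    by (simp add: right_diff_distrib sum_subtractf sum_distrib_right sum_divide_distrib mult.assoc)
  also have "\<dots> = of_bool (i = j)"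
    using nz I ij by (auto simp: ST)
  finally show "(\<Sum>k\<in>I. S i k * (T k j - T k a * T a j / T a a)) = of_bool (i = j)" .
  have "(\<Sum>k\<in>I. (T i k - T i a * T a k / T a a) * S k j)
      = (\<Sum>k\<in>I. T i k * S k j) - T i a / T a a * (\<Sum>k\<in>I. T a k * S k j)"
    by (simp add: left_diff_distrib sum_subtractf sum_distrib_left mult.assoc)
  also have "\<dots> = of_bool (i = j)"
    using nz I ij by (auto simp: TS)
  finally show "(\<Sum>k\<in>I. (T i k - T i a * T a k / T a a) * S k j) = of_bool (i = j)" .
qed

interpretation lborel_product: product_sigma_finite "\<lambda>_. lborel :: real measure"
  by standard

text \<open>The coordinate \<open>a\<close> is integrated out as a one-dimensional Gaussian of
  precision \<open>T a a\<close>, and \<open>det_on_minor\<close> turns its factor into the ratio of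
  determinants. The precision varies in the induction, since the remaining integral has the Schur
  complement of \<open>T\<close>, whereas \<open>S\<close> is merely restricted.\<close>

lemma nn_integral_gaussian:
  fixes S T :: "'i \<Rightarrow> 'i \<Rightarrow> real"
  assumes "finite I" "pos_def_on I S" "is_inverse_on I S T"
  shows "0 < det_on I S" (is ?pos)
    and "(\<integral>\<^sup>+ z. ennreal (exp (- (\<Sum>i\<in>I. \<Sum>j\<in>I. (z i - m i) * T i j * (z j - m j)) / 2)) \<partial>Pi\<^sub>M I (\<lambda>_. lborel))
     = ennreal (sqrt ((2 * pi) ^ card I * det_on I S))" (is ?int)
proof -
  have "?pos \<and> ?int" using assms
  proof (induction I arbitrary: T rule: finite_induct)
    case empty
    then show ?case by (simp add: PiM_empty)
  next
    case (insert a I)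
    let ?T' = "\<lambda>i j. T i j - T i a * T a j / T a a"
    have T: "pos_def_on (insert a I) T"
      using insert.hyps insert.prems by (intro pos_def_on_inverse[OF _ insert.prems]) auto
    have pos: "T a a > 0" using pos_def_on_diag[OF T] insert.hyps by auto
    have inv: "is_inverse_on I S ?T'"
      using insert.hyps insert.prems pos by (intro is_inverse_on_schur) auto
    have "pos_def_on I S"
      using insert.hyps by (intro pos_def_on_subset[OF insert.prems(1)]) auto
    note IH = insert.IH[OF this inv]
    have det: "det_on I S = T a a * det_on (insert a I) S"
      using insert.hyps insert.prems by (intro det_on_minor) auto
    have det_pos: "det_on (insert a I) S > 0"
      using IH det pos by (simp add: zero_less_mult_iff)
    let ?f = "\<lambda>z. ennreal (exp (- (\<Sum>i\<in>insert a I. \<Sum>j\<in>insert a I. (z i - m i) * T i j * (z j - m j)) / 2))"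
    let ?g = "\<lambda>z. ennreal (exp (- (\<Sum>i\<in>I. \<Sum>j\<in>I. (z i - m i) * ?T' i j * (z j - m j)) / 2))"
    \<comment> \<open>The conditional mean of coordinate \<open>a\<close> given the others, in terms
      of the precision matrix.\<close>
    let ?\<mu> = "\<lambda>z. m a - (\<Sum>i\<in>I. T a i * (z i - m i)) / T a a"
    have sym: "T i a = T a i" if "i \<in> I" for i
      using pos_def_on_sym[OF T] that by simp
    have f: "?f (z(a := t)) = ?g z * ennreal (exp (- (T a a * (t - ?\<mu> z)\<^sup>2) / 2))" for z t
    proof -
      let ?w = "\<lambda>i. (z(a := t)) i - m i"
      have w: "?w i = z i - m i" if "i \<in> I" for i
        using insert.hyps that by auto
      have "(\<Sum>i\<in>insert a I. \<Sum>j\<in>insert a I. ?w i * T i j * ?w j)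
          = T a a * (?w a + (\<Sum>i\<in>I. T a i * ?w i) / T a a)\<^sup>2 + (\<Sum>i\<in>I. \<Sum>j\<in>I. ?w i * ?T' i j * ?w j)"
        using insert.hyps pos sym by (intro sum_insert_quadratic_form) auto
      also have "(\<Sum>i\<in>I. T a i * ?w i) = (\<Sum>i\<in>I. T a i * (z i - m i))"
        by (intro sum.cong refl) (simp only: w)
      also have "(\<Sum>i\<in>I. \<Sum>j\<in>I. ?w i * ?T' i j * ?w j) = (\<Sum>i\<in>I. \<Sum>j\<in>I. (z i - m i) * ?T' i j * (z j - m j))"
        by (intro sum.cong refl) (simp only: w)
      also have "?w a + (\<Sum>i\<in>I. T a i * (z i - m i)) / T a a = t - ?\<mu> z"
        by simp
      finally show ?thesis
        by (simp only: ennreal_exp_neg_half_add)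
    qed
    have "integral\<^sup>N (Pi\<^sub>M (insert a I) (\<lambda>_. lborel)) ?f
        = (\<integral>\<^sup>+ z. \<integral>\<^sup>+ t. ?f (z(a := t)) \<partial>lborel \<partial>Pi\<^sub>M I (\<lambda>_. lborel))"
      using insert.hyps by (intro lborel_product.product_nn_integral_insert) auto
    also have "\<dots> = (\<integral>\<^sup>+ z. ?g z * ennreal (sqrt (2 * pi / T a a)) \<partial>Pi\<^sub>M I (\<lambda>_. lborel))"
      unfolding f by (subst nn_integral_cmult) (auto simp: nn_integral_gaussian_1[OF pos, simplified])
    also have "\<dots> = ennreal (sqrt ((2 * pi) ^ card I * det_on I S)) * ennreal (sqrt (2 * pi / T a a))"
      using IH by (subst nn_integral_multc) auto
    also have "\<dots> = ennreal (sqrt ((2 * pi) ^ card (insert a I) * det_on (insert a I) S))"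
    proof -
      have "(2 * pi) ^ card I * det_on I S * (2 * pi / T a a) = (2 * pi) ^ card (insert a I) * det_on (insert a I) S"
        using insert.hyps pos by (simp add: det)
      then show ?thesis
        using pos by (subst ennreal_mult''[symmetric]) (auto simp flip: real_sqrt_mult)
    qed
    finally show ?case using det_pos by simp
  qed
  then show ?pos ?int by auto
qed

section \<open>Multivariate normal laws and the prior conditional\<close>

text \<open>Laws are stated over \<open>borel\<close>, densities over \<open>lborel\<close>;
  identifying the sigma-algebras lets measurability proofs pass between them.\<close>

lemma sets_PiM_lborel [measurable_cong, simp]:
  "sets (Pi\<^sub>M I (\<lambda>_. lborel :: real measure)) = sets (Pi\<^sub>M I (\<lambda>_. borel))"
  by (rule sets_PiM_cong) auto

lemma sets_mvn [measurable_cong, simp]: "sets (mvn I m S) = sets (Pi\<^sub>M I (\<lambda>_. borel))"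
  by (simp add: mvn_def)

lemma mvn_density_measurable [measurable]:
  "mvn_density I m S \<in> borel_measurable (Pi\<^sub>M I (\<lambda>_. borel))"
  unfolding mvn_density_def by measurable

lemma nn_integral_mvn:
  assumes "\<phi> \<in> borel_measurable (Pi\<^sub>M I (\<lambda>_. borel))"
  shows "(\<integral>\<^sup>+ z. \<phi> z \<partial>mvn I m S) = (\<integral>\<^sup>+ z. ennreal (mvn_density I m S z) * \<phi> z \<partial>Pi\<^sub>M I (\<lambda>_. lborel))"
  using assms unfolding mvn_def by (subst nn_integral_density) auto

lemma nn_integral_mvn_density:
  assumes I: "finite I" and S: "pos_def_on I S"
  shows "(\<integral>\<^sup>+ z. ennreal (mvn_density I m S z) \<partial>Pi\<^sub>M I (\<lambda>_. lborel)) = 1"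
proof -
  have inv: "is_inverse_on I S (inv_on I S)"
    using I S by (intro inv_on_inverse pos_def_on_invertible)
  note G = nn_integral_gaussian[OF I S inv]
  define c where "c = sqrt ((2 * pi) ^ card I * det_on I S)"
  have c: "c > 0" using G(1) by (simp add: c_def)
  have "(\<integral>\<^sup>+ z. ennreal (mvn_density I m S z) \<partial>Pi\<^sub>M I (\<lambda>_. lborel))
      = (\<integral>\<^sup>+ z. ennreal (exp (- (\<Sum>i\<in>I. \<Sum>j\<in>I. (z i - m i) * inv_on I S i j * (z j - m j)) / 2)) * ennreal (1 / c)
          \<partial>Pi\<^sub>M I (\<lambda>_. lborel))"
    unfolding mvn_density_def c_def[symmetric]
    by (intro nn_integral_cong) (use c in \<open>simp add: ennreal_mult'[symmetric]\<close>)
  also have "\<dots> = ennreal c * ennreal (1 / c)"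
    by (subst nn_integral_multc) (simp_all only: G(2) c_def, measurable)
  also have "\<dots> = 1"
    using c by (simp add: ennreal_mult'[symmetric])
  finally show ?thesis .
qed

lemma prob_space_mvn:
  assumes "finite I" "pos_def_on I S"
  shows "prob_space (mvn I m S)"
proof (rule prob_spaceI)
  have "emeasure (mvn I m S) (space (mvn I m S)) = (\<integral>\<^sup>+ z. 1 \<partial>mvn I m S)"
    by simp
  also have "\<dots> = 1"
    by (subst nn_integral_mvn) (simp_all add: nn_integral_mvn_density[OF assms])
  finally show "emeasure (mvn I m S) (space (mvn I m S)) = 1" .
qed

text \<open>The exponents agree by \<open>quadratic_form_condition\<close>. For the normalizers,
  integrating this identity over all coordinates by Fubini gives the product rule, in place of a
  determinant formula for block matrices.\<close>

lemma mvn_density_condition: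
  assumes fin: "finite U" "finite J" and disj: "J \<inter> U = {}" and S: "pos_def_on (U \<union> J) S"
  shows "mvn_density (U \<union> J) (\<lambda>_. 0) S (merge U J (u, h))
    = mvn_density U (\<lambda>_. 0) S u * mvn_density J (cond_mean S U u) (cond_cov S U) h"
proof -
  let ?E = "\<lambda>I m S z. exp (- (\<Sum>i\<in>I. \<Sum>j\<in>I. (z i - m i) * inv_on I S i j * (z j - m j)) / 2) :: real"
  let ?c = "\<lambda>I S. sqrt ((2 * pi) ^ card I * det_on I S)"
  have dens: "mvn_density I m S z = ?E I m S z / ?c I S" for I m S and z :: "'a \<Rightarrow> real"
    by (simp add: mvn_density_def)
  have finUJ: "finite (U \<union> J)" using fin by simp
  have posU: "pos_def_on U S" and posJ: "pos_def_on J (cond_cov S U)"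
    using pos_def_on_cond[OF fin disj S] pos_def_on_cond_cov[OF fin disj S] by auto
  have G: "0 < ?c I S" "(\<integral>\<^sup>+ z. ennreal (?E I m S z) \<partial>Pi\<^sub>M I (\<lambda>_. lborel)) = ennreal (?c I S)"
    if "finite I" "pos_def_on I S" for I S and m :: "'a \<Rightarrow> real"
    using nn_integral_gaussian[OF that inv_on_inverse[OF pos_def_on_invertible[OF that]]] by simp_all
  have E: "?E (U \<union> J) (\<lambda>_. 0) S (merge U J (u, h)) = ?E U (\<lambda>_. 0) S u * ?E J (cond_mean S U u) (cond_cov S U) h" for u h
  proof -
    let ?z = "merge U J (u, h)"
    have zU: "?z i = u i" if "i \<in> U" for i using that by (simp add: merge_def)
    have zJ: "?z i = h i" if "i \<in> J" for i using that disj by (auto simp: merge_def)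
    have m: "cond_mean S U ?z = cond_mean S U u"
      by (simp add: cond_mean_def fun_eq_iff zU cong: sum.cong)
    show ?thesis
      using quadratic_form_condition[OF fin disj S, of ?z]
      by (simp add: m zU zJ exp_add[symmetric] add_divide_distrib cong: sum.cong)
  qed
  have [measurable]: "(\<lambda>z. ennreal (?E I m S z)) \<in> borel_measurable (Pi\<^sub>M I (\<lambda>_. borel))" for I m S
    by measurable
  have "ennreal (?c (U \<union> J) S) = (\<integral>\<^sup>+ z. ennreal (?E (U \<union> J) (\<lambda>_. 0) S z) \<partial>Pi\<^sub>M (U \<union> J) (\<lambda>_. lborel))"
    by (rule G(2)[OF finUJ S, symmetric])
  also have "\<dots> = (\<integral>\<^sup>+ u. \<integral>\<^sup>+ h. ennreal (?E (U \<union> J) (\<lambda>_. 0) S (merge U J (u, h)))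
      \<partial>Pi\<^sub>M J (\<lambda>_. lborel) \<partial>Pi\<^sub>M U (\<lambda>_. lborel))"
    using fin disj by (intro lborel_product.product_nn_integral_fold) auto
  also have "\<dots> = (\<integral>\<^sup>+ u. ennreal (?E U (\<lambda>_. 0) S u) * ennreal (?c J (cond_cov S U)) \<partial>Pi\<^sub>M U (\<lambda>_. lborel))"
  proof (rule nn_integral_cong)
    fix u
    show "(\<integral>\<^sup>+ h. ennreal (?E (U \<union> J) (\<lambda>_. 0) S (merge U J (u, h))) \<partial>Pi\<^sub>M J (\<lambda>_. lborel))
      = ennreal (?E U (\<lambda>_. 0) S u) * ennreal (?c J (cond_cov S U))"
      unfolding E ennreal_mult'[OF exp_ge_zero] G(2)[OF fin(2) posJ, of "cond_mean S U u", symmetric]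
      by (intro nn_integral_cmult) measurable
  qed
  also have "\<dots> = ennreal (?c U S) * ennreal (?c J (cond_cov S U))"
    unfolding G(2)[OF fin(1) posU, of "\<lambda>_. 0", symmetric]
    by (intro nn_integral_multc) measurable
  also have "\<dots> = ennreal (?c U S * ?c J (cond_cov S U))"
    using G(1)[OF fin(1) posU] by (intro ennreal_mult'[symmetric]) simp
  finally have "?c (U \<union> J) S = ?c U S * ?c J (cond_cov S U)"
    using G(1)[OF finUJ S] G(1)[OF fin(1) posU] G(1)[OF fin(2) posJ]
    by (subst (asm) ennreal_inj) (simp_all only: less_imp_le mult_nonneg_nonneg)
  then show ?thesis
    unfolding dens E by (simp only: times_divide_times_eq)
qed

section \<open>The prior conditional as a probability kernel\<close>

lemma gp_conditional_alt: "gp_conditional K U J u = mvn J (cond_mean K U u) (cond_cov K U)"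
  by (simp add: gp_conditional_def cond_mean_def cond_cov_def)

lemma sets_gp_conditional [simp, measurable_cong]:
  "sets (gp_conditional K U J u) = sets (Pi\<^sub>M J (\<lambda>_. borel))"
  by (simp add: gp_conditional_alt)

lemma mvn_density_cond_measurable [measurable]:
  "(\<lambda>(u, h). mvn_density J (cond_mean K U u) S h) \<in> borel_measurable (Pi\<^sub>M U (\<lambda>_. borel) \<Otimes>\<^sub>M Pi\<^sub>M J (\<lambda>_. borel))"
  unfolding mvn_density_def cond_mean_def by measurable

lemma sigma_finite_PiM_lborel:
  "finite I \<Longrightarrow> sigma_finite_measure (Pi\<^sub>M I (\<lambda>_. lborel :: real measure))"
  by (rule lborel_product.sigma_finite)

text \<open>The measure itself varies with \<open>w\<close>. Rewriting the integral with a jointly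
  measurable density against a fixed Lebesgue measure makes it an ordinary parametrized
  integral.\<close>

lemma nn_integral_gp_conditional_measurable:
  assumes J: "finite J" and \<phi> [measurable]: "(\<lambda>(w, h). \<phi> w h) \<in> borel_measurable (N \<Otimes>\<^sub>M Pi\<^sub>M J (\<lambda>_. borel))"
    and u [measurable]: "u \<in> measurable N (Pi\<^sub>M U (\<lambda>_. borel))"
  shows "(\<lambda>w. \<integral>\<^sup>+ h. \<phi> w h \<partial>gp_conditional K U J (u w)) \<in> borel_measurable N"
proof -
  interpret sigma_finite_measure "Pi\<^sub>M J (\<lambda>_. lborel :: real measure)"
    by (rule sigma_finite_PiM_lborel[OF J])
  have [measurable]: "(\<lambda>(w, h). mvn_density J (cond_mean K U (u w)) (cond_cov K U) h)
      \<in> borel_measurable (N \<Otimes>\<^sub>M Pi\<^sub>M J (\<lambda>_. borel))"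
    using measurable_compose[OF _ mvn_density_cond_measurable, of "\<lambda>(w, h). (u w, h)"] by (simp add: case_prod_beta')
  have "(\<lambda>w. \<integral>\<^sup>+ h. ennreal (mvn_density J (cond_mean K U (u w)) (cond_cov K U) h) * \<phi> w h \<partial>Pi\<^sub>M J (\<lambda>_. lborel))
      \<in> borel_measurable N"
    by measurable
  also have "?this \<longleftrightarrow> ?thesis"
  proof (rule measurable_cong)
    fix w assume "w \<in> space N"
    then have "\<phi> w \<in> borel_measurable (Pi\<^sub>M J (\<lambda>_. borel))"
      using measurable_Pair2[OF \<phi>] by simp
    then show "(\<integral>\<^sup>+ h. ennreal (mvn_density J (cond_mean K U (u w)) (cond_cov K U) h) * \<phi> w h \<partial>Pi\<^sub>M J (\<lambda>_. lborel))
        = (\<integral>\<^sup>+ h. \<phi> w h \<partial>gp_conditional K U J (u w))"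
      by (simp add: gp_conditional_alt nn_integral_mvn)
  qed
  finally show ?thesis .
qed

text \<open>The parameter space \<open>N\<close> and the map \<open>r\<close> are left open so that
  one lemma covers both kernels: the one indexed by \<open>u\<close> alone and the one indexed by
  state and \<open>u\<close>.\<close>

lemma gp_conditional_kernel:
  assumes U: "finite U" and J: "finite J" and disj: "J \<inter> U = {}" and K: "pos_def_on (U \<union> J) K"
    and u [measurable]: "u \<in> measurable N (Pi\<^sub>M U (\<lambda>_. borel))"
    and r [measurable]: "(\<lambda>(w, h). r w h) \<in> measurable (N \<Otimes>\<^sub>M Pi\<^sub>M J (\<lambda>_. borel)) L"
  shows "(\<lambda>w. distr (gp_conditional K U J (u w)) L (r w)) \<in> measurable N (subprob_algebra L)"
proof (rule measurable_subprob_algebra)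
  have r': "r w \<in> measurable (gp_conditional K U J (u w)) L" if "w \<in> space N" for w
    using measurable_Pair2[OF r that] by (simp add: measurable_cong_sets[OF sets_gp_conditional refl])
  fix w assume w: "w \<in> space N"
  interpret prob_space "gp_conditional K U J (u w)"
    unfolding gp_conditional_alt using pos_def_on_cond_cov[OF U J disj K] by (intro prob_space_mvn J)
  show "subprob_space (distr (gp_conditional K U J (u w)) L (r w))"
    using r'[OF w] by (intro prob_space_imp_subprob_space prob_space_distr)
next
  fix A assume A [measurable]: "A \<in> sets L"
  have r': "r w \<in> measurable (gp_conditional K U J (u w)) L" if "w \<in> space N" for w
    using measurable_Pair2[OF r that] by (simp add: measurable_cong_sets[OF sets_gp_conditional refl])
  have "(\<lambda>w. \<integral>\<^sup>+ h. indicator A (r w h) \<partial>gp_conditional K U J (u w)) \<in> borel_measurable N"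
    by (rule nn_integral_gp_conditional_measurable[OF J]) measurable
  also have "?this \<longleftrightarrow> (\<lambda>w. emeasure (distr (gp_conditional K U J (u w)) L (r w)) A) \<in> borel_measurable N"
    by (rule measurable_cong) (simp add: r' nn_integral_distr flip: nn_integral_indicator)
  finally show "(\<lambda>w. emeasure (distr (gp_conditional K U J (u w)) L (r w)) A) \<in> borel_measurable N" .
qed simp

section \<open>Finite-dimensional laws of the Gaussian process\<close>

lemma gaussian_process_pos_def_on:
  assumes "covariance_function K" "\<And>J. finite J \<Longrightarrow> invertible_on J K" "finite J"
  shows "pos_def_on J K"
  using assms by (intro pos_def_onI_semidef) (auto simp: covariance_function_def)

context
  fixes P :: "('p \<Rightarrow> real) measure" and K :: "'p \<Rightarrow> 'p \<Rightarrow> real"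
  assumes GP: "gaussian_process (\<lambda>_. 0) K P"
begin

lemma sets_gaussian_process [measurable_cong]: "sets P = sets (Pi\<^sub>M UNIV (\<lambda>_. borel))"
  using GP by (simp add: gaussian_process_def)

lemma restrict_gaussian_process [measurable]: "(\<lambda>f. restrict f J) \<in> measurable P (Pi\<^sub>M J (\<lambda>_. borel))"
proof -
  have "(\<lambda>f. restrict f J) \<in> measurable (Pi\<^sub>M UNIV (\<lambda>_. borel)) (Pi\<^sub>M J (\<lambda>_. borel))"
    by (rule measurable_restrict_subset) simp
  then show ?thesis by (simp add: measurable_cong_sets[OF sets_gaussian_process refl])
qed

lemma nn_integral_gaussian_process:
  assumes "finite J" "\<phi> \<in> borel_measurable (Pi\<^sub>M J (\<lambda>_. borel))"
  shows "(\<integral>\<^sup>+ f. \<phi> (restrict f J) \<partial>P) = (\<integral>\<^sup>+ z. ennreal (mvn_density J (\<lambda>_. 0) K z) * \<phi> z \<partial>Pi\<^sub>M J (\<lambda>_. lborel))"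
proof -
  have "distr P (Pi\<^sub>M J (\<lambda>_. borel)) (\<lambda>f. restrict f J) = mvn J (\<lambda>_. 0) K"
    using GP assms by (simp add: gaussian_process_def)
  then have "(\<integral>\<^sup>+ z. \<phi> z \<partial>mvn J (\<lambda>_. 0) K) = (\<integral>\<^sup>+ z. \<phi> z \<partial>distr P (Pi\<^sub>M J (\<lambda>_. borel)) (\<lambda>f. restrict f J))"
    by simp
  also have "\<dots> = (\<integral>\<^sup>+ f. \<phi> (restrict f J) \<partial>P)"
    using assms by (intro nn_integral_distr) auto
  finally show ?thesis
    using assms by (simp add: nn_integral_mvn)
qed

text \<open>Disintegration of the prior in integral form, by \<open>mvn_density_condition\<close>
  and Fubini over \<open>U\<close> and \<open>J\<close>. It serves the prior itself with indicators
  for \<open>\<phi>\<close>, and the approximations with an additional density factor.\<close>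

lemma nn_integral_prior_conditional:
  assumes U: "finite U" and J: "finite J" and disj: "J \<inter> U = {}" and K: "pos_def_on (U \<union> J) K"
    and \<phi> [measurable]: "(\<lambda>(u, h). \<phi> u h) \<in> borel_measurable (Pi\<^sub>M U (\<lambda>_. borel) \<Otimes>\<^sub>M Pi\<^sub>M J (\<lambda>_. borel))"
  shows "(\<integral>\<^sup>+ f. \<phi> (restrict f U) (restrict f J) \<partial>P)
    = (\<integral>\<^sup>+ f. \<integral>\<^sup>+ h. \<phi> (restrict f U) h \<partial>gp_conditional K U J (restrict f U) \<partial>P)"
proof -
  let ?m = "cond_mean K U" and ?C = "cond_cov K U"
  have [measurable]: "(\<lambda>f. restrict f U) \<in> measurable (Pi\<^sub>M (U \<union> J) (\<lambda>_. borel)) (Pi\<^sub>M U (\<lambda>_. borel))"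
    "(\<lambda>f. restrict f J) \<in> measurable (Pi\<^sub>M (U \<union> J) (\<lambda>_. borel)) (Pi\<^sub>M J (\<lambda>_. borel))"
    by (auto intro: measurable_restrict_subset)
  have \<phi>u [measurable]: "\<phi> u \<in> borel_measurable (Pi\<^sub>M J (\<lambda>_. borel))" if "u \<in> space (Pi\<^sub>M U (\<lambda>_. borel))" for u
    using measurable_Pair2[OF \<phi> that] by simp
  have "(\<integral>\<^sup>+ f. \<phi> (restrict f U) (restrict f J) \<partial>P)
      = (\<integral>\<^sup>+ f. (\<lambda>z. \<phi> (restrict z U) (restrict z J)) (restrict f (U \<union> J)) \<partial>P)"
    by (simp add: Int_absorb1)
  also have "\<dots> = (\<integral>\<^sup>+ z. ennreal (mvn_density (U \<union> J) (\<lambda>_. 0) K z) * \<phi> (restrict z U) (restrict z J) \<partial>Pi\<^sub>M (U \<union> J) (\<lambda>_. lborel))"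
    using U J by (subst nn_integral_gaussian_process[of "U \<union> J"]) auto
  also have "\<dots> = (\<integral>\<^sup>+ u. \<integral>\<^sup>+ h. ennreal (mvn_density (U \<union> J) (\<lambda>_. 0) K (merge U J (u, h)))
        * \<phi> (restrict (merge U J (u, h)) U) (restrict (merge U J (u, h)) J)
      \<partial>Pi\<^sub>M J (\<lambda>_. lborel) \<partial>Pi\<^sub>M U (\<lambda>_. lborel))"
    using U J disj by (intro lborel_product.product_nn_integral_fold) auto
  also have "\<dots> = (\<integral>\<^sup>+ u. ennreal (mvn_density U (\<lambda>_. 0) K u) * (\<integral>\<^sup>+ h. \<phi> u h \<partial>gp_conditional K U J u) \<partial>Pi\<^sub>M U (\<lambda>_. lborel))"
  proof (rule nn_integral_cong)
    fix u assume u: "u \<in> space (Pi\<^sub>M U (\<lambda>_. lborel :: real measure))"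
    then have u': "u \<in> space (Pi\<^sub>M U (\<lambda>_. borel :: real measure))"
      by (simp add: space_PiM)
    have "(\<integral>\<^sup>+ h. ennreal (mvn_density (U \<union> J) (\<lambda>_. 0) K (merge U J (u, h)))
        * \<phi> (restrict (merge U J (u, h)) U) (restrict (merge U J (u, h)) J) \<partial>Pi\<^sub>M J (\<lambda>_. lborel))
      = (\<integral>\<^sup>+ h. ennreal (mvn_density U (\<lambda>_. 0) K u) * (ennreal (mvn_density J (?m u) ?C h) * \<phi> u h) \<partial>Pi\<^sub>M J (\<lambda>_. lborel))"
    proof (rule nn_integral_cong)
      fix h assume "h \<in> space (Pi\<^sub>M J (\<lambda>_. lborel :: real measure))"
      then have "restrict (merge U J (u, h)) U = u" "restrict (merge U J (u, h)) J = h"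
        using u disj by (auto simp: space_PiM)
      \<comment> \<open>\<open>ennreal\<close> truncates negative numbers, so splitting the product
        needs a sign.\<close>
      moreover have "mvn_density J (?m u) ?C h \<ge> 0"
        using nn_integral_gaussian(1)[OF J, of ?C "inv_on J ?C"] pos_def_on_cond_cov[OF U J disj K] J
        by (simp add: mvn_density_def inv_on_inverse pos_def_on_invertible)
      ultimately show "ennreal (mvn_density (U \<union> J) (\<lambda>_. 0) K (merge U J (u, h)))
          * \<phi> (restrict (merge U J (u, h)) U) (restrict (merge U J (u, h)) J)
        = ennreal (mvn_density U (\<lambda>_. 0) K u) * (ennreal (mvn_density J (?m u) ?C h) * \<phi> u h)"
        by (simp add: mvn_density_condition[OF U J disj K] ennreal_mult'' mult.assoc)
    qed
    also have "\<dots> = ennreal (mvn_density U (\<lambda>_. 0) K u) * (\<integral>\<^sup>+ h. \<phi> u h \<partial>gp_conditional K U J u)"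
      using \<phi>u[OF u'] by (subst nn_integral_cmult) (auto simp: gp_conditional_alt nn_integral_mvn)
    finally show "(\<integral>\<^sup>+ h. ennreal (mvn_density (U \<union> J) (\<lambda>_. 0) K (merge U J (u, h)))
        * \<phi> (restrict (merge U J (u, h)) U) (restrict (merge U J (u, h)) J) \<partial>Pi\<^sub>M J (\<lambda>_. lborel))
      = ennreal (mvn_density U (\<lambda>_. 0) K u) * (\<integral>\<^sup>+ h. \<phi> u h \<partial>gp_conditional K U J u)" .
  qed
  also have "\<dots> = (\<integral>\<^sup>+ f. \<integral>\<^sup>+ h. \<phi> (restrict f U) h \<partial>gp_conditional K U J (restrict f U) \<partial>P)"
    by (rule nn_integral_gaussian_process[OF U, symmetric],
        rule nn_integral_gp_conditional_measurable[OF J]) measurable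
  finally show ?thesis .
qed

lemma is_prior_conditional_gp_conditional:
  assumes U: "finite U" and K: "\<And>J. finite J \<Longrightarrow> pos_def_on J K"
  shows "is_prior_conditional P U (gp_conditional K U)"
  unfolding is_prior_conditional_def
proof (intro allI impI, elim conjE)
  fix J :: "'p set" assume J: "finite J" and disj: "J \<inter> U = {}"
  let ?BU = "Pi\<^sub>M U (\<lambda>_. borel :: real measure)" and ?BJ = "Pi\<^sub>M J (\<lambda>_. borel :: real measure)"
  have K': "pos_def_on (U \<union> J) K" using U J K by simp
  have nonempty: "space P \<noteq> {}"
    using GP by (intro prob_space.not_empty) (simp add: gaussian_process_def)
  have kernel: "(\<lambda>u. distr (gp_conditional K U J u) (?BU \<Otimes>\<^sub>M ?BJ) (\<lambda>h. (u, h)))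
      \<in> measurable (distr P ?BU (\<lambda>f. restrict f U)) (subprob_algebra (?BU \<Otimes>\<^sub>M ?BJ))"
    by (rule gp_conditional_kernel[OF U J disj K']) measurable
  show "distr P (?BU \<Otimes>\<^sub>M ?BJ) (\<lambda>f. (restrict f U, restrict f J)) =
      distr P ?BU (\<lambda>f. restrict f U) \<bind> (\<lambda>u. distr (gp_conditional K U J u) (?BU \<Otimes>\<^sub>M ?BJ) (\<lambda>h. (u, h)))"
    (is "?L = ?R")
  proof (rule measure_eqI)
    show "sets ?L = sets ?R"
      using kernel nonempty by (subst sets_bind[where N = "?BU \<Otimes>\<^sub>M ?BJ"]) (auto simp: sets_kernel)
    fix A assume "A \<in> sets ?L"
    then have A [measurable]: "A \<in> sets (?BU \<Otimes>\<^sub>M ?BJ)" by simp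
    have "emeasure ?L A = (\<integral>\<^sup>+ f. indicator A (restrict f U, restrict f J) \<partial>P)"
      by (subst nn_integral_indicator[symmetric], simp, subst nn_integral_distr) auto
    also have "\<dots> = (\<integral>\<^sup>+ f. \<integral>\<^sup>+ h. indicator A (restrict f U, h) \<partial>gp_conditional K U J (restrict f U) \<partial>P)"
      by (rule nn_integral_prior_conditional[OF U J disj K', of "\<lambda>u h. indicator A (u, h)"]) measurable
    also have "\<dots> = (\<integral>\<^sup>+ u. \<integral>\<^sup>+ h. indicator A (u, h) \<partial>gp_conditional K U J u \<partial>distr P ?BU (\<lambda>f. restrict f U))"
      by (rule nn_integral_distr[symmetric], measurable, rule nn_integral_gp_conditional_measurable[OF J]) measurable
    also have "\<dots> = (\<integral>\<^sup>+ u. emeasure (distr (gp_conditional K U J u) (?BU \<Otimes>\<^sub>M ?BJ) (\<lambda>h. (u, h))) A \<partial>distr P ?BU (\<lambda>f. restrict f U))"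
    proof (rule nn_integral_cong)
      fix u assume u: "u \<in> space (distr P ?BU (\<lambda>f. restrict f U))"
      then have [measurable]: "Pair u \<in> measurable (gp_conditional K U J u) (?BU \<Otimes>\<^sub>M ?BJ)"
        by simp
      show "(\<integral>\<^sup>+ h. indicator A (u, h) \<partial>gp_conditional K U J u)
          = emeasure (distr (gp_conditional K U J u) (?BU \<Otimes>\<^sub>M ?BJ) (\<lambda>h. (u, h))) A"
        by (subst nn_integral_indicator[symmetric], simp, subst nn_integral_distr) auto
    qed
    also have "\<dots> = emeasure ?R A"
      using nonempty by (intro emeasure_bind[OF _ kernel A, symmetric]) simp
    finally show "emeasure ?L A = emeasure ?R A" .
  qed
qed

end

section \<open>Quadratic exponents\<close>

lemma vec_nth_measurable [measurable (raw)]: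
  fixes f :: "'a \<Rightarrow> real^'n"
  assumes "f \<in> borel_measurable M"
  shows "(\<lambda>x. f x $ i) \<in> borel_measurable M"
proof -
  have "(\<lambda>x::real^'n. x $ i) \<in> borel_measurable borel"
    by (intro borel_measurable_continuous_onI continuous_intros)
  then show ?thesis by (rule measurable_compose[OF assms])
qed

lemma ball_Plus_iff: "(\<forall>i\<in>A <+> B. P i) \<longleftrightarrow> (\<forall>a\<in>A. P (Inl a)) \<and> (\<forall>b\<in>B. P (Inr b))"
  by auto

lemma vec_lambda_measurable [measurable]:
  "(\<lambda>f. \<chi> i. f i) \<in> borel_measurable (Pi\<^sub>M (UNIV :: 'n::finite set) (\<lambda>_. borel :: real measure))"
  by (subst borel_measurable_euclidean_space) (auto simp: Basis_vec_def inner_axis)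

lemma vec_lambda_measurable_lborel [measurable, simp]:
  "vec_lambda \<in> borel_measurable (Pi\<^sub>M (UNIV :: 'n::finite set) (\<lambda>_. lborel :: real measure))"
  using vec_lambda_measurable by (simp add: measurable_cong_sets[OF sets_PiM_lborel refl])

text \<open>\<open>lborel\<close> on vectors is determined by boxes along \<open>Basis\<close>,
  whose elements are the unit vectors \<open>axis i 1\<close>. This makes the coordinate formulas
  available for integrals over the state.\<close>

lemma distr_PiM_lborel_vec:
  "distr (Pi\<^sub>M UNIV (\<lambda>_. lborel)) borel (\<lambda>f. \<chi> i. f i) = (lborel :: (real^'n) measure)"
proof (rule lborel_eqI[symmetric])
  let ?D = "distr (Pi\<^sub>M UNIV (\<lambda>_. lborel)) borel (\<lambda>f. \<chi> i. f i) :: (real^'n) measure"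
  fix l u :: "real^'n" assume le: "\<And>b. b \<in> Basis \<Longrightarrow> l \<bullet> b \<le> u \<bullet> b"
  have le': "l $ i \<le> u $ i" for i
    using le[of "axis i 1"] by (auto simp: Basis_vec_def inner_axis)
  have "(\<lambda>f. \<chi> i. f i) -` box l u \<inter> space (Pi\<^sub>M UNIV (\<lambda>_. lborel)) = (\<Pi>\<^sub>E i\<in>UNIV. {l $ i <..< u $ i})"
    by (auto simp: mem_box_cart space_PiM PiE_iff)
  then have "emeasure ?D (box l u) = emeasure (Pi\<^sub>M UNIV (\<lambda>_. lborel)) (\<Pi>\<^sub>E i\<in>UNIV. {l $ i <..< u $ i})"
    by (subst emeasure_distr) auto
  also have "\<dots> = (\<Prod>i\<in>UNIV. ennreal (u $ i - l $ i))"
    using le' by (subst lborel_product.emeasure_PiM) auto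
  also have "\<dots> = ennreal (\<Prod>i\<in>UNIV. u $ i - l $ i)"
    using le' by (intro prod_ennreal) auto
  also have "(\<Prod>i\<in>UNIV. u $ i - l $ i) = (\<Prod>b\<in>Basis. (u - l) \<bullet> b)"
  proof -
    have "(Basis :: (real^'n) set) = range (\<lambda>i. axis i 1)"
      by (auto simp: Basis_vec_def)
    moreover have "inj (\<lambda>i. axis i 1 :: real^'n)"
      by (auto simp: inj_on_def axis_eq_axis)
    ultimately show ?thesis
      by (intro prod.reindex_cong[symmetric]) (auto simp: inner_axis)
  qed
  finally show "emeasure ?D (box l u) = ennreal (\<Prod>b\<in>Basis. (u - l) \<bullet> b)" .
qed simp

lemma nn_integral_lborel_vec:
  fixes \<phi> :: "real^'n \<Rightarrow> ennreal"
  assumes [measurable]: "\<phi> \<in> borel_measurable borel"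
  shows "(\<integral>\<^sup>+ x. \<phi> x \<partial>lborel) = (\<integral>\<^sup>+ z. \<phi> (\<chi> i. z i) \<partial>Pi\<^sub>M UNIV (\<lambda>_. lborel))"
  by (subst distr_PiM_lborel_vec[symmetric], subst nn_integral_distr) auto

lemma emeasure_lborel_vec_box:
  assumes A: "\<And>i. A i \<in> sets borel"
  shows "emeasure lborel {x :: real^'n. \<forall>i. x $ i \<in> A i} = (\<Prod>i\<in>UNIV. emeasure lborel (A i))"
proof -
  have [measurable]: "{x :: real^'n. \<forall>i. x $ i \<in> A i} \<in> sets borel"
  proof -
    have "{x :: real^'n. \<forall>i. x $ i \<in> A i} = {x\<in>space borel. \<forall>i. x $ i \<in> A i}" by simp
    also have "\<dots> \<in> sets borel" using A by measurable
    finally show ?thesis .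
  qed
  have "(\<lambda>f. \<chi> i. f i) -` {x :: real^'n. \<forall>i. x $ i \<in> A i} \<inter> space (Pi\<^sub>M UNIV (\<lambda>_. lborel)) = (\<Pi>\<^sub>E i\<in>UNIV. A i)"
    by (auto simp: space_PiM)
  then show ?thesis
    using A by (subst distr_PiM_lborel_vec[symmetric], subst emeasure_distr) (auto simp: lborel_product.emeasure_PiM)
qed

text \<open>The coordinate map that occurs inside \<open>gaussian_xu\<close>.\<close>

definition join_xu :: "'p set \<Rightarrow> (real^'n) \<times> ('p \<Rightarrow> real) \<Rightarrow> 'n + 'p \<Rightarrow> real" where
  "join_xu U = (\<lambda>(x, u). restrict (case_sum (($) x) u) (UNIV <+> U))"

lemma join_xu_measurable [measurable]:
  fixes U :: "'p set"
  shows "join_xu U \<in> measurable ((borel :: (real^'n) measure) \<Otimes>\<^sub>M Pi\<^sub>M U (\<lambda>_. borel)) (Pi\<^sub>M (UNIV <+> U) (\<lambda>_. borel))"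
  unfolding join_xu_def case_prod_beta'
proof (rule measurable_restrict)
  fix i :: "'n + 'p" assume "i \<in> UNIV <+> U"
  then show "(\<lambda>p. case_sum (($) (fst p)) (snd p) i :: real) \<in> borel_measurable (borel \<Otimes>\<^sub>M Pi\<^sub>M U (\<lambda>_. borel))"
    by (cases i) (auto intro!: vec_nth_measurable measurable_fst)
qed

text \<open>The preimage of a rectangle is again a rectangle with its factors regrouped, and
  rectangles determine a finite product of sigma-finite measures.\<close>

lemma distr_join_xu:
  fixes U :: "'p set"
  assumes U: "finite U"
  shows "distr ((lborel :: (real^'n) measure) \<Otimes>\<^sub>M Pi\<^sub>M U (\<lambda>_. lborel)) (Pi\<^sub>M (UNIV <+> U) (\<lambda>_. borel)) (join_xu U)
    = Pi\<^sub>M (UNIV <+> U) (\<lambda>_. lborel)"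
proof (rule lborel_product.PiM_eqI)
  fix A :: "'n + 'p \<Rightarrow> real set" assume "\<And>i. i \<in> UNIV <+> U \<Longrightarrow> A i \<in> sets lborel"
  then have A: "\<And>i. i \<in> UNIV <+> U \<Longrightarrow> A i \<in> sets borel" by simp
  interpret sigma_finite_measure "Pi\<^sub>M U (\<lambda>_. lborel :: real measure)"
    by (rule sigma_finite_PiM_lborel[OF U])
  have 1: "{x :: real^'n. \<forall>i. x $ i \<in> A (Inl i)} \<in> sets borel"
  proof -
    have "{x :: real^'n. \<forall>i. x $ i \<in> A (Inl i)} = {x\<in>space borel. \<forall>i. x $ i \<in> A (Inl i)}" by simp
    also have "\<dots> \<in> sets borel" using A by measurable auto
    finally show ?thesis .
  qed
  have 2: "Pi\<^sub>E (UNIV <+> U) A \<in> sets (Pi\<^sub>M (UNIV <+> U) (\<lambda>_. borel))"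
    using A U by (intro sets_PiM_I_finite) auto
  have "join_xu U -` Pi\<^sub>E (UNIV <+> U) A \<inter> space ((lborel :: (real^'n) measure) \<Otimes>\<^sub>M Pi\<^sub>M U (\<lambda>_. lborel))
      = {x. \<forall>i. x $ i \<in> A (Inl i)} \<times> Pi\<^sub>E U (\<lambda>p. A (Inr p))"
    by (auto simp: join_xu_def space_pair_measure space_PiM PiE_iff ball_Plus_iff)
  moreover have "join_xu U \<in> measurable ((lborel :: (real^'n) measure) \<Otimes>\<^sub>M Pi\<^sub>M U (\<lambda>_. lborel)) (Pi\<^sub>M (UNIV <+> U) (\<lambda>_. borel))"
    using join_xu_measurable[of U]
    by (subst measurable_cong_sets[OF sets_pair_measure_cong[OF sets_lborel sets_PiM_lborel] refl])
  ultimately have "emeasure (distr ((lborel :: (real^'n) measure) \<Otimes>\<^sub>M Pi\<^sub>M U (\<lambda>_. lborel)) (Pi\<^sub>M (UNIV <+> U) (\<lambda>_. borel)) (join_xu U))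
        (Pi\<^sub>E (UNIV <+> U) A)
      = emeasure (lborel \<Otimes>\<^sub>M Pi\<^sub>M U (\<lambda>_. lborel)) ({x :: real^'n. \<forall>i. x $ i \<in> A (Inl i)} \<times> Pi\<^sub>E U (\<lambda>p. A (Inr p)))"
    using 2 by (subst emeasure_distr) auto
  also have "\<dots> = emeasure lborel {x :: real^'n. \<forall>i. x $ i \<in> A (Inl i)} * emeasure (Pi\<^sub>M U (\<lambda>_. lborel)) (Pi\<^sub>E U (\<lambda>p. A (Inr p)))"
    using 1 A U by (intro emeasure_pair_measure_Times) (auto intro!: sets_PiM_I_finite)
  also have "\<dots> = (\<Prod>i\<in>UNIV. emeasure lborel (A (Inl i))) * (\<Prod>p\<in>U. emeasure lborel (A (Inr p)))"
    using A U by (subst emeasure_lborel_vec_box, auto, subst lborel_product.emeasure_PiM) auto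
  also have "\<dots> = (\<Prod>i\<in>UNIV <+> U. emeasure lborel (A i))"
    using U by (subst prod.Plus) (auto simp: o_def)
  finally show "emeasure (distr ((lborel :: (real^'n) measure) \<Otimes>\<^sub>M Pi\<^sub>M U (\<lambda>_. lborel)) (Pi\<^sub>M (UNIV <+> U) (\<lambda>_. borel)) (join_xu U))
        (Pi\<^sub>E (UNIV <+> U) A) = (\<Prod>i\<in>UNIV <+> U. emeasure lborel (A i))" .
qed (use U in auto)

section \<open>Affine and quadratic functions of finitely many coordinates\<close>

definition affine_on :: "'i set \<Rightarrow> (('i \<Rightarrow> real) \<Rightarrow> real) \<Rightarrow> bool" where
  "affine_on I l \<longleftrightarrow> (\<exists>b c. \<forall>z. l z = (\<Sum>i\<in>I. b i * z i) + c)"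

definition quadratic_on :: "'i set \<Rightarrow> (('i \<Rightarrow> real) \<Rightarrow> real) \<Rightarrow> bool" where
  "quadratic_on I q \<longleftrightarrow>
     (\<exists>Q b c. \<forall>z. q z = (\<Sum>i\<in>I. \<Sum>j\<in>I. z i * Q i j * z j) + (\<Sum>i\<in>I. b i * z i) + c)"

text \<open>Twice the homogeneous quadratic part of \<open>q\<close>, expressed without its coefficients.\<close>

definition curvature :: "(('i \<Rightarrow> real) \<Rightarrow> real) \<Rightarrow> ('i \<Rightarrow> real) \<Rightarrow> real" where
  "curvature q z = q z + q (\<lambda>i. - z i) - 2 * q (\<lambda>_. 0)"

text \<open>For \<open>q\<close> quadratic on \<open>I\<close> this is positive definiteness of the
  Hessian, that is, strict convexity in these coordinates.\<close>

definition pos_curved_on :: "'i set \<Rightarrow> (('i \<Rightarrow> real) \<Rightarrow> real) \<Rightarrow> bool" where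
  "pos_curved_on I q \<longleftrightarrow> (\<forall>z. (\<exists>i\<in>I. z i \<noteq> 0) \<longrightarrow> 0 < curvature q z)"

lemma affine_onI: "(\<And>z. l z = (\<Sum>i\<in>I. b i * z i) + c) \<Longrightarrow> affine_on I l"
  by (auto simp: affine_on_def)

lemma affine_on_const: "affine_on I (\<lambda>_. c)"
  by (rule affine_onI[of _ "\<lambda>_. 0" I c]) simp

lemma affine_on_proj: "finite I \<Longrightarrow> i \<in> I \<Longrightarrow> affine_on I (\<lambda>z. z i)"
  by (rule affine_onI[of _ "\<lambda>j. of_bool (j = i)" I 0]) simp

lemma affine_on_add:
  assumes "affine_on I l" "affine_on I k" shows "affine_on I (\<lambda>z. l z + k z)"
proof -
  obtain b c b' c' where *: "\<And>z. l z = (\<Sum>i\<in>I. b i * z i) + c" "\<And>z. k z = (\<Sum>i\<in>I. b' i * z i) + c'"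
    using assms unfolding affine_on_def by blast
  show ?thesis
    by (rule affine_onI[of _ "\<lambda>i. b i + b' i" I "c + c'"]) (simp add: * distrib_right sum.distrib)
qed

lemma affine_on_cmult: 
  assumes "affine_on I l" shows "affine_on I (\<lambda>z. a * l z)"
proof -
  obtain b c where *: "\<And>z. l z = (\<Sum>i\<in>I. b i * z i) + c"
    using assms unfolding affine_on_def by blast
  show ?thesis
    by (rule affine_onI[of _ "\<lambda>i. a * b i" I "a * c"]) (simp add: * distrib_left sum_distrib_left mult.assoc)
qed

lemma affine_on_diff: "affine_on I l \<Longrightarrow> affine_on I k \<Longrightarrow> affine_on I (\<lambda>z. l z - k z)"
  using affine_on_add[of I l "\<lambda>z. (- 1) * k z"] affine_on_cmult[of I k "- 1"] by simp

lemma affine_on_sum: "(\<And>a. a \<in> A \<Longrightarrow> affine_on I (l a)) \<Longrightarrow> affine_on I (\<lambda>z. \<Sum>a\<in>A. l a z)"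
  by (induction A rule: infinite_finite_induct) (simp_all add: affine_on_const affine_on_add)

lemma affine_on_reflect:
  assumes "affine_on I l" shows "l (\<lambda>i. - z i) = 2 * l (\<lambda>_. 0) - l z"
  using assms unfolding affine_on_def by (auto simp: sum_negf)

lemma quadratic_onI:
  "(\<And>z. q z = (\<Sum>i\<in>I. \<Sum>j\<in>I. z i * Q i j * z j) + (\<Sum>i\<in>I. b i * z i) + c) \<Longrightarrow> quadratic_on I q"
  by (auto simp: quadratic_on_def)

lemma quadratic_on_add:
  assumes "quadratic_on I q" "quadratic_on I r" shows "quadratic_on I (\<lambda>z. q z + r z)"
proof -
  obtain Q b c where 1: "\<And>z. q z = (\<Sum>i\<in>I. \<Sum>j\<in>I. z i * Q i j * z j) + (\<Sum>i\<in>I. b i * z i) + c"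
    using assms unfolding quadratic_on_def by blast
  obtain Q' b' c' where 2: "\<And>z. r z = (\<Sum>i\<in>I. \<Sum>j\<in>I. z i * Q' i j * z j) + (\<Sum>i\<in>I. b' i * z i) + c'"
    using assms unfolding quadratic_on_def by blast
  show ?thesis
    by (rule quadratic_onI[of _ "\<lambda>i j. Q i j + Q' i j" I "\<lambda>i. b i + b' i" "c + c'"])
      (simp add: 1 2 distrib_right distrib_left sum.distrib)
qed

lemma quadratic_on_affine:
  assumes "affine_on I l" shows "quadratic_on I l"
proof -
  obtain b c where *: "\<And>z. l z = (\<Sum>i\<in>I. b i * z i) + c"
    using assms unfolding affine_on_def by blast
  show ?thesis
    by (rule quadratic_onI[of _ "\<lambda>_ _. 0" I b c]) (simp add: *)
qed

lemma quadratic_on_mult: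
  assumes "affine_on I l" "affine_on I k" shows "quadratic_on I (\<lambda>z. l z * k z)"
proof -
  obtain b c b' c' where *: "\<And>z. l z = (\<Sum>i\<in>I. b i * z i) + c" "\<And>z. k z = (\<Sum>i\<in>I. b' i * z i) + c'"
    using assms unfolding affine_on_def by blast
  have "(\<Sum>i\<in>I. \<Sum>j\<in>I. z i * (b i * b' j) * z j) = (\<Sum>i\<in>I. b i * z i) * (\<Sum>i\<in>I. b' i * z i)" for z
    unfolding sum_product by (intro sum.cong refl) simp
  then show ?thesis
    by (intro quadratic_onI[of _ "\<lambda>i j. b i * b' j" I "\<lambda>i. c' * b i + c * b' i" "c * c'"])
      (simp add: * algebra_simps sum.distrib sum_distrib_left)
qed

lemma quadratic_on_sum: "(\<And>a. a \<in> A \<Longrightarrow> quadratic_on I (q a)) \<Longrightarrow> quadratic_on I (\<lambda>z. \<Sum>a\<in>A. q a z)"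
  by (induction A rule: infinite_finite_induct)
    (simp_all add: quadratic_on_affine affine_on_const quadratic_on_add)

lemma quadratic_on_compose:
  assumes q: "quadratic_on A q" and L: "\<And>a. a \<in> A \<Longrightarrow> affine_on I (L a)"
  shows "quadratic_on I (\<lambda>w. q (\<lambda>a. L a w))"
proof -
  obtain Q b c where *: "\<And>z. q z = (\<Sum>i\<in>A. \<Sum>j\<in>A. z i * Q i j * z j) + (\<Sum>i\<in>A. b i * z i) + c"
    using q unfolding quadratic_on_def by blast
  show ?thesis
    unfolding * mult.commute[of _ "Q _ _"]
    by (intro quadratic_on_add quadratic_on_sum quadratic_on_mult quadratic_on_affine
        affine_on_cmult affine_on_const affine_on_sum L)
qed

lemma quadratic_on_mono:
  assumes "quadratic_on I q" "I \<subseteq> J" "finite J" shows "quadratic_on J q"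
  using quadratic_on_compose[OF assms(1), of J "\<lambda>a z. z a"] assms(2,3) by (simp add: affine_on_proj subset_iff)

lemma quadratic_on_cong:
  assumes "quadratic_on I q" "\<And>i. i \<in> I \<Longrightarrow> z i = w i" shows "q z = q w"
proof -
  obtain Q b c where *: "\<And>z. q z = (\<Sum>i\<in>I. \<Sum>j\<in>I. z i * Q i j * z j) + (\<Sum>i\<in>I. b i * z i) + c"
    using assms(1) unfolding quadratic_on_def by blast
  show ?thesis unfolding * using assms(2) by (simp cong: sum.cong)
qed

text \<open>In a second difference of a quadratic the terms linear in \<open>v\<close> cancel, and
  what is left does not involve the centre \<open>a\<close>.\<close>

lemma quadratic_on_shift:
  assumes "quadratic_on I q"
  shows "q (\<lambda>i. a i + v i) + q (\<lambda>i. a i - v i) - 2 * q a = curvature q v"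
proof -
  obtain Q b c where *: "\<And>z. q z = (\<Sum>i\<in>I. \<Sum>j\<in>I. z i * Q i j * z j) + (\<Sum>i\<in>I. b i * z i) + c"
    using assms(1) unfolding quadratic_on_def by blast
  show ?thesis
    unfolding * curvature_def
    by (simp add: algebra_simps sum.distrib sum_negf sum_subtractf)
qed

text \<open>Reflecting \<open>w\<close> reflects \<open>L w\<close> about \<open>L 0\<close>, so the
  left side is a second difference of \<open>q\<close> centred at \<open>L 0\<close>, and by
  \<open>quadratic_on_shift\<close> the centre can be moved to 0.\<close>

lemma curvature_compose:
  assumes q: "quadratic_on A q" and L: "\<And>a. a \<in> A \<Longrightarrow> affine_on I (L a)"
  shows "curvature (\<lambda>w. q (\<lambda>a. L a w)) w = curvature q (\<lambda>a. L a w - L a (\<lambda>_. 0))"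
proof -
  let ?a = "\<lambda>a. L a (\<lambda>_. 0)" and ?v = "\<lambda>a. L a w - L a (\<lambda>_. 0)"
  have "q (\<lambda>a. L a (\<lambda>i. - w i)) = q (\<lambda>a. ?a a - ?v a)"
    by (rule quadratic_on_cong[OF q]) (simp add: affine_on_reflect[OF L])
  moreover have "q (\<lambda>a. L a w) = q (\<lambda>a. ?a a + ?v a)" by simp
  ultimately show ?thesis
    unfolding quadratic_on_shift[OF q, of ?a ?v, symmetric] by (simp add: curvature_def)
qed

lemma curvature_add: "curvature (\<lambda>z. q z + r z) z = curvature q z + curvature r z"
  by (simp add: curvature_def)

text \<open>Symmetrization: \<open>S\<close> is \<open>Q\<close> plus its transpose, that is, the
  Hessian; hence the factor one half in front of its form.\<close>

lemma quadratic_on_normal_form: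
  assumes "quadratic_on I q"
  obtains S b c where "\<And>i j. S i j = S j i"
    "\<And>z. q z = (\<Sum>i\<in>I. \<Sum>j\<in>I. z i * S i j * z j) / 2 + (\<Sum>i\<in>I. b i * z i) + c"
    "\<And>z. curvature q z = (\<Sum>i\<in>I. \<Sum>j\<in>I. z i * S i j * z j)"
proof -
  obtain Q b c where *: "\<And>z. q z = (\<Sum>i\<in>I. \<Sum>j\<in>I. z i * Q i j * z j) + (\<Sum>i\<in>I. b i * z i) + c"
    using assms(1) unfolding quadratic_on_def by blast
  let ?S = "\<lambda>i j. Q i j + Q j i"
  have "(\<Sum>i\<in>I. \<Sum>j\<in>I. z i * Q j i * z j) = (\<Sum>i\<in>I. \<Sum>j\<in>I. z i * Q i j * z j)" for z
    by (subst sum.swap) (simp add: mult_ac)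
  then have S: "(\<Sum>i\<in>I. \<Sum>j\<in>I. z i * ?S i j * z j) = 2 * (\<Sum>i\<in>I. \<Sum>j\<in>I. z i * Q i j * z j)" for z
    by (simp add: distrib_left distrib_right sum.distrib)
  show thesis
  proof
    show "?S i j = ?S j i" for i j by simp
    show "q z = (\<Sum>i\<in>I. \<Sum>j\<in>I. z i * ?S i j * z j) / 2 + (\<Sum>i\<in>I. b i * z i) + c" for z
      by (simp add: S *)
    show "curvature q z = (\<Sum>i\<in>I. \<Sum>j\<in>I. z i * ?S i j * z j)" for z
      by (simp add: S * curvature_def sum_negf)
  qed
qed

section \<open>Completing the square and integrating out a block\<close>

lemma complete_square:
  fixes S :: "'i \<Rightarrow> 'i \<Rightarrow> real"
  assumes sym: "\<And>i j. S i j = S j i" and m: "\<And>i. i \<in> I \<Longrightarrow> (\<Sum>j\<in>I. S i j * m j) = - b i"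
  shows "(\<Sum>i\<in>I. \<Sum>j\<in>I. z i * S i j * z j) / 2 + (\<Sum>i\<in>I. b i * z i)
    = (\<Sum>i\<in>I. \<Sum>j\<in>I. (z i - m i) * S i j * (z j - m j)) / 2 - (\<Sum>i\<in>I. \<Sum>j\<in>I. m i * S i j * m j) / 2"
proof -
  have 1: "(\<Sum>i\<in>I. \<Sum>j\<in>I. z i * S i j * m j) = - (\<Sum>i\<in>I. b i * z i)"
  proof -
    have "(\<Sum>i\<in>I. \<Sum>j\<in>I. z i * S i j * m j) = (\<Sum>i\<in>I. z i * (\<Sum>j\<in>I. S i j * m j))"
      by (simp add: sum_distrib_left mult.assoc)
    also have "\<dots> = (\<Sum>i\<in>I. - (b i * z i))"
      by (intro sum.cong refl) (simp add: m)
    finally show ?thesis by (simp add: sum_negf)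
  qed
  have "(\<Sum>i\<in>I. \<Sum>j\<in>I. m i * S i j * z j) = (\<Sum>i\<in>I. \<Sum>j\<in>I. z i * S i j * m j)"
    by (subst sum.swap, intro sum.cong refl) (simp add: sym mult_ac)
  then have "(\<Sum>i\<in>I. \<Sum>j\<in>I. (z i - m i) * S i j * (z j - m j))
      = (\<Sum>i\<in>I. \<Sum>j\<in>I. z i * S i j * z j) + 2 * (\<Sum>i\<in>I. b i * z i) + (\<Sum>i\<in>I. \<Sum>j\<in>I. m i * S i j * m j)"
    using 1 by (simp add: left_diff_distrib right_diff_distrib sum_subtractf)
  then show ?thesis by (simp add: add_divide_distrib)
qed

lemma pos_curved_on_pos_def:
  assumes "pos_curved_on I q" "\<And>i j. S i j = S j i" "\<And>z. curvature q z = (\<Sum>i\<in>I. \<Sum>j\<in>I. z i * S i j * z j)"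
  shows "pos_def_on I S"
  using assms(1) unfolding pos_curved_on_def pos_def_on_def assms(3) by (intro conjI ballI assms(2))

lemma pos_curved_onD: "pos_curved_on I q \<Longrightarrow> \<exists>i\<in>I. z i \<noteq> 0 \<Longrightarrow> 0 < curvature q z"
  unfolding pos_curved_on_def by blast

text \<open>The Hessian \<open>T\<close> is the precision, its inverse \<open>S\<close> the
  covariance, and the stationary point \<open>m\<close> the mean. The factor \<open>d\<close> left
  by completing the square need not be evaluated, since total mass one forces it to be the
  normalizer.\<close>

lemma is_mvn_exp_quadratic:
  assumes I: "finite I" and q: "quadratic_on I q" and pos: "pos_curved_on I q"
    and one: "(\<integral>\<^sup>+ z. ennreal (exp (- q z)) \<partial>Pi\<^sub>M I (\<lambda>_. lborel)) = 1"
  shows "is_mvn I (density (Pi\<^sub>M I (\<lambda>_. lborel)) (\<lambda>z. ennreal (exp (- q z))))"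
proof -
  obtain T b c where T: "\<And>i j. T i j = T j i"
    and qT: "\<And>z. q z = (\<Sum>i\<in>I. \<Sum>j\<in>I. z i * T i j * z j) / 2 + (\<Sum>i\<in>I. b i * z i) + c"
    and curv: "\<And>z. curvature q z = (\<Sum>i\<in>I. \<Sum>j\<in>I. z i * T i j * z j)"
    using quadratic_on_normal_form[OF q] by blast
  have posT: "pos_def_on I T" by (rule pos_curved_on_pos_def[OF pos T curv])
  obtain S where ST: "is_inverse_on I S T"
    using pos_def_on_invertible[OF I posT] by (auto simp: invertible_on_def is_inverse_on_commute)
  have posS: "pos_def_on I S"
    using pos_def_on_inverse[OF I posT] ST by (simp add: is_inverse_on_commute)
  obtain m where m: "\<And>i. i \<in> I \<Longrightarrow> (\<Sum>j\<in>I. T i j * m j) = - b i"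
    using pos_def_on_solve[OF I posT, of "\<lambda>i. - b i"] by blast
  define d where "d = exp (- (c - (\<Sum>i\<in>I. \<Sum>j\<in>I. m i * T i j * m j) / 2))"
  let ?E = "\<lambda>z. exp (- (\<Sum>i\<in>I. \<Sum>j\<in>I. (z i - m i) * T i j * (z j - m j)) / 2)"
  have eq: "exp (- q z) = d * ?E z" for z
  proof -
    have "(\<Sum>i\<in>I. \<Sum>j\<in>I. z i * T i j * z j) / 2 + (\<Sum>i\<in>I. b i * z i)
      = (\<Sum>i\<in>I. \<Sum>j\<in>I. (z i - m i) * T i j * (z j - m j)) / 2 - (\<Sum>i\<in>I. \<Sum>j\<in>I. m i * T i j * m j) / 2"
      by (rule complete_square) (fact T, erule m)
    then show ?thesis
      unfolding qT d_def exp_add[symmetric] by simp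
  qed
  have "d > 0" by (simp add: d_def)
  have E: "(\<lambda>z. ennreal (?E z)) \<in> borel_measurable (Pi\<^sub>M I (\<lambda>_. lborel))"
    by (subst measurable_cong_sets[OF sets_PiM_lborel refl]) measurable
  have G: "0 < det_on I S" "(\<integral>\<^sup>+ z. ennreal (?E z) \<partial>Pi\<^sub>M I (\<lambda>_. lborel)) = ennreal (sqrt ((2 * pi) ^ card I * det_on I S))"
    using nn_integral_gaussian[OF I posS ST] by auto
  have "1 = (\<integral>\<^sup>+ z. ennreal d * ennreal (?E z) \<partial>Pi\<^sub>M I (\<lambda>_. lborel))"
    unfolding one[symmetric] eq using \<open>d > 0\<close> by (simp add: ennreal_mult')
  also have "\<dots> = ennreal d * ennreal (sqrt ((2 * pi) ^ card I * det_on I S))"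
    unfolding G(2)[symmetric] by (rule nn_integral_cmult[OF E])
  finally have "d * sqrt ((2 * pi) ^ card I * det_on I S) = 1"
    using \<open>d > 0\<close> G(1) by (simp add: ennreal_mult'[symmetric] flip: ennreal_1)
  then have d: "d = 1 / sqrt ((2 * pi) ^ card I * det_on I S)"
    using G(1) by (simp add: field_simps)
  \<comment> \<open>\<open>inv_on\<close> is a chosen inverse and is determined only on
    \<open>I\<close>; there it agrees with \<open>T\<close>.\<close>
  have inv: "inv_on I S i j = T i j" if "i \<in> I" "j \<in> I" for i j
    using is_inverse_on_unique[OF I inv_on_inverse ST that] ST by (auto simp: invertible_on_def)
  have "exp (- q z) = mvn_density I m S z" for z
    unfolding eq d mvn_density_def by (simp add: inv cong: sum.cong)
  then show ?thesis
    using posS by (auto simp: is_mvn_def mvn_def)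
qed

text \<open>Complete the square in \<open>z\<close> for fixed \<open>w\<close>. The precision does
  not depend on \<open>w\<close>, so the Gaussian integral contributes a constant and leaves the
  minimal value of the exponent. That value is kept as \<open>q\<close> at its minimizer, which is
  affine in \<open>w\<close>, so that its curvature can be found by substitution.\<close>

lemma nn_integral_exp_quadratic:
  assumes A: "finite A" and I: "finite I" and q: "quadratic_on (A <+> I) q"
    and pos: "\<And>z. \<exists>a\<in>A. z a \<noteq> 0 \<Longrightarrow> 0 < curvature q (case_sum z (\<lambda>_. 0))"
  shows "\<exists>L c. (\<forall>a\<in>A. affine_on I (L a)) \<and>
    (\<forall>w. (\<integral>\<^sup>+ z. ennreal (exp (- q (case_sum z w))) \<partial>Pi\<^sub>M A (\<lambda>_. lborel))
       = ennreal (exp (- (q (case_sum (\<lambda>a. L a w) w) + c))))"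
proof -
  obtain R b c where R: "\<And>i j. R i j = R j i"
    and qR: "\<And>z. q z = (\<Sum>i\<in>A <+> I. \<Sum>j\<in>A <+> I. z i * R i j * z j) / 2 + (\<Sum>i\<in>A <+> I. b i * z i) + c"
    and curv: "\<And>z. curvature q z = (\<Sum>i\<in>A <+> I. \<Sum>j\<in>A <+> I. z i * R i j * z j)"
    using quadratic_on_normal_form[OF q] by blast
  define T where "T = (\<lambda>a a'. R (Inl a) (Inl a'))"
  \<comment> \<open>The gradient in \<open>z\<close> at \<open>z = 0\<close>, an affine function of
    \<open>w\<close>; all cross terms of \<open>z\<close> and \<open>w\<close> are collected
    here.\<close>
  define B where "B = (\<lambda>w a. b (Inl a) + (\<Sum>i\<in>I. R (Inl a) (Inr i) * w i))"
  have T: "T a a' = T a' a" for a a' by (simp add: T_def R)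
  have posT: "pos_def_on A T"
    unfolding pos_def_on_def
  proof (intro conjI allI impI ballI T)
    fix z :: "'a \<Rightarrow> real" assume "\<exists>a\<in>A. z a \<noteq> 0"
    then show "0 < (\<Sum>a\<in>A. \<Sum>a'\<in>A. z a * T a a' * z a')"
      using pos[of z] A I by (simp add: curv sum.Plus o_def T_def)
  qed
  have RIA: "(\<Sum>i\<in>I. \<Sum>a\<in>A. w i * R (Inr i) (Inl a) * z a) = (\<Sum>a\<in>A. \<Sum>i\<in>I. z a * R (Inl a) (Inr i) * w i)" for z w
    by (subst sum.swap, intro sum.cong refl) (simp add: R mult_ac)
  have BA: "(\<Sum>a\<in>A. B w a * z a) = (\<Sum>a\<in>A. b (Inl a) * z a) + (\<Sum>a\<in>A. \<Sum>i\<in>I. z a * R (Inl a) (Inr i) * w i)" for w z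
    by (simp add: B_def distrib_right distrib_left sum.distrib sum_distrib_right sum_distrib_left mult_ac)
  have split: "q (case_sum z w) = ((\<Sum>a\<in>A. \<Sum>a'\<in>A. z a * T a a' * z a') / 2 + (\<Sum>a\<in>A. B w a * z a)) + q (case_sum (\<lambda>_. 0) w)" for z w
    using A I by (simp add: qR BA sum.Plus o_def sum.distrib RIA T_def)
  obtain S where ST: "is_inverse_on A S T"
    using pos_def_on_invertible[OF A posT] by (auto simp: invertible_on_def is_inverse_on_commute)
  have posS: "pos_def_on A S"
    using pos_def_on_inverse[OF A posT] ST by (simp add: is_inverse_on_commute)
  define L where "L = (\<lambda>a w. \<Sum>a'\<in>A. S a a' * (- B w a'))"
  have L: "(\<Sum>a'\<in>A. T a a' * L a' w) = - B w a" if "a \<in> A" for a w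
    unfolding L_def using A ST that
    by (intro is_inverse_on_mult[of A S T "\<lambda>a. - B w a", symmetric]) auto
  have affL: "affine_on I (L a)" for a
  proof -
    have "affine_on I (\<lambda>w. (- 1) * B w a)" for a
      unfolding B_def using I
      by (intro affine_on_cmult affine_on_add affine_on_const affine_on_sum affine_on_proj)
    then show ?thesis
      unfolding L_def by (intro affine_on_sum affine_on_cmult) simp
  qed
  let ?E = "\<lambda>w z. exp (- (\<Sum>i\<in>A. \<Sum>j\<in>A. (z i - L i w) * T i j * (z j - L j w)) / 2)"
  have sq: "q (case_sum z w) = (\<Sum>i\<in>A. \<Sum>j\<in>A. (z i - L i w) * T i j * (z j - L j w)) / 2
      - (\<Sum>i\<in>A. \<Sum>j\<in>A. L i w * T i j * L j w) / 2 + q (case_sum (\<lambda>_. 0) w)" for z w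
  proof -
    have "(\<Sum>a\<in>A. \<Sum>a'\<in>A. z a * T a a' * z a') / 2 + (\<Sum>a\<in>A. B w a * z a)
      = (\<Sum>i\<in>A. \<Sum>j\<in>A. (z i - L i w) * T i j * (z j - L j w)) / 2 - (\<Sum>i\<in>A. \<Sum>j\<in>A. L i w * T i j * L j w) / 2"
      by (rule complete_square) (fact T, erule L)
    then show ?thesis unfolding split[of z w] by simp
  qed
  have sqL: "q (case_sum z w) = (\<Sum>i\<in>A. \<Sum>j\<in>A. (z i - L i w) * T i j * (z j - L j w)) / 2 + q (case_sum (\<lambda>a. L a w) w)" for z w
    unfolding sq[of z w] sq[of "\<lambda>a. L a w" w] by simp
  have E: "exp (- q (case_sum z w)) = exp (- q (case_sum (\<lambda>a. L a w) w)) * ?E w z" for z w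
    unfolding exp_add[symmetric] by (subst sqL) simp
  have meas: "(\<lambda>z. ennreal (?E w z)) \<in> borel_measurable (Pi\<^sub>M A (\<lambda>_. lborel))" for w
    by (subst measurable_cong_sets[OF sets_PiM_lborel refl]) measurable
  \<comment> \<open>The normalizer is written as an exponential so that it can join the
    exponent.\<close>
  define d where "d = - ln (sqrt ((2 * pi) ^ card A * det_on A S))"
  have d: "sqrt ((2 * pi) ^ card A * det_on A S) = exp (- d)"
    using nn_integral_gaussian(1)[OF A posS ST] by (simp add: d_def)
  have "(\<integral>\<^sup>+ z. ennreal (exp (- q (case_sum z w))) \<partial>Pi\<^sub>M A (\<lambda>_. lborel))
      = ennreal (exp (- (q (case_sum (\<lambda>a. L a w) w) + d)))" for w
  proof -
    have "(\<integral>\<^sup>+ z. ennreal (exp (- q (case_sum z w))) \<partial>Pi\<^sub>M A (\<lambda>_. lborel))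
        = ennreal (exp (- q (case_sum (\<lambda>a. L a w) w))) * (\<integral>\<^sup>+ z. ennreal (?E w z) \<partial>Pi\<^sub>M A (\<lambda>_. lborel))"
      by (rule trans[OF nn_integral_cong nn_integral_cmult[OF meas]])
        (rule arg_cong[where f = ennreal, OF E, THEN trans[OF _ ennreal_mult'[OF exp_ge_zero]]])
    also have "\<dots> = ennreal (exp (- (q (case_sum (\<lambda>a. L a w) w) + d)))"
      unfolding nn_integral_gaussian(2)[OF A posS ST] d ennreal_mult'[OF exp_ge_zero, symmetric] exp_add[symmetric]
      by simp
    finally show ?thesis .
  qed
  then show ?thesis using affL by (intro exI[of _ L] exI[of _ d]) auto
qed

text \<open>
  In the application \<open>k\<close> is the energy of the prior, which is part of the reference measure and not
  of the density \<open>exp (- q)\<close>.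
\<close>

lemma integrate_out_exp_quadratic:
  assumes A: "finite A" and I: "finite I" and q: "quadratic_on (A <+> I) q" and k: "quadratic_on I k"
    and pos: "pos_curved_on (A <+> I) (\<lambda>z. q z + k (\<lambda>i. z (Inr i)))"
  obtains r where "quadratic_on I r" "pos_curved_on I (\<lambda>w. r w + k w)"
    "\<And>w. (\<integral>\<^sup>+ z. ennreal (exp (- q (case_sum z w))) \<partial>Pi\<^sub>M A (\<lambda>_. lborel)) = ennreal (exp (- r w))"
proof -
  let ?h = "\<lambda>z. q z + k (\<lambda>i. z (Inr i))"
  have "0 < curvature q (case_sum z (\<lambda>_. 0))" if "\<exists>a\<in>A. z a \<noteq> 0" for z
  proof -
    have "0 < curvature ?h (case_sum z (\<lambda>_. 0))"
      using that by (intro pos_curved_onD[OF pos]) force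
    \<comment> \<open>On \<open>case_sum z (\<lambda>_. 0)\<close> the term \<open>k\<close> sees
      only zeros and contributes no curvature.\<close>
    then show ?thesis by (simp add: curvature_def)
  qed
  from nn_integral_exp_quadratic[OF A I q this] obtain L c where
    L: "\<And>a. a \<in> A \<Longrightarrow> affine_on I (L a)" and
    int: "\<And>w. (\<integral>\<^sup>+ z. ennreal (exp (- q (case_sum z w))) \<partial>Pi\<^sub>M A (\<lambda>_. lborel))
       = ennreal (exp (- (q (case_sum (\<lambda>a. L a w) w) + c)))"
    by blast
  \<comment> \<open>The substitution that puts the minimizer into the eliminated coordinates and
    keeps the others: \<open>r\<close> is \<open>q\<close> along it up to a constant, and
    \<open>k\<close> is unchanged by it.\<close>
  define M where "M = case_sum L (\<lambda>i w. w i)"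
  have M: "affine_on I (M i)" if "i \<in> A <+> I" for i
    using that L I by (auto simp: M_def affine_on_proj)
  have M_eq: "(\<lambda>i. M i w) = case_sum (\<lambda>a. L a w) w" for w
    by (auto simp: M_def fun_eq_iff split: sum.splits)
  define r where "r = (\<lambda>w. q (\<lambda>i. M i w) + c)"
  have h: "quadratic_on (A <+> I) ?h"
    using A I by (intro quadratic_on_add q quadratic_on_compose[OF k] affine_on_proj) auto
  show thesis
  proof
    show "quadratic_on I r"
      unfolding r_def
      by (intro quadratic_on_add quadratic_on_compose[OF q M] quadratic_on_affine affine_on_const)
    show "(\<integral>\<^sup>+ z. ennreal (exp (- q (case_sum z w))) \<partial>Pi\<^sub>M A (\<lambda>_. lborel)) = ennreal (exp (- r w))" for w
      by (simp add: r_def int M_eq)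
    show "pos_curved_on I (\<lambda>w. r w + k w)"
      unfolding pos_curved_on_def
    proof (intro allI impI)
      fix w :: "'b \<Rightarrow> real" assume w: "\<exists>i\<in>I. w i \<noteq> 0"
      have "curvature (\<lambda>w. r w + k w) w = curvature (\<lambda>w. ?h (\<lambda>i. M i w)) w"
        by (simp add: curvature_def r_def M_def)
      also have "\<dots> = curvature ?h (\<lambda>i. M i w - M i (\<lambda>_. 0))"
        by (rule curvature_compose[OF h M])
      \<comment> \<open>\<open>M\<close> is the identity on the coordinates in \<open>I\<close>, so
        a nonzero \<open>w\<close> gives a nonzero direction.\<close>
      also have "\<dots> > 0"
        using w by (intro pos_curved_onD[OF pos]) (force simp: M_def)
      finally show "0 < curvature (\<lambda>w. r w + k w) w" .
    qed
  qed
qed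

section \<open>The invariant of the recursion\<close>

text \<open>The negative logarithm of a centred Gaussian density when \<open>T\<close> is the
  precision and \<open>c\<close> the logarithm of the normalizer.\<close>

definition energy :: "'i set \<Rightarrow> ('i \<Rightarrow> 'i \<Rightarrow> real) \<Rightarrow> real \<Rightarrow> ('i \<Rightarrow> real) \<Rightarrow> real" where
  "energy A T c v = (\<Sum>i\<in>A. \<Sum>j\<in>A. v i * T i j * v j) / 2 + c"

lemma quadratic_on_energy: "quadratic_on A (energy A T c)"
  by (rule quadratic_onI[of _ "\<lambda>i j. T i j / 2" A "\<lambda>_. 0" c]) (simp add: energy_def sum_divide_distrib)

lemma curvature_energy: "curvature (energy A T c) v = (\<Sum>i\<in>A. \<Sum>j\<in>A. v i * T i j * v j)"
  by (simp add: curvature_def energy_def)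

lemma energy_cong: "(\<And>i. i \<in> A \<Longrightarrow> v i = w i) \<Longrightarrow> energy A T c v = energy A T c w"
  by (rule quadratic_on_cong[OF quadratic_on_energy])

lemma mvn_density_energy:
  assumes "finite I" "pos_def_on I S"
  shows "mvn_density I m S z = exp (- energy I (inv_on I S) (ln (sqrt ((2 * pi) ^ card I * det_on I S))) (\<lambda>i. z i - m i))"
proof -
  have eq: "exp (- a / 2) / s = exp (- (a / 2 + ln s))" if "0 < s" for a s :: real
  proof -
    have "exp (- (a / 2 + ln s)) = exp (- a / 2 - ln s)" by simp
    then show ?thesis using that by (simp only: exp_diff exp_ln)
  qed
  have "0 < sqrt ((2 * pi) ^ card I * det_on I S)"
    using nn_integral_gaussian(1)[OF assms inv_on_inverse[OF pos_def_on_invertible[OF assms]]] by simp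
  then show ?thesis
    unfolding mvn_density_def energy_def by (rule eq)
qed

lemma measurable_quadratic_on:
  assumes q: "quadratic_on I q" and G: "\<And>i. i \<in> I \<Longrightarrow> (\<lambda>w. G w i) \<in> borel_measurable M"
  shows "(\<lambda>w. q (G w)) \<in> borel_measurable M"
proof -
  obtain Q b c where *: "\<And>z. q z = (\<Sum>i\<in>I. \<Sum>j\<in>I. z i * Q i j * z j) + (\<Sum>i\<in>I. b i * z i) + c"
    using q unfolding quadratic_on_def by blast
  show ?thesis
    unfolding * using G by measurable
qed

lemma pos_def_on_inv_on:
  assumes "finite I" "pos_def_on I S"
  shows "pos_def_on I (inv_on I S)"
  by (rule pos_def_on_inverse[OF assms inv_on_inverse[OF pos_def_on_invertible[OF assms]]])

lemma pos_def_inverse: "pos_def S \<Longrightarrow> pos_def_on UNIV (inv_on UNIV (\<lambda>i j. S $ i $ j))"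
  by (rule pos_def_on_inv_on) (simp_all add: pos_def_def)

definition vec_energy :: "real^'d^'d \<Rightarrow> ('d \<Rightarrow> real) \<Rightarrow> real" where
  "vec_energy S = energy UNIV (inv_on UNIV (\<lambda>i j. S $ i $ j))
     (ln (sqrt ((2 * pi) ^ CARD('d) * det_on UNIV (\<lambda>i j. S $ i $ j))))"

lemma mvn_vec_density_energy:
  "pos_def S \<Longrightarrow> mvn_vec_density m S x = exp (- vec_energy S (\<lambda>i. x $ i - m $ i))"
  by (simp add: mvn_vec_density_def mvn_density_energy pos_def_def vec_energy_def)

lemma quadratic_on_vec_energy: "quadratic_on UNIV (vec_energy S)"
  by (simp add: vec_energy_def quadratic_on_energy)

lemma curvature_vec_energy_nonneg: "pos_def S \<Longrightarrow> 0 \<le> curvature (vec_energy S) v"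
  unfolding vec_energy_def curvature_energy by (rule pos_def_on_nonneg[OF pos_def_inverse])

lemma curvature_vec_energy_pos: "pos_def S \<Longrightarrow> v i \<noteq> 0 \<Longrightarrow> 0 < curvature (vec_energy S) v"
  unfolding vec_energy_def curvature_energy by (rule pos_def_on_pos[OF pos_def_inverse]) auto

text \<open>A Gaussian density peaks at its mean; this bounds the likelihood in the correction
  step.\<close>

lemma vec_energy_ge: "pos_def S \<Longrightarrow> vec_energy S (\<lambda>_. 0) \<le> vec_energy S v"
  using pos_def_on_nonneg[OF pos_def_inverse, of S v] by (simp add: vec_energy_def energy_def)

lemma mvn_vec_density_measurable:
  assumes "pos_def S" and [measurable]: "m \<in> borel_measurable M" "x \<in> borel_measurable M"
  shows "(\<lambda>w. mvn_vec_density (m w) S (x w)) \<in> borel_measurable M"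
proof -
  have [measurable]: "(\<lambda>w. vec_energy S (\<lambda>i. x w $ i - m w $ i)) \<in> borel_measurable M"
    by (rule measurable_quadratic_on[OF quadratic_on_vec_energy]) measurable
  show ?thesis
    unfolding mvn_vec_density_energy[OF assms(1)] by measurable
qed

lemma sets_mvn_vec [simp, measurable_cong]: "sets (mvn_vec m S) = sets borel"
  by (simp add: mvn_vec_def)

lemma nn_integral_mvn_vec:
  assumes "pos_def S" and [measurable]: "\<phi> \<in> borel_measurable borel"
  shows "(\<integral>\<^sup>+ x. \<phi> x \<partial>mvn_vec m S) = (\<integral>\<^sup>+ x. ennreal (mvn_vec_density m S x) * \<phi> x \<partial>lborel)"
proof -
  have [measurable]: "(\<lambda>x. mvn_vec_density m S x) \<in> borel_measurable borel"
    by (rule mvn_vec_density_measurable[OF assms(1)]) measurable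
  show ?thesis
    unfolding mvn_vec_def by (rule nn_integral_density) measurable
qed

lemma prob_space_mvn_vec:
  assumes S: "pos_def S"
  shows "prob_space (mvn_vec m S)"
proof (rule prob_spaceI)
  have meas: "(\<lambda>x. ennreal (mvn_vec_density m S x)) \<in> borel_measurable borel"
    by (rule measurable_compose[OF mvn_vec_density_measurable[OF S] measurable_ennreal]) measurable
  have "emeasure (mvn_vec m S) (space (mvn_vec m S)) = (\<integral>\<^sup>+ x. 1 \<partial>mvn_vec m S)"
    by simp
  also have "\<dots> = (\<integral>\<^sup>+ x. ennreal (mvn_vec_density m S x) \<partial>lborel)"
    by (subst nn_integral_mvn_vec[OF S]) simp_all
  also have "\<dots> = (\<integral>\<^sup>+ z. ennreal (mvn_density UNIV (($) m) (\<lambda>i j. S $ i $ j) z) \<partial>Pi\<^sub>M UNIV (\<lambda>_. lborel))"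
  proof -
    have "($) (\<chi> i. z i) = z" for z :: "'a \<Rightarrow> real" by (simp add: fun_eq_iff)
    then show ?thesis
      by (subst nn_integral_lborel_vec[OF meas]) (simp only: mvn_vec_density_def)
  qed
  also have "\<dots> = 1"
    using S by (intro nn_integral_mvn_density) (simp_all add: pos_def_def)
  finally show "emeasure (mvn_vec m S) (space (mvn_vec m S)) = 1" .
qed

text \<open>The normalizer is left out because the invariant uses this term only through its
  curvature, which constants do not affect.\<close>

abbreviation prior_energy :: "('p \<Rightarrow> 'p \<Rightarrow> real) \<Rightarrow> 'p set \<Rightarrow> ('p \<Rightarrow> real) \<Rightarrow> real" where
  "prior_energy K U \<equiv> energy U (inv_on U K) 0"

text \<open>By \<open>quadratic_form_condition\<close>, values at \<open>J\<close> add to the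
  curvature the conditional form at the deviation from the conditional mean. It is nonnegative, and
  it is positive when the old coordinates vanish but some new one does not, for then the conditional
  mean is zero.\<close>

lemma pos_curved_on_prior_extend:
  assumes fin: "finite U" "finite J" and disj: "J \<inter> U = {}" and K: "pos_def_on (U \<union> J) K"
    and r: "quadratic_on (A <+> U) r"
    and pos: "pos_curved_on (A <+> U) (\<lambda>z. r z + prior_energy K U (\<lambda>p. z (Inr p)))"
  shows "pos_curved_on (A <+> (U \<union> J)) (\<lambda>z. r z + prior_energy K (U \<union> J) (\<lambda>p. z (Inr p)))"
  unfolding pos_curved_on_def
proof (intro allI impI)
  fix z :: "'b + 'a \<Rightarrow> real" assume z: "\<exists>i\<in>A <+> (U \<union> J). z i \<noteq> 0"
  let ?u = "\<lambda>p. z (Inr p)" and ?C = "inv_on J (cond_cov K U)"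
  let ?d = "\<Sum>i\<in>J. \<Sum>j\<in>J. (?u i - cond_mean K U ?u i) * ?C i j * (?u j - cond_mean K U ?u j)"
  have C: "pos_def_on J ?C"
    by (rule pos_def_on_inv_on[OF fin(2) pos_def_on_cond_cov[OF fin disj K]])
  have curv: "curvature (\<lambda>z. q z + prior_energy K V (\<lambda>p. z (Inr p))) z
      = curvature q z + (\<Sum>i\<in>V. \<Sum>j\<in>V. ?u i * inv_on V K i j * ?u j)" for q V
    by (simp add: curvature_def energy_def)
  have eq: "curvature (\<lambda>z. r z + prior_energy K (U \<union> J) (\<lambda>p. z (Inr p))) z
      = curvature (\<lambda>z. r z + prior_energy K U (\<lambda>p. z (Inr p))) z + ?d"
    unfolding curv quadratic_form_condition[OF fin disj K] by simp
  show "0 < curvature (\<lambda>z. r z + prior_energy K (U \<union> J) (\<lambda>p. z (Inr p))) z"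
  proof (cases "\<exists>i\<in>A <+> U. z i \<noteq> 0")
    case True
    then show ?thesis
      unfolding eq by (intro add_pos_nonneg pos_curved_onD[OF pos] pos_def_on_nonneg[OF C])
  next
    case False
    then have zero: "\<And>a. a \<in> A \<Longrightarrow> z (Inl a) = 0" "\<And>p. p \<in> U \<Longrightarrow> ?u p = 0"
      by auto
    with z obtain p where p: "p \<in> J" "?u p \<noteq> 0" by auto
    have m: "cond_mean K U ?u i = 0" for i
      using zero by (simp add: cond_mean_def)
    have "r z = r (\<lambda>_. 0)" "r (\<lambda>i. - z i) = r (\<lambda>_. 0)"
      using False by (auto intro!: quadratic_on_cong[OF r])
    then have "curvature (\<lambda>z. r z + prior_energy K U (\<lambda>p. z (Inr p))) z = 0"
      unfolding curv using zero by (simp add: curvature_def)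
    moreover have "0 < ?d"
      using p by (intro pos_def_on_pos[OF C]) (auto simp: m)
    ultimately show ?thesis unfolding eq by simp
  qed
qed


text \<open>\<open>r\<close> is applied to the whole path \<open>f\<close> but, being quadratic on
  \<open>UNIV <+> U\<close>, reads it only on \<open>U\<close>; hence it can stay the same when
  \<open>U\<close> grows. The requirement \<open>prob_space q\<close> fixes its constant
  term.\<close>

definition gaussian_state ::
    "(real^'n \<Rightarrow> real^'n \<Rightarrow> real) \<Rightarrow> (real^'n \<Rightarrow> real) measure \<Rightarrow> (real^'n) set \<Rightarrow> 'n::finite joint_law \<Rightarrow> bool" where
  "gaussian_state K P U q \<longleftrightarrow> finite U \<and> prob_space q \<and>
     (\<exists>r. quadratic_on (UNIV <+> U) r \<and>
       pos_curved_on (UNIV <+> U) (\<lambda>z. r z + prior_energy K U (\<lambda>p. z (Inr p))) \<and>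
       q = density (lborel \<Otimes>\<^sub>M P) (\<lambda>(x, f). ennreal (exp (- r (case_sum (($) x) f)))))"

lemma fst_lborel_measurable [measurable]: "fst \<in> measurable (lborel \<Otimes>\<^sub>M M) borel"
  using measurable_fst[of lborel M] by simp

lemma join_xu_measurable_lborel [measurable]:
  "join_xu U \<in> measurable ((lborel :: (real^'n) measure) \<Otimes>\<^sub>M Pi\<^sub>M U (\<lambda>_. lborel)) (Pi\<^sub>M (UNIV <+> U) (\<lambda>_. borel))"
  using join_xu_measurable[of U]
  by (subst measurable_cong_sets[OF sets_pair_measure_cong[OF sets_lborel sets_PiM_lborel] refl])

text \<open>Paths are measurable coordinate by coordinate; since \<open>r\<close> reads
  \<open>f\<close> only at inputs in \<open>U\<close>, the coordinate projections suffice.\<close>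

lemma measurable_join:
  assumes "quadratic_on (UNIV <+> U) r"
    and [measurable]: "x \<in> borel_measurable M" "f \<in> measurable M (Pi\<^sub>M V (\<lambda>_. borel))" and "U \<subseteq> V"
  shows "(\<lambda>w. ennreal (exp (- r (case_sum (($) (x w)) (f w))))) \<in> borel_measurable M"
proof -
  have "(\<lambda>w. case_sum (($) (x w)) (f w) i) \<in> borel_measurable M" if "i \<in> UNIV <+> U" for i
    using that assms(4) by (cases i) (auto intro!: vec_nth_measurable measurable_component_singleton[THEN measurable_compose[OF assms(3)]])
  from measurable_quadratic_on[OF assms(1) this]
  have [measurable]: "(\<lambda>w. r (case_sum (($) (x w)) (f w))) \<in> borel_measurable M" .
  show ?thesis by measurable
qed

locale gaussian_prior =
  fixes K :: "real^'n \<Rightarrow> real^'n \<Rightarrow> real" and P :: "(real^'n \<Rightarrow> real) measure"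
  assumes GP: "gaussian_process (\<lambda>_. 0) K P"
    and K: "\<And>J. finite J \<Longrightarrow> pos_def_on J K"
begin

lemmas sets_P [measurable_cong] = sets_gaussian_process[OF GP]

lemma prob_space_P: "prob_space P"
  using GP by (simp add: gaussian_process_def)

lemma sigma_finite_P: "sigma_finite_measure P"
  using prob_space_P by (simp add: prob_space_imp_sigma_finite)

lemma restrict_snd_measurable [measurable]:
  "(\<lambda>w. restrict (snd w) U) \<in> measurable (M \<Otimes>\<^sub>M P) (Pi\<^sub>M U (\<lambda>_. borel))"
  by (rule measurable_compose[OF measurable_snd restrict_gaussian_process[OF GP]])

lemma proj_measurable [measurable]:
  "(\<lambda>w. (fst w, restrict (snd w) U)) \<in> measurable (lborel \<Otimes>\<^sub>M P) (borel \<Otimes>\<^sub>M Pi\<^sub>M U (\<lambda>_. borel))"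
  by (rule measurable_Pair[OF _ restrict_snd_measurable]) (rule fst_lborel_measurable)

text \<open>At the start \<open>r\<close> is the energy of the state alone. Its curvature covers the
  state directions, and that of the prior energy covers the directions in \<open>U\<close>.\<close>

lemma gaussian_state_initial:
  assumes U: "finite U" and P0: "pos_def P0"
  shows "gaussian_state K P U (mvn_vec \<mu> P0 \<Otimes>\<^sub>M P)"
proof -
  define r where "r = (\<lambda>z :: 'n + real^'n \<Rightarrow> real. vec_energy P0 (\<lambda>i. z (Inl i) - \<mu> $ i))"
  have aff: "affine_on (UNIV <+> U) (\<lambda>z. z (Inl i) - \<mu> $ i)" for i
    using U by (intro affine_on_diff affine_on_proj affine_on_const) auto
  have r: "quadratic_on (UNIV <+> U) r"
    unfolding r_def by (rule quadratic_on_compose[OF quadratic_on_vec_energy aff])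
  have curv: "curvature r z = curvature (vec_energy P0) (\<lambda>i. z (Inl i))" for z
    unfolding r_def by (subst curvature_compose[OF quadratic_on_vec_energy aff]) simp
  have curvU: "curvature (\<lambda>z :: 'n + real^'n \<Rightarrow> real. prior_energy K U (\<lambda>p. z (Inr p))) z
      = curvature (prior_energy K U) (\<lambda>p. z (Inr p))" for z
    by (simp add: curvature_def)
  have KU: "pos_def_on U (inv_on U K)"
    using U K by (intro pos_def_on_inv_on)
  have nonneg: "0 \<le> curvature (prior_energy K U) u" for u
    unfolding curvature_energy by (rule pos_def_on_nonneg[OF KU])
  have pos: "pos_curved_on (UNIV <+> U) (\<lambda>z. r z + prior_energy K U (\<lambda>p. z (Inr p)))"
    unfolding pos_curved_on_def
  proof (intro allI impI)
    fix z :: "'n + real^'n \<Rightarrow> real" assume z: "\<exists>i\<in>UNIV <+> U. z i \<noteq> 0"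
    show "0 < curvature (\<lambda>z. r z + prior_energy K U (\<lambda>p. z (Inr p))) z"
    proof (cases "\<exists>i. z (Inl i) \<noteq> 0")
      case True
      then obtain i where "z (Inl i) \<noteq> 0" by blast
      then show ?thesis
        unfolding curvature_add curv curvU
        by (intro add_pos_nonneg nonneg curvature_vec_energy_pos[OF P0])
    next
      case False
      with z have "0 < curvature (prior_energy K U) (\<lambda>p. z (Inr p))"
        unfolding curvature_energy by (intro pos_def_on_pos[OF KU]) auto
      then show ?thesis
        unfolding curvature_add curv curvU
        by (intro add_nonneg_pos curvature_vec_energy_nonneg[OF P0])
    qed
  qed
  have "mvn_vec \<mu> P0 \<Otimes>\<^sub>M P = density lborel (\<lambda>x. ennreal (mvn_vec_density \<mu> P0 x)) \<Otimes>\<^sub>M density P (\<lambda>_. 1)"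
    by (simp add: mvn_vec_def density_1)
  also have "\<dots> = density (lborel \<Otimes>\<^sub>M P) (\<lambda>(x, f). ennreal (mvn_vec_density \<mu> P0 x) * 1)"
  proof (rule pair_measure_density)
    show "(\<lambda>x. ennreal (mvn_vec_density \<mu> P0 x)) \<in> borel_measurable lborel"
      by (rule measurable_compose[OF mvn_vec_density_measurable[OF P0] measurable_ennreal]) measurable
    show "sigma_finite_measure (density P (\<lambda>_. 1))"
      unfolding density_1 by (rule sigma_finite_P)
  qed (simp_all add: sigma_finite_P)
  finally have q: "mvn_vec \<mu> P0 \<Otimes>\<^sub>M P = density (lborel \<Otimes>\<^sub>M P) (\<lambda>(x, f). ennreal (exp (- r (case_sum (($) x) f))))"
    by (simp add: mvn_vec_density_energy[OF P0] r_def)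
  have "prob_space (mvn_vec \<mu> P0 \<Otimes>\<^sub>M P)"
    using prob_space_mvn_vec[OF P0] prob_space_P by (rule prob_space_pair)
  then show ?thesis
    unfolding gaussian_state_def using U r pos q by blast
qed

text \<open>Passing from the prior to Lebesgue measure on the coordinates costs the prior density of
  the inducing values as a factor.\<close>

lemma nn_integral_lborel_P_join:
  assumes U: "finite U" and \<phi> [measurable]: "\<phi> \<in> borel_measurable (Pi\<^sub>M (UNIV <+> U) (\<lambda>_. borel))"
  shows "(\<integral>\<^sup>+ w. \<phi> (join_xu U (fst w, restrict (snd w) U)) \<partial>((lborel :: (real^'n) measure) \<Otimes>\<^sub>M P))
    = (\<integral>\<^sup>+ z. ennreal (mvn_density U (\<lambda>_. 0) K (\<lambda>p. z (Inr p))) * \<phi> z \<partial>Pi\<^sub>M (UNIV <+> U) (\<lambda>_. lborel))"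
proof -
  interpret P: sigma_finite_measure P by (rule sigma_finite_P)
  interpret PU: sigma_finite_measure "Pi\<^sub>M U (\<lambda>_. lborel :: real measure)"
    by (rule sigma_finite_PiM_lborel[OF U])
  have [measurable]: "(\<lambda>f. restrict f U) \<in> measurable P (Pi\<^sub>M U (\<lambda>_. borel))"
    by (rule restrict_gaussian_process[OF GP])
  have "(\<integral>\<^sup>+ w. \<phi> (join_xu U (fst w, restrict (snd w) U)) \<partial>((lborel :: (real^'n) measure) \<Otimes>\<^sub>M P))
      = (\<integral>\<^sup>+ x. \<integral>\<^sup>+ f. \<phi> (join_xu U (x, restrict f U)) \<partial>P \<partial>lborel)"
  proof -
    have "(\<lambda>w. \<phi> (join_xu U (fst w, restrict (snd w) U))) \<in> borel_measurable ((lborel :: (real^'n) measure) \<Otimes>\<^sub>M P)"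
      by (rule measurable_compose[OF measurable_compose[OF proj_measurable join_xu_measurable] \<phi>])
    then show ?thesis by (subst P.nn_integral_fst[symmetric]) simp_all
  qed
  also have "\<dots> = (\<integral>\<^sup>+ x. \<integral>\<^sup>+ u. ennreal (mvn_density U (\<lambda>_. 0) K u) * \<phi> (join_xu U (x, u)) \<partial>Pi\<^sub>M U (\<lambda>_. lborel) \<partial>lborel)"
    by (intro nn_integral_cong nn_integral_gaussian_process[OF GP U, of "\<lambda>u. \<phi> (join_xu U (x, u))" for x]) measurable
  also have "\<dots> = (\<integral>\<^sup>+ w. ennreal (mvn_density U (\<lambda>_. 0) K (snd w)) * \<phi> (join_xu U w) \<partial>(lborel \<Otimes>\<^sub>M Pi\<^sub>M U (\<lambda>_. lborel)))"
  proof -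
    have "(\<lambda>w. mvn_density U (\<lambda>_. 0) K (snd w)) \<in> borel_measurable ((lborel :: (real^'n) measure) \<Otimes>\<^sub>M Pi\<^sub>M U (\<lambda>_. lborel))"
      by (rule measurable_compose[OF measurable_snd]) (simp add: measurable_cong_sets[OF sets_PiM_lborel refl])
    moreover have "(\<lambda>w. \<phi> (join_xu U w)) \<in> borel_measurable ((lborel :: (real^'n) measure) \<Otimes>\<^sub>M Pi\<^sub>M U (\<lambda>_. lborel))"
      by (rule measurable_compose[OF join_xu_measurable_lborel \<phi>])
    ultimately show ?thesis by (subst PU.nn_integral_fst[symmetric]) simp_all
  qed
  also have "\<dots> = (\<integral>\<^sup>+ w. ennreal (mvn_density U (\<lambda>_. 0) K (\<lambda>p. join_xu U w (Inr p))) * \<phi> (join_xu U w) \<partial>(lborel \<Otimes>\<^sub>M Pi\<^sub>M U (\<lambda>_. lborel)))"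
  proof (intro nn_integral_cong arg_cong2[where f = "(*)"] arg_cong[where f = ennreal] refl)
    fix w :: "(real^'n) \<times> (real^'n \<Rightarrow> real)"
    show "mvn_density U (\<lambda>_. 0) K (snd w) = mvn_density U (\<lambda>_. 0) K (\<lambda>p. join_xu U w (Inr p))"
      unfolding mvn_density_energy[OF U K[OF U]]
      by (intro arg_cong[where f = exp] arg_cong[where f = uminus] energy_cong)
        (auto simp: join_xu_def split: prod.splits)
  qed
  also have "\<dots> = (\<integral>\<^sup>+ z. ennreal (mvn_density U (\<lambda>_. 0) K (\<lambda>p. z (Inr p))) * \<phi> z \<partial>Pi\<^sub>M (UNIV <+> U) (\<lambda>_. lborel))"
  proof -
    have [measurable]: "(\<lambda>z. mvn_density U (\<lambda>_. 0) K (\<lambda>p. z (Inr p))) \<in> borel_measurable (Pi\<^sub>M (UNIV <+> U) (\<lambda>_. borel))"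
      unfolding mvn_density_energy[OF U K[OF U]]
      by (intro measurable_compose[OF _ borel_measurable_exp] borel_measurable_uminus
          measurable_quadratic_on[OF quadratic_on_energy])
        (auto intro!: borel_measurable_diff measurable_component_singleton)
    show ?thesis
      by (subst distr_join_xu[OF U, symmetric], subst nn_integral_distr[OF join_xu_measurable_lborel])
        (simp_all, measurable)
  qed
  finally show ?thesis .
qed

section \<open>Gaussian marginals and factorization from the invariant\<close>

lemma gaussian_state_gaussian_xu:
  assumes q: "gaussian_state K P U q"
  shows "gaussian_xu U (marginal_xu U q)"
proof -
  obtain r where U: "finite U" and prob: "prob_space q" and r: "quadratic_on (UNIV <+> U) r"
    and pos: "pos_curved_on (UNIV <+> U) (\<lambda>z. r z + prior_energy K U (\<lambda>p. z (Inr p)))"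
    and q_def: "q = density (lborel \<Otimes>\<^sub>M P) (\<lambda>(x, f). ennreal (exp (- r (case_sum (($) x) f))))"
    using q unfolding gaussian_state_def by blast
  let ?I = "UNIV <+> U :: ('n + real^'n) set"
  let ?B = "Pi\<^sub>M ?I (\<lambda>_. borel :: real measure)"
  \<comment> \<open>The prior normalizer that \<open>prior_energy\<close> leaves out; with it,
    \<open>s\<close> is the exact negative log-density of state and inducing values.\<close>
  define c where "c = ln (sqrt ((2 * pi) ^ card U * det_on U K))"
  define s where "s = (\<lambda>z. r z + prior_energy K U (\<lambda>p. z (Inr p)) + c)"
  have s: "quadratic_on ?I s"
    unfolding s_def using U
    by (intro quadratic_on_add r quadratic_on_compose[OF quadratic_on_energy] affine_on_proj
        quadratic_on_affine affine_on_const) auto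
  have pos_s: "pos_curved_on ?I s"
  proof -
    have "curvature s = curvature (\<lambda>z. r z + prior_energy K U (\<lambda>p. z (Inr p)))"
      by (simp add: s_def curvature_def fun_eq_iff)
    then show ?thesis using pos by (simp only: pos_curved_on_def)
  qed
  have join: "r (case_sum (($) x) f) = r (join_xu U (x, restrict f U))" for x and f :: "real^'n \<Rightarrow> real"
    by (rule quadratic_on_cong[OF r]) (auto simp: join_xu_def)
  have [measurable]: "r \<in> borel_measurable ?B" "s \<in> borel_measurable ?B"
    using measurable_quadratic_on[OF r, of "\<lambda>z. z"] measurable_quadratic_on[OF s, of "\<lambda>z. z"] by auto
  have [measurable]: "(\<lambda>f. restrict f U) \<in> measurable P (Pi\<^sub>M U (\<lambda>_. borel))"
    by (rule restrict_gaussian_process[OF GP])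
  have int_q: "(\<integral>\<^sup>+ w. \<phi> (join_xu U (fst w, restrict (snd w) U)) \<partial>q)
      = (\<integral>\<^sup>+ z. ennreal (exp (- s z)) * \<phi> z \<partial>Pi\<^sub>M ?I (\<lambda>_. lborel))"
    if [measurable]: "\<phi> \<in> borel_measurable ?B" for \<phi>
  proof -
    have "(\<integral>\<^sup>+ w. \<phi> (join_xu U (fst w, restrict (snd w) U)) \<partial>q)
      = (\<integral>\<^sup>+ w. ennreal (exp (- r (join_xu U (fst w, restrict (snd w) U)))) * \<phi> (join_xu U (fst w, restrict (snd w) U))
          \<partial>(lborel \<Otimes>\<^sub>M P))"
      unfolding q_def join case_prod_beta' by (intro nn_integral_density) measurable
    also have "\<dots> = (\<integral>\<^sup>+ z. ennreal (mvn_density U (\<lambda>_. 0) K (\<lambda>p. z (Inr p))) * (ennreal (exp (- r z)) * \<phi> z)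
        \<partial>Pi\<^sub>M ?I (\<lambda>_. lborel))"
      by (rule nn_integral_lborel_P_join[OF U]) measurable
    also have "\<dots> = (\<integral>\<^sup>+ z. ennreal (exp (- s z)) * \<phi> z \<partial>Pi\<^sub>M ?I (\<lambda>_. lborel))"
    proof (rule nn_integral_cong)
      fix z
      have "exp (- s z) = mvn_density U (\<lambda>_. 0) K (\<lambda>p. z (Inr p)) * exp (- r z)"
        unfolding mvn_density_energy[OF U K[OF U]] c_def[symmetric] exp_add[symmetric]
        by (simp add: s_def energy_def)
      moreover have "0 \<le> mvn_density U (\<lambda>_. 0) K (\<lambda>p. z (Inr p))"
        unfolding mvn_density_energy[OF U K[OF U]] by simp
      ultimately show "ennreal (mvn_density U (\<lambda>_. 0) K (\<lambda>p. z (Inr p))) * (ennreal (exp (- r z)) * \<phi> z)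
          = ennreal (exp (- s z)) * \<phi> z"
        by (simp only: ennreal_mult' mult.assoc)
    qed
    finally show ?thesis .
  qed
  have "(\<integral>\<^sup>+ z. ennreal (exp (- s z)) \<partial>Pi\<^sub>M ?I (\<lambda>_. lborel)) = 1"
    using int_q[of "\<lambda>_. 1"] prob_space.emeasure_space_1[OF prob] by simp
  then have mvn: "is_mvn ?I (density (Pi\<^sub>M ?I (\<lambda>_. lborel)) (\<lambda>z. ennreal (exp (- s z))))"
    using U by (intro is_mvn_exp_quadratic s pos_s) auto
  have sets_q: "sets q = sets (borel \<Otimes>\<^sub>M P)"
    unfolding q_def by (simp cong: sets_pair_measure_cong)
  have proj: "(\<lambda>(x, f). (x, restrict f U)) \<in> measurable q (borel \<Otimes>\<^sub>M Pi\<^sub>M U (\<lambda>_. borel))"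
    unfolding measurable_cong_sets[OF sets_q refl] by measurable
  have "distr (marginal_xu U q) ?B (\<lambda>(x, u). restrict (case_sum (($) x) u) ?I)
      = distr q ?B (\<lambda>w. join_xu U (fst w, restrict (snd w) U))"
    unfolding marginal_xu_def join_xu_def[symmetric]
    by (subst distr_distr[OF join_xu_measurable proj]) (simp add: comp_def case_prod_beta')
  also have "\<dots> = density (Pi\<^sub>M ?I (\<lambda>_. lborel)) (\<lambda>z. ennreal (exp (- s z)))"
  proof (rule measure_eqI)
    fix A assume "A \<in> sets (distr q ?B (\<lambda>w. join_xu U (fst w, restrict (snd w) U)))"
    then have A [measurable]: "A \<in> sets ?B" by simp
    have comp: "(\<lambda>w. join_xu U (fst w, restrict (snd w) U)) \<in> measurable q ?B"
      using measurable_compose[OF proj join_xu_measurable] by (simp add: case_prod_beta')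
    have "emeasure (distr q ?B (\<lambda>w. join_xu U (fst w, restrict (snd w) U))) A
        = (\<integral>\<^sup>+ w. indicator A (join_xu U (fst w, restrict (snd w) U)) \<partial>q)"
      by (subst nn_integral_indicator[symmetric], simp, subst nn_integral_distr[OF comp]) auto
    also have "\<dots> = (\<integral>\<^sup>+ z. ennreal (exp (- s z)) * indicator A z \<partial>Pi\<^sub>M ?I (\<lambda>_. lborel))"
      by (rule int_q) measurable
    also have "\<dots> = emeasure (density (Pi\<^sub>M ?I (\<lambda>_. lborel)) (\<lambda>z. ennreal (exp (- s z)))) A"
    proof (rule emeasure_density[symmetric])
      show "(\<lambda>z. ennreal (exp (- s z))) \<in> borel_measurable (Pi\<^sub>M ?I (\<lambda>_. lborel))"
        by (subst measurable_cong_sets[OF sets_PiM_lborel refl]) measurable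
    qed simp
    finally show "emeasure (distr q ?B (\<lambda>w. join_xu U (fst w, restrict (snd w) U))) A
        = emeasure (density (Pi\<^sub>M ?I (\<lambda>_. lborel)) (\<lambda>z. ennreal (exp (- s z)))) A" .
  qed simp
  finally show ?thesis
    using mvn unfolding gaussian_xu_def by simp
qed

lemma gaussian_state_factorizes:
  assumes q: "gaussian_state K P U q"
  shows "factorizes U (gp_conditional K U) q"
  unfolding factorizes_def
proof (intro allI impI, elim conjE)
  fix J :: "(real^'n) set" assume J: "finite J" and disj: "J \<inter> U = {}"
  obtain r where U: "finite U" and prob: "prob_space q" and r: "quadratic_on (UNIV <+> U) r"
    and q_def: "q = density (lborel \<Otimes>\<^sub>M P) (\<lambda>(x, f). ennreal (exp (- r (case_sum (($) x) f))))"
    using q unfolding gaussian_state_def by blast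
  interpret P: sigma_finite_measure P by (rule sigma_finite_P)
  let ?B = "borel :: (real^'n) measure"
  let ?BU = "Pi\<^sub>M U (\<lambda>_. borel :: real measure)" and ?BJ = "Pi\<^sub>M J (\<lambda>_. borel :: real measure)"
  let ?N = "?B \<Otimes>\<^sub>M ?BU \<Otimes>\<^sub>M ?BJ"
  have K': "pos_def_on (U \<union> J) K" using U J K by simp
  define H where "H = (\<lambda>x (u :: real^'n \<Rightarrow> real). ennreal (exp (- r (case_sum (($) x) u))))"
  have H: "ennreal (exp (- r (case_sum (($) x) f))) = H x (restrict f U)" for x f
    unfolding H_def by (intro arg_cong[where f = ennreal] arg_cong[where f = exp] arg_cong[where f = uminus]
      quadratic_on_cong[OF r]) auto
  have H_meas [measurable]: "(\<lambda>(x, u). H x u) \<in> borel_measurable (?B \<Otimes>\<^sub>M ?BU)"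
    unfolding H_def case_prod_beta' by (rule measurable_join[OF r, of _ _ _ U]) auto
  have restr [measurable]: "(\<lambda>f. restrict f V) \<in> measurable P (Pi\<^sub>M V (\<lambda>_. borel))" for V
    by (rule restrict_gaussian_process[OF GP])
  have q_eq: "q = density (lborel \<Otimes>\<^sub>M P) (\<lambda>(x, f). H x (restrict f U))"
    by (simp add: q_def H)
  have sets_q: "sets q = sets (borel \<Otimes>\<^sub>M P)"
    unfolding q_def by (simp cong: sets_pair_measure_cong)
  \<comment> \<open>\<open>bind\<close> has a degenerate value on an empty space, which is excluded
    here.\<close>
  have nonempty: "space (marginal_xu U q) \<noteq> {}"
    by (simp add: marginal_xu_def space_pair_measure space_PiM PiE_eq_empty_iff)
  have proj [measurable]: "(\<lambda>(x, f). (x, restrict f U)) \<in> measurable q (?B \<Otimes>\<^sub>M ?BU)"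
    unfolding measurable_cong_sets[OF sets_q refl] by measurable
  have proj3 [measurable]: "(\<lambda>(x, f). (x, restrict f U, restrict f J)) \<in> measurable q ?N"
    unfolding measurable_cong_sets[OF sets_q refl] by measurable
  have kernel: "(\<lambda>w. distr (gp_conditional K U J (snd w)) ?N (\<lambda>h. (fst w, snd w, h))) \<in> measurable (?B \<Otimes>\<^sub>M ?BU) (subprob_algebra ?N)"
    by (rule gp_conditional_kernel[OF U J disj K']) measurable
  then have kernel': "(\<lambda>(x, u). distr (gp_conditional K U J u) ?N (\<lambda>h. (x, u, h))) \<in> measurable (marginal_xu U q) (subprob_algebra ?N)"
    by (simp add: case_prod_beta' marginal_xu_def)
  show "distr q ?N (\<lambda>(x, f). (x, restrict f U, restrict f J)) =
      marginal_xu U q \<bind> (\<lambda>(x, u). distr (gp_conditional K U J u) ?N (\<lambda>h. (x, u, h)))" (is "?L = ?R")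
  proof (rule measure_eqI)
    show "sets ?L = sets ?R"
      using nonempty by (subst sets_bind[where N = ?N]) (auto simp: marginal_xu_def)
    fix A assume "A \<in> sets ?L"
    then have A [measurable]: "A \<in> sets ?N" by simp
    have kernel_A: "(\<lambda>w. emeasure (distr (gp_conditional K U J (snd w)) ?N (\<lambda>h. (fst w, snd w, h))) A) \<in> borel_measurable (?B \<Otimes>\<^sub>M ?BU)"
      by (rule measurable_compose[OF kernel measurable_emeasure_subprob_algebra[OF A]])
    from measurable_compose[OF _ this, of "\<lambda>w. (fst w, restrict (snd w) U)" "lborel \<Otimes>\<^sub>M P"]
    have [measurable]: "(\<lambda>w. emeasure (distr (gp_conditional K U J (restrict (snd w) U)) ?N (\<lambda>h. (fst w, restrict (snd w) U, h))) A)
        \<in> borel_measurable (lborel \<Otimes>\<^sub>M P)"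
      by simp
    have "emeasure ?L A = (\<integral>\<^sup>+ w. indicator A (fst w, restrict (snd w) U, restrict (snd w) J) \<partial>q)"
      by (subst nn_integral_indicator[symmetric], simp, subst nn_integral_distr[OF proj3]) (auto simp: case_prod_beta')
    also have "\<dots> = (\<integral>\<^sup>+ w. H (fst w) (restrict (snd w) U) * indicator A (fst w, restrict (snd w) U, restrict (snd w) J) \<partial>(lborel \<Otimes>\<^sub>M P))"
      unfolding q_eq case_prod_beta' by (intro nn_integral_density) measurable
    also have "\<dots> = (\<integral>\<^sup>+ x. \<integral>\<^sup>+ f. H x (restrict f U) * indicator A (x, restrict f U, restrict f J) \<partial>P \<partial>lborel)"
      by (subst P.nn_integral_fst[symmetric]) (simp_all, measurable)
    \<comment> \<open>For fixed \<open>x\<close> the prior is disintegrated; the density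
      \<open>H\<close> comes along as a factor that is constant in the new values
      \<open>h\<close>.\<close>
    also have "\<dots> = (\<integral>\<^sup>+ x. \<integral>\<^sup>+ f. \<integral>\<^sup>+ h. H x (restrict f U) * indicator A (x, restrict f U, h)
        \<partial>gp_conditional K U J (restrict f U) \<partial>P \<partial>lborel)"
      by (intro nn_integral_cong nn_integral_prior_conditional[OF GP U J disj K', of "\<lambda>u h. H x u * indicator A (x, u, h)" for x])
        measurable
    also have "\<dots> = (\<integral>\<^sup>+ x. \<integral>\<^sup>+ f. H x (restrict f U) * emeasure (distr (gp_conditional K U J (restrict f U)) ?N (\<lambda>h. (x, restrict f U, h))) A
        \<partial>P \<partial>lborel)"
    proof (intro nn_integral_cong)
      fix x :: "real^'n" and f assume "f \<in> space P"
      have u: "restrict f U \<in> space ?BU" by (simp add: space_PiM)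
      have m [measurable]: "(\<lambda>h. (x, restrict f U, h)) \<in> measurable (gp_conditional K U J (restrict f U)) ?N"
        unfolding measurable_cong_sets[OF sets_gp_conditional refl]
        using u by measurable
      have "(\<integral>\<^sup>+ h. H x (restrict f U) * indicator A (x, restrict f U, h) \<partial>gp_conditional K U J (restrict f U))
          = H x (restrict f U) * (\<integral>\<^sup>+ h. indicator A (x, restrict f U, h) \<partial>gp_conditional K U J (restrict f U))"
        by (rule nn_integral_cmult[OF measurable_compose[OF m borel_measurable_indicator[OF A]]])
      also have "(\<integral>\<^sup>+ h. indicator A (x, restrict f U, h) \<partial>gp_conditional K U J (restrict f U))
          = emeasure (distr (gp_conditional K U J (restrict f U)) ?N (\<lambda>h. (x, restrict f U, h))) A"
        by (subst nn_integral_indicator[symmetric], simp, subst nn_integral_distr[OF m]) auto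
      finally show "(\<integral>\<^sup>+ h. H x (restrict f U) * indicator A (x, restrict f U, h) \<partial>gp_conditional K U J (restrict f U))
          = H x (restrict f U) * emeasure (distr (gp_conditional K U J (restrict f U)) ?N (\<lambda>h. (x, restrict f U, h))) A" .
    qed
    also have "\<dots> = (\<integral>\<^sup>+ w. H (fst w) (restrict (snd w) U)
        * emeasure (distr (gp_conditional K U J (restrict (snd w) U)) ?N (\<lambda>h. (fst w, restrict (snd w) U, h))) A \<partial>(lborel \<Otimes>\<^sub>M P))"
      by (subst P.nn_integral_fst[symmetric]) (simp_all, measurable)
    also have "\<dots> = (\<integral>\<^sup>+ w. emeasure (distr (gp_conditional K U J (restrict (snd w) U)) ?N (\<lambda>h. (fst w, restrict (snd w) U, h))) A \<partial>q)"
      unfolding q_eq case_prod_beta' by (intro nn_integral_density[symmetric]) measurable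
    also have "\<dots> = (\<integral>\<^sup>+ w. emeasure (distr (gp_conditional K U J (snd w)) ?N (\<lambda>h. (fst w, snd w, h))) A \<partial>marginal_xu U q)"
      unfolding marginal_xu_def
      by (subst nn_integral_distr[OF proj]) (simp_all add: kernel_A case_prod_beta')
    also have "\<dots> = emeasure ?R A"
      using nonempty by (subst emeasure_bind[OF _ kernel' A]) (simp_all add: marginal_xu_def case_prod_beta')
    finally show "emeasure ?L A = emeasure ?R A" .
  qed
qed

end

section \<open>Preservation of the invariant by correction and prediction\<close>

lemma curvature_eq_0:
  assumes "quadratic_on I q" "\<And>i. i \<in> I \<Longrightarrow> z i = 0"
  shows "curvature q z = 0"
proof -
  have "q z = q (\<lambda>_. 0)" "q (\<lambda>i. - z i) = q (\<lambda>_. 0)"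
    using assms(2) by (auto intro!: quadratic_on_cong[OF assms(1)])
  then show ?thesis by (simp add: curvature_def)
qed

lemma affine_on_matrix:
  fixes C :: "real^'n^'m"
  assumes "finite V"
  shows "affine_on (UNIV <+> V) (\<lambda>z. (a + C *v ((\<chi> j. z (Inl j)) - \<mu>)) $ i)"
proof -
  have "affine_on (UNIV <+> V) (\<lambda>z. a $ i + (\<Sum>j\<in>UNIV. C $ i $ j * (z (Inl j) - \<mu> $ j)))"
    using assms by (intro affine_on_add affine_on_sum affine_on_cmult affine_on_diff affine_on_const affine_on_proj) auto
  then show ?thesis by (simp add: matrix_vector_mult_def)
qed

context gaussian_prior
begin

text \<open>The likelihood exponent may be flat along the kernel of the measurement Jacobian.
  Convexity is enough, because the old exponent is already strictly convex together with the prior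
  energy.\<close>

lemma gaussian_state_correction:
  assumes q: "gaussian_state K P U q" and Sm: "pos_def Sm"
  shows "gaussian_state K P U (correction g Sm y q)"
proof -
  obtain r where U: "finite U" and prob: "prob_space q" and r: "quadratic_on (UNIV <+> U) r"
    and pos: "pos_curved_on (UNIV <+> U) (\<lambda>z. r z + prior_energy K U (\<lambda>p. z (Inr p)))"
    and q_def: "q = density (lborel \<Otimes>\<^sub>M P) (\<lambda>(x, f). ennreal (exp (- r (case_sum (($) x) f))))"
    using q unfolding gaussian_state_def by blast
  interpret q: prob_space q by (rule prob)
  define \<mu> where "\<mu> = state_mean q"
  define a where "a = g \<mu>"
  define C where "C = jacobian g (at \<mu>)"
  define l where "l = (\<lambda>i (z :: 'n + real^'n \<Rightarrow> real). y $ i - (a + C *v ((\<chi> j. z (Inl j)) - \<mu>)) $ i)"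
  define s where "s = (\<lambda>z. vec_energy Sm (\<lambda>i. l i z))"
  have l: "affine_on (UNIV <+> U) (l i)" for i
    unfolding l_def by (intro affine_on_diff affine_on_const affine_on_matrix U)
  have s: "quadratic_on (UNIV <+> U) s"
    unfolding s_def by (rule quadratic_on_compose[OF quadratic_on_vec_energy l])
  have curv_s: "0 \<le> curvature s z" for z
    unfolding s_def by (subst curvature_compose[OF quadratic_on_vec_energy l])
      (rule curvature_vec_energy_nonneg[OF Sm])
  define L where "L = (\<lambda>w :: (real^'n) \<times> (real^'n \<Rightarrow> real). ennreal (exp (- s (case_sum (($) (fst w)) (snd w)))))"
  have L_eq: "(\<lambda>(x, f). ennreal (linearized_likelihood g Sm y q x)) = L"
    by (simp add: fun_eq_iff L_def linearized_likelihood_def Let_def mvn_vec_density_energy[OF Sm] s_def l_def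
        \<mu>_def[symmetric] a_def[symmetric] C_def[symmetric])
  have sets_q: "sets q = sets (lborel \<Otimes>\<^sub>M P)"
    unfolding q_def by simp
  have snd_m [measurable]: "snd \<in> measurable (lborel \<Otimes>\<^sub>M P) (Pi\<^sub>M UNIV (\<lambda>_. borel))"
    using measurable_snd[of lborel P] by (simp add: measurable_cong_sets[OF refl sets_P])
  have L_meas [measurable]: "L \<in> borel_measurable (lborel \<Otimes>\<^sub>M P)"
    unfolding L_def by (rule measurable_join[OF s, of _ _ _ UNIV]) (simp_all add: snd_m fst_lborel_measurable)
  have r_meas [measurable]: "(\<lambda>w. ennreal (exp (- r (case_sum (($) (fst w)) (snd w))))) \<in> borel_measurable (lborel \<Otimes>\<^sub>M P)"
    by (rule measurable_join[OF r, of _ _ _ UNIV]) (simp_all add: snd_m fst_lborel_measurable)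
  have L_q: "L \<in> borel_measurable q"
    using L_meas by (simp add: measurable_cong_sets[OF sets_q refl])
  \<comment> \<open>The evidence must be finite and nonzero, since division in
    \<open>ennreal\<close> is degenerate otherwise: the likelihood is at most its peak value, and it
    is positive everywhere.\<close>
  define Z where "Z = (\<integral>\<^sup>+ w. L w \<partial>q)"
  have "Z \<le> (\<integral>\<^sup>+ w. ennreal (exp (- vec_energy Sm (\<lambda>_. 0))) \<partial>q)"
    unfolding Z_def by (intro nn_integral_mono) (simp add: L_def s_def vec_energy_ge[OF Sm])
  also have "\<dots> < \<infinity>"
    by (simp add: q.emeasure_space_1)
  finally have Z_fin: "Z \<noteq> \<infinity>" by simp
  have "Z \<noteq> 0"
  proof
    assume "Z = 0"
    then have "AE w in q. L w = 0"
      unfolding Z_def using L_q by (simp add: nn_integral_0_iff_AE)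
    then have "AE w in q. False"
      by (rule AE_mp) (simp add: L_def)
    then show False
      using q.AE_False by simp
  qed
  then obtain \<zeta> where \<zeta>: "0 < \<zeta>" "Z = ennreal \<zeta>"
    using Z_fin by (cases Z) (auto simp: order.order_iff_strict)
  \<comment> \<open>Division by the evidence becomes the summand \<open>ln \<zeta>\<close>.\<close>
  define r' where "r' = (\<lambda>z. r z + (s z + ln \<zeta>))"
  have r': "quadratic_on (UNIV <+> U) r'"
    unfolding r'_def by (intro quadratic_on_add r s quadratic_on_affine affine_on_const)
  have pos': "pos_curved_on (UNIV <+> U) (\<lambda>z. r' z + prior_energy K U (\<lambda>p. z (Inr p)))"
    unfolding pos_curved_on_def
  proof (intro allI impI)
    fix z :: "'n + real^'n \<Rightarrow> real" assume "\<exists>i\<in>UNIV <+> U. z i \<noteq> 0"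
    then have "0 < curvature (\<lambda>z. r z + prior_energy K U (\<lambda>p. z (Inr p))) z"
      by (rule pos_curved_onD[OF pos])
    also have "\<dots> \<le> \<dots> + curvature s z"
      using curv_s by simp
    also have "\<dots> = curvature (\<lambda>z. r' z + prior_energy K U (\<lambda>p. z (Inr p))) z"
      by (simp add: curvature_def r'_def)
    finally show "0 < curvature (\<lambda>z. r' z + prior_energy K U (\<lambda>p. z (Inr p))) z" .
  qed
  have corr: "correction g Sm y q = density q (\<lambda>w. L w / Z)"
    by (simp add: correction_def Let_def L_eq Z_def)
  also have "\<dots> = density (lborel \<Otimes>\<^sub>M P) (\<lambda>w. ennreal (exp (- r (case_sum (($) (fst w)) (snd w)))) * (L w / Z))"
    unfolding q_def case_prod_beta' by (intro density_density_eq) measurable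
  also have "\<dots> = density (lborel \<Otimes>\<^sub>M P) (\<lambda>(x, f). ennreal (exp (- r' (case_sum (($) x) f))))"
  proof (rule arg_cong[where f = "density _"], rule ext)
    fix w :: "(real^'n) \<times> (real^'n \<Rightarrow> real)"
    let ?z = "case_sum (($) (fst w)) (snd w)"
    have "exp (- r ?z) * (exp (- s ?z) / \<zeta>) = exp (- r' ?z)"
      using \<zeta>(1) by (simp add: r'_def exp_add exp_diff exp_minus field_simps)
    then show "ennreal (exp (- r ?z)) * (L w / Z) = (case w of (x, f) \<Rightarrow> ennreal (exp (- r' (case_sum (($) x) f))))"
      using \<zeta> by (simp add: L_def case_prod_beta' divide_ennreal ennreal_mult'[symmetric])
  qed
  finally have dens: "correction g Sm y q = density (lborel \<Otimes>\<^sub>M P) (\<lambda>(x, f). ennreal (exp (- r' (case_sum (($) x) f))))" .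
  have "emeasure (correction g Sm y q) (space (correction g Sm y q)) = (\<integral>\<^sup>+ w. 1 \<partial>density q (\<lambda>w. L w / Z))"
    unfolding corr by simp
  also have "\<dots> = (\<integral>\<^sup>+ w. L w / Z \<partial>q)"
    using L_q by (subst nn_integral_density) auto
  also have "\<dots> = Z / Z"
    unfolding Z_def using L_q by (rule nn_integral_divide)
  also have "\<dots> = 1"
    using \<zeta> by (simp add: divide_ennreal)
  finally have "prob_space (correction g Sm y q)"
    by (rule prob_spaceI)
  then show ?thesis
    unfolding gaussian_state_def using U r' pos' dens by blast
qed

text \<open>The joint exponent of old state, new state and inducing values is strictly convex: the
  old invariant covers old state and inducing values, and the transition noise covers the new state.
  Then \<open>integrate_out_exp_quadratic\<close> removes the old state for each fixed path.\<close>

lemma gaussian_state_transition: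
  fixes A :: "real^'n^'n" and a \<mu> b :: "real^'n" and m :: real
  assumes q: "gaussian_state K P U q" and Sp: "pos_def Sp"
  defines "M \<equiv> \<lambda>x t. a + A *v (x - \<mu>) + (t - m) *\<^sub>R b"
  shows "gaussian_state K P (insert p U)
    (q \<bind> (\<lambda>(x, f). distr (mvn_vec (M x (f p)) Sp) (borel \<Otimes>\<^sub>M Pi\<^sub>M UNIV (\<lambda>_. borel)) (\<lambda>x'. (x', f))))"
proof -
  obtain r where U: "finite U" and prob: "prob_space q" and r: "quadratic_on (UNIV <+> U) r"
    and pos: "pos_curved_on (UNIV <+> U) (\<lambda>z. r z + prior_energy K U (\<lambda>p. z (Inr p)))"
    and q_def: "q = density (lborel \<Otimes>\<^sub>M P) (\<lambda>(x, f). ennreal (exp (- r (case_sum (($) x) f))))"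
    using q unfolding gaussian_state_def by blast
  interpret q: prob_space q by (rule prob)
  interpret P: sigma_finite_measure P by (rule sigma_finite_P)
  define V where "V = insert p U"
  have V: "finite V" "p \<in> V" "U \<subseteq> V" using U by (auto simp: V_def)
  \<comment> \<open>\<open>{p} - U\<close> is empty when \<open>p\<close> is already an inducing
    input, so a repeated linearization point is no special case.\<close>
  have V_eq: "V = U \<union> ({p} - U)" by (auto simp: V_def)
  have posV: "pos_curved_on (UNIV <+> V) (\<lambda>z. r z + prior_energy K V (\<lambda>p. z (Inr p)))"
    unfolding V_eq using U K r pos by (intro pos_curved_on_prior_extend) auto
  have rV: "quadratic_on (UNIV <+> V) r"
    using V by (intro quadratic_on_mono[OF r]) auto
  let ?I = "UNIV <+> V :: ('n + real^'n) set"
  \<comment> \<open>Three blocks of coordinates: old state, new state, inducing values. The old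
    state comes first as the block to be integrated out.\<close>
  let ?J = "UNIV <+> ?I :: ('n + 'n + real^'n) set"
  \<comment> \<open>Drops the new state, which lifts \<open>r\<close> from two blocks to
    three.\<close>
  define \<iota> where "\<iota> = case_sum (\<lambda>j (z :: 'n + 'n + real^'n \<Rightarrow> real). z (Inl j)) (\<lambda>p z. z (Inr (Inr p)))"
  have \<iota>: "affine_on ?J (\<iota> i)" if "i \<in> ?I" for i
    using that V by (cases i) (auto simp: \<iota>_def intro!: affine_on_proj)
  \<comment> \<open>The residual of the linearized transition, one coordinate at a time.\<close>
  define l where "l = (\<lambda>i (z :: 'n + 'n + real^'n \<Rightarrow> real).
    z (Inr (Inl i)) - ((a + A *v ((\<chi> j. z (Inl j)) - \<mu>)) $ i + b $ i * (z (Inr (Inr p)) - m)))"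
  have l: "affine_on ?J (l i)" for i
    unfolding l_def using V
    by (intro affine_on_diff affine_on_add affine_on_cmult affine_on_const affine_on_matrix affine_on_proj) auto
  define e where "e = (\<lambda>z. vec_energy Sp (\<lambda>i. l i z))"
  have e: "quadratic_on ?J e"
    unfolding e_def by (rule quadratic_on_compose[OF quadratic_on_vec_energy l])
  have curv_e: "curvature e z = curvature (vec_energy Sp) (\<lambda>i. l i z - l i (\<lambda>_. 0))" for z
    unfolding e_def by (rule curvature_compose[OF quadratic_on_vec_energy l])
  define h where "h = (\<lambda>z. r (\<lambda>i. \<iota> i z) + e z)"
  have h: "quadratic_on ?J h"
    unfolding h_def by (intro quadratic_on_add e quadratic_on_compose[OF rV \<iota>])
  let ?k = "\<lambda>w :: 'n + real^'n \<Rightarrow> real. prior_energy K V (\<lambda>p. w (Inr p))"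
  have k: "quadratic_on ?I ?k"
    using V by (intro quadratic_on_compose[OF quadratic_on_energy] affine_on_proj) auto
  have pos_h: "pos_curved_on ?J (\<lambda>z. h z + ?k (\<lambda>i. z (Inr i)))"
    unfolding pos_curved_on_def
  proof (intro allI impI)
    fix z :: "'n + 'n + real^'n \<Rightarrow> real" assume z: "\<exists>i\<in>?J. z i \<noteq> 0"
    have curv: "curvature (\<lambda>z. h z + ?k (\<lambda>i. z (Inr i))) z = curvature (\<lambda>z. r z + ?k z) (\<lambda>i. \<iota> i z) + curvature e z"
    proof -
      have "(\<lambda>i. \<iota> i (\<lambda>j. - z j)) = (\<lambda>i. - \<iota> i z)" "(\<lambda>i. \<iota> i (\<lambda>_. 0)) = (\<lambda>_. 0)"
        by (auto simp: \<iota>_def fun_eq_iff split: sum.splits)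
      then show ?thesis by (simp add: curvature_def h_def) (simp add: \<iota>_def)
    qed
    show "0 < curvature (\<lambda>z. h z + ?k (\<lambda>i. z (Inr i))) z"
    proof (cases "\<exists>i\<in>?I. \<iota> i z \<noteq> 0")
      case True
      then show ?thesis
        unfolding curv curv_e
        by (intro add_pos_nonneg pos_curved_onD[OF posV] curvature_vec_energy_nonneg[OF Sp])
    next
      case False
      then have zero: "\<And>i. i \<in> ?I \<Longrightarrow> \<iota> i z = 0" by blast
      have zero_x: "z (Inl j) = 0" for j
        using zero[OF InlI[OF UNIV_I], of j] by (simp add: \<iota>_def)
      have zero_u: "z (Inr (Inr v)) = 0" if "v \<in> V" for v
        using zero[OF InrI[OF that]] by (simp add: \<iota>_def)
      obtain i where i: "z (Inr (Inl i)) \<noteq> 0"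
        using z zero_x zero_u by auto
      \<comment> \<open>With old state and inducing values zero, the linear part of the residual is
        the new state itself.\<close>
      have "l i z - l i (\<lambda>_. 0) = z (Inr (Inl i))"
        using zero_x zero_u[OF V(2)] by (simp add: l_def)
      with i have "0 < curvature e z"
        unfolding curv_e by (intro curvature_vec_energy_pos[OF Sp, of _ i]) simp
      moreover have "curvature (\<lambda>z. r z + ?k z) (\<lambda>i. \<iota> i z) = 0"
        by (rule curvature_eq_0[OF quadratic_on_add[OF rV k] zero])
      ultimately show ?thesis unfolding curv by simp
    qed
  qed
  obtain r' where r': "quadratic_on ?I r'" and pos': "pos_curved_on ?I (\<lambda>w. r' w + ?k w)"
    and int: "\<And>w. (\<integral>\<^sup>+ z. ennreal (exp (- h (case_sum z w))) \<partial>Pi\<^sub>M UNIV (\<lambda>_. lborel)) = ennreal (exp (- r' w))"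
    using integrate_out_exp_quadratic[OF finite_class.finite_UNIV _ h k pos_h] V by auto
  let ?N = "borel \<Otimes>\<^sub>M Pi\<^sub>M UNIV (\<lambda>_. borel) :: 'n joint_law"
  define G where "G = (\<lambda>x (f :: real^'n \<Rightarrow> real). ennreal (exp (- r (case_sum (($) x) f))))"
  define D where "D = (\<lambda>x (f :: real^'n \<Rightarrow> real) x'. ennreal (mvn_vec_density (M x (f p)) Sp x'))"
  have D_eq: "D x f x' = ennreal (exp (- e (case_sum (($) x) (case_sum (($) x') f))))" for x f x'
    by (simp add: D_def mvn_vec_density_energy[OF Sp] e_def l_def M_def mult.commute)
  have GD: "G x f * D x f x' = ennreal (exp (- h (case_sum (($) x) (case_sum (($) x') f))))" for x f x'
  proof -
    have "(\<lambda>i. \<iota> i (case_sum (($) x) (case_sum (($) x') f))) = case_sum (($) x) f"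
      by (auto simp: \<iota>_def fun_eq_iff split: sum.splits)
    then show ?thesis
      by (simp add: G_def D_eq h_def ennreal_mult'[symmetric] exp_add[symmetric])
  qed
  have G_meas: "(\<lambda>w. G (x w) (f w)) \<in> borel_measurable L"
    if "x \<in> borel_measurable L" "f \<in> measurable L (Pi\<^sub>M UNIV (\<lambda>_. borel))" for L :: "'z measure" and x f
    unfolding G_def using that by (intro measurable_join[OF r, of _ _ _ UNIV]) auto
  have D_meas: "(\<lambda>w. D (x w) (f w) (x' w)) \<in> borel_measurable L"
    if x: "x \<in> borel_measurable L" and f: "f \<in> measurable L (Pi\<^sub>M UNIV (\<lambda>_. borel))" and x': "x' \<in> borel_measurable L"
    for L :: "'z measure" and x f x'
  proof -
    have "(\<lambda>w. case_sum (($) (x w)) (case_sum (($) (x' w)) (f w)) i) \<in> borel_measurable L" for i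
    proof (cases i)
      case (Inl j)
      then show ?thesis using x by (simp add: vec_nth_measurable)
    next
      case (Inr v)
      then show ?thesis
        using x' by (cases v) (auto intro!: vec_nth_measurable measurable_component_singleton[THEN measurable_compose[OF f]])
    qed
    from measurable_quadratic_on[OF e this]
    have [measurable]: "(\<lambda>w. e (case_sum (($) (x w)) (case_sum (($) (x' w)) (f w)))) \<in> borel_measurable L" .
    show ?thesis unfolding D_eq by measurable
  qed
  \<comment> \<open>The path \<open>f\<close> is held fixed, so only the finitely many coordinates
    of the old state are integrated.\<close>
  have int_x: "(\<integral>\<^sup>+ x. G x f * D x f x' \<partial>lborel) = ennreal (exp (- r' (case_sum (($) x') f)))" for f x'
  proof -
    have "(\<lambda>x. G x f * D x f x') \<in> borel_measurable borel"
      by (intro borel_measurable_times_ennreal G_meas D_meas) (auto simp: space_PiM)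
    then have "(\<integral>\<^sup>+ x. G x f * D x f x' \<partial>lborel) = (\<integral>\<^sup>+ z. G (\<chi> i. z i) f * D (\<chi> i. z i) f x' \<partial>Pi\<^sub>M UNIV (\<lambda>_. lborel))"
      by (rule nn_integral_lborel_vec)
    also have "\<dots> = (\<integral>\<^sup>+ z. ennreal (exp (- h (case_sum z (case_sum (($) x') f)))) \<partial>Pi\<^sub>M UNIV (\<lambda>_. lborel))"
    proof -
      have "($) (\<chi> i. z i) = z" for z :: "'n \<Rightarrow> real" by (simp add: fun_eq_iff)
      then show ?thesis by (simp only: GD)
    qed
    finally show ?thesis by (simp only: int)
  qed
  have sets_q: "sets q = sets (lborel \<Otimes>\<^sub>M P)"
    unfolding q_def by simp
  have fst_q: "fst \<in> borel_measurable q"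
    using fst_lborel_measurable[of P] by (simp add: measurable_cong_sets[OF sets_q refl])
  have snd_LP: "snd \<in> measurable (lborel \<Otimes>\<^sub>M P) (Pi\<^sub>M UNIV (\<lambda>_. borel))"
    using measurable_snd[of lborel P] by (simp add: measurable_cong_sets[OF refl sets_P])
  then have snd_q: "snd \<in> measurable q (Pi\<^sub>M UNIV (\<lambda>_. borel))"
    by (simp add: measurable_cong_sets[OF sets_q refl])
  define \<kappa> where "\<kappa> = (\<lambda>w. distr (mvn_vec (M (fst w) (snd w p)) Sp) ?N (\<lambda>x'. (x', snd w)))"
  have pair_m: "(\<lambda>x'. (x', f)) \<in> measurable (mvn_vec c Sp) ?N" for c and f :: "real^'n \<Rightarrow> real"
    unfolding measurable_cong_sets[OF sets_mvn_vec refl] by (intro measurable_Pair) (auto simp: space_PiM)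
  have emeasure_\<kappa>: "emeasure (\<kappa> w) B = (\<integral>\<^sup>+ x'. D (fst w) (snd w) x' * indicator B (x', snd w) \<partial>lborel)"
    if B: "B \<in> sets ?N" for w B
  proof -
    have "emeasure (\<kappa> w) B = (\<integral>\<^sup>+ x'. indicator B (x', snd w) \<partial>mvn_vec (M (fst w) (snd w p)) Sp)"
      unfolding \<kappa>_def using B
      by (subst nn_integral_indicator[symmetric], simp, subst nn_integral_distr[OF pair_m]) auto
    also have "\<dots> = (\<integral>\<^sup>+ x'. D (fst w) (snd w) x' * indicator B (x', snd w) \<partial>lborel)"
      unfolding D_def
      using measurable_compose[OF pair_m borel_measurable_indicator[OF B]]
      by (intro nn_integral_mvn_vec[OF Sp]) (simp add: measurable_cong_sets[OF sets_mvn_vec refl])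
    finally show ?thesis .
  qed
  have kernel: "\<kappa> \<in> measurable q (subprob_algebra ?N)"
  proof (rule measurable_subprob_algebra)
    show "subprob_space (\<kappa> w)" for w
      unfolding \<kappa>_def
      by (intro prob_space_imp_subprob_space prob_space.prob_space_distr prob_space_mvn_vec Sp pair_m)
    show "sets (\<kappa> w) = sets ?N" for w by (simp add: \<kappa>_def)
    fix B assume B: "B \<in> sets ?N"
    have "(\<lambda>v. D (fst (fst v)) (snd (fst v)) (snd v) * indicator B (snd v, snd (fst v))) \<in> borel_measurable (q \<Otimes>\<^sub>M lborel)"
      using fst_q snd_q measurable_snd[of q lborel]
      by (intro borel_measurable_times_ennreal D_meas measurable_compose[OF measurable_Pair borel_measurable_indicator[OF B]]
          measurable_compose[OF measurable_fst]) simp_all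
    then have "(\<lambda>w. \<integral>\<^sup>+ x'. D (fst w) (snd w) x' * indicator B (x', snd w) \<partial>lborel) \<in> borel_measurable q"
      by (intro lborel.borel_measurable_nn_integral) (simp add: case_prod_beta')
    then show "(\<lambda>w. emeasure (\<kappa> w) B) \<in> borel_measurable q"
      by (simp only: emeasure_\<kappa>[OF B])
  qed
  have prob': "prob_space (q \<bind> \<kappa>)"
  proof (rule q.prob_space_bind[OF _ kernel])
    show "AE w in q. prob_space (\<kappa> w)"
      unfolding \<kappa>_def by (intro AE_I2 prob_space.prob_space_distr prob_space_mvn_vec Sp pair_m)
  qed
  have dens: "q \<bind> \<kappa> = density (lborel \<Otimes>\<^sub>M P) (\<lambda>(x, f). ennreal (exp (- r' (case_sum (($) x) f))))" (is "?L = ?R")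
  proof (rule measure_eqI)
    have sets_N: "sets ?N = sets (lborel \<Otimes>\<^sub>M P)"
      by (intro sets_pair_measure_cong) (simp_all add: sets_P)
    show "sets ?L = sets ?R"
      using q.not_empty by (subst sets_bind[where N = ?N]) (simp_all add: \<kappa>_def sets_N)
    fix B assume "B \<in> sets ?L"
    then have B: "B \<in> sets ?N"
      using q.not_empty by (subst (asm) sets_bind[where N = ?N]) (simp_all add: \<kappa>_def)
    have id_f: "(\<lambda>f. f) \<in> measurable P (Pi\<^sub>M UNIV (\<lambda>_. borel))"
      by (simp add: measurable_cong_sets[OF refl sets_P[symmetric]])
    define T where "T = (\<lambda>x f x'. G x f * (D x f x' * indicator B (x', f)))"
    have T_meas: "(\<lambda>w. T (x w) (f w) (x' w)) \<in> borel_measurable L"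
      if "x \<in> borel_measurable L" "f \<in> measurable L (Pi\<^sub>M UNIV (\<lambda>_. borel))" "x' \<in> borel_measurable L"
      for L :: "'z measure" and x f x'
      unfolding T_def using that
      by (intro borel_measurable_times_ennreal G_meas D_meas measurable_compose[OF measurable_Pair borel_measurable_indicator[OF B]])
    have "emeasure ?L B = (\<integral>\<^sup>+ w. emeasure (\<kappa> w) B \<partial>q)"
      by (rule emeasure_bind[OF q.not_empty kernel B])
    also have "\<dots> = (\<integral>\<^sup>+ w. G (fst w) (snd w) * emeasure (\<kappa> w) B \<partial>(lborel \<Otimes>\<^sub>M P))"
    proof -
      have "(\<lambda>w. emeasure (\<kappa> w) B) \<in> borel_measurable (lborel \<Otimes>\<^sub>M P)"
        using measurable_compose[OF kernel measurable_emeasure_subprob_algebra[OF B]]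
        by (simp add: measurable_cong_sets[OF sets_q refl])
      moreover have "(\<lambda>w. G (fst w) (snd w)) \<in> borel_measurable (lborel \<Otimes>\<^sub>M P)"
        by (rule G_meas[OF fst_lborel_measurable snd_LP])
      ultimately show ?thesis
        unfolding q_def G_def case_prod_beta' by (intro nn_integral_density)
    qed
    also have "\<dots> = (\<integral>\<^sup>+ w. \<integral>\<^sup>+ x'. T (fst w) (snd w) x' \<partial>lborel \<partial>(lborel \<Otimes>\<^sub>M P))"
    proof (rule nn_integral_cong)
      fix w
      have "(\<lambda>x'. D (fst w) (snd w) x' * indicator B (x', snd w)) \<in> borel_measurable lborel"
        by (intro borel_measurable_times_ennreal D_meas measurable_compose[OF measurable_Pair borel_measurable_indicator[OF B]])
          (auto simp: space_PiM)
      then show "G (fst w) (snd w) * emeasure (\<kappa> w) B = (\<integral>\<^sup>+ x'. T (fst w) (snd w) x' \<partial>lborel)"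
        unfolding T_def emeasure_\<kappa>[OF B] by (rule nn_integral_cmult[symmetric])
    qed
    also have "\<dots> = (\<integral>\<^sup>+ x. \<integral>\<^sup>+ f. \<integral>\<^sup>+ x'. T x f x' \<partial>lborel \<partial>P \<partial>lborel)"
    proof -
      have "(\<lambda>v. T (fst (fst v)) (snd (fst v)) (snd v)) \<in> borel_measurable ((lborel \<Otimes>\<^sub>M P) \<Otimes>\<^sub>M lborel)"
        using measurable_snd[of "lborel \<Otimes>\<^sub>M P" lborel]
        by (intro T_meas measurable_compose[OF measurable_fst fst_lborel_measurable] measurable_compose[OF measurable_fst snd_LP]) simp
      then have "(\<lambda>w. \<integral>\<^sup>+ x'. T (fst w) (snd w) x' \<partial>lborel) \<in> borel_measurable (lborel \<Otimes>\<^sub>M P)"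
        by (intro lborel.borel_measurable_nn_integral) (simp add: case_prod_beta')
      then show ?thesis
        by (subst P.nn_integral_fst[symmetric]) simp_all
    qed
    \<comment> \<open>Three exchanges of adjacent integrals carry the old state \<open>x\<close> to
      the innermost position: from the order \<open>x, f, x'\<close> via \<open>x, x', f\<close> and
      \<open>x', x, f\<close> to \<open>x', f, x\<close>.\<close>
    also have "\<dots> = (\<integral>\<^sup>+ x. \<integral>\<^sup>+ x'. \<integral>\<^sup>+ f. T x f x' \<partial>P \<partial>lborel \<partial>lborel)"
    proof (rule nn_integral_cong)
      fix x
      interpret pair_sigma_finite "lborel :: (real^'n) measure" P ..
      have "(\<lambda>v. T x (snd v) (fst v)) \<in> borel_measurable (lborel \<Otimes>\<^sub>M P)"
        by (intro T_meas snd_LP fst_lborel_measurable) simp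
      then show "(\<integral>\<^sup>+ f. \<integral>\<^sup>+ x'. T x f x' \<partial>lborel \<partial>P) = (\<integral>\<^sup>+ x'. \<integral>\<^sup>+ f. T x f x' \<partial>P \<partial>lborel)"
        by (intro Fubini') (simp add: case_prod_beta')
    qed
    also have "\<dots> = (\<integral>\<^sup>+ x'. \<integral>\<^sup>+ x. \<integral>\<^sup>+ f. T x f x' \<partial>P \<partial>lborel \<partial>lborel)"
    proof -
      have "(\<lambda>v. T (snd (fst v)) (snd v) (fst (fst v))) \<in> borel_measurable ((lborel \<Otimes>\<^sub>M lborel) \<Otimes>\<^sub>M P)"
        using measurable_compose[OF measurable_fst[of "lborel \<Otimes>\<^sub>M lborel" P] measurable_snd[of lborel lborel]]
        by (intro T_meas measurable_compose[OF measurable_fst fst_lborel_measurable] measurable_compose[OF measurable_snd id_f]) simp_all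
      then have "(\<lambda>w. \<integral>\<^sup>+ f. T (snd w) f (fst w) \<partial>P) \<in> borel_measurable (lborel \<Otimes>\<^sub>M lborel)"
        by (intro P.borel_measurable_nn_integral) (simp add: case_prod_beta')
      then show ?thesis by (intro lborel_pair.Fubini') (simp add: case_prod_beta')
    qed
    also have "\<dots> = (\<integral>\<^sup>+ x'. \<integral>\<^sup>+ f. \<integral>\<^sup>+ x. T x f x' \<partial>lborel \<partial>P \<partial>lborel)"
    proof (rule nn_integral_cong)
      fix x'
      interpret pair_sigma_finite "lborel :: (real^'n) measure" P ..
      have "(\<lambda>v. T (fst v) (snd v) x') \<in> borel_measurable (lborel \<Otimes>\<^sub>M P)"
        by (intro T_meas snd_LP fst_lborel_measurable) simp
      then show "(\<integral>\<^sup>+ x. \<integral>\<^sup>+ f. T x f x' \<partial>P \<partial>lborel) = (\<integral>\<^sup>+ f. \<integral>\<^sup>+ x. T x f x' \<partial>lborel \<partial>P)"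
        by (intro Fubini'[symmetric]) (simp add: case_prod_beta')
    qed
    also have "\<dots> = (\<integral>\<^sup>+ x'. \<integral>\<^sup>+ f. ennreal (exp (- r' (case_sum (($) x') f))) * indicator B (x', f) \<partial>P \<partial>lborel)"
    proof (intro nn_integral_cong)
      fix x' :: "real^'n" and f :: "real^'n \<Rightarrow> real"
      have "(\<lambda>x. G x f * D x f x') \<in> borel_measurable lborel"
        by (intro borel_measurable_times_ennreal G_meas D_meas) (auto simp: space_PiM)
      then show "(\<integral>\<^sup>+ x. T x f x' \<partial>lborel) = ennreal (exp (- r' (case_sum (($) x') f))) * indicator B (x', f)"
        unfolding T_def int_x[symmetric] mult.assoc[symmetric] by (rule nn_integral_multc)
    qed
    also have "\<dots> = (\<integral>\<^sup>+ w. ennreal (exp (- r' (case_sum (($) (fst w)) (snd w)))) * indicator B w \<partial>(lborel \<Otimes>\<^sub>M P))"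
    proof -
      have "(\<lambda>w. ennreal (exp (- r' (case_sum (($) (fst w)) (snd w))))) \<in> borel_measurable (lborel \<Otimes>\<^sub>M P)"
        by (rule measurable_join[OF r' fst_lborel_measurable snd_LP]) simp
      moreover have "indicator B \<in> borel_measurable (lborel \<Otimes>\<^sub>M P)"
        using B by (simp add: sets_N)
      ultimately have "(\<lambda>w. ennreal (exp (- r' (case_sum (($) (fst w)) (snd w)))) * indicator B w) \<in> borel_measurable (lborel \<Otimes>\<^sub>M P)"
        by (rule borel_measurable_times_ennreal)
      then show ?thesis
        by (subst P.nn_integral_fst[symmetric]) simp_all
    qed
    also have "\<dots> = emeasure ?R B"
    proof -
      have "(\<lambda>w. ennreal (exp (- r' (case_sum (($) (fst w)) (snd w))))) \<in> borel_measurable (lborel \<Otimes>\<^sub>M P)"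
        by (rule measurable_join[OF r' fst_lborel_measurable snd_LP]) simp
      then show ?thesis
        unfolding case_prod_beta' using B by (intro emeasure_density[symmetric]) (simp_all add: sets_N)
    qed
    finally show "emeasure ?L B = emeasure ?R B" .
  qed
  have "gaussian_state K P V (q \<bind> \<kappa>)"
    unfolding gaussian_state_def using V r' pos' prob' dens by blast
  then show ?thesis
    by (simp add: V_def \<kappa>_def case_prod_beta')
qed

section \<open>Induction along the recursion\<close>

lemma gaussian_state_predict_step:
  assumes "gaussian_state K P (snd s) (fst s)" and "pos_def Sp"
  shows "gaussian_state K P (snd (predict_step F Sp s)) (fst (predict_step F Sp s))"
  using gaussian_state_transition[OF assms]
  by (simp add: predict_step_def prediction_def transition_mean_def Let_def case_prod_beta')

lemma gaussian_state_correct_step: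
  assumes "gaussian_state K P (snd s) (fst s)" and "pos_def Sm"
  shows "gaussian_state K P (snd (correct_step g Sm y s)) (fst (correct_step g Sm y s))"
  using gaussian_state_correction[OF assms] by (simp add: correct_step_def case_prod_beta')

lemma gaussian_state_corrected:
  assumes "gaussian_state K P (snd s0) (fst s0)" "pos_def Sp" "pos_def Sm"
  shows "gaussian_state K P (snd (corrected F g Sp Sm y s0 t)) (fst (corrected F g Sp Sm y s0 t))"
  by (induction t) (simp_all add: assms gaussian_state_predict_step gaussian_state_correct_step)

end

theorem theorem1:
  fixes F :: "(real^'n) \<times> real \<Rightarrow> real^'n"
    and g :: "real^'n \<Rightarrow> real^'m"
    and K0 :: "real^'n \<Rightarrow> real^'n \<Rightarrow> real"
    and \<mu>0 :: "real^'n" and P0 Sp :: "real^'n^'n" and Sm :: "real^'m^'m"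
    and GP :: "(real^'n \<Rightarrow> real) measure"
    and U0 :: "(real^'n) set"
    and y :: "nat \<Rightarrow> real^'m"
    and q :: "'n joint_law" and U :: "(real^'n) set" and t :: nat
  assumes "F differentiable_on UNIV"
    and "g differentiable_on UNIV"
    and "covariance_function K0"
    and "(\<lambda>(x, x'). K0 x x') differentiable_on UNIV"
    and "\<And>J. finite J \<Longrightarrow> invertible_on J K0"
    and "pos_def P0" and "pos_def Sp" and "pos_def Sm"
    and "gaussian_process (\<lambda>_. 0) K0 GP"
    and "finite U0"
    and "(q, U) = predicted F g Sp Sm y (mvn_vec \<mu>0 P0 \<Otimes>\<^sub>M GP, U0) t \<or>
         (q, U) = corrected F g Sp Sm y (mvn_vec \<mu>0 P0 \<Otimes>\<^sub>M GP, U0) (Suc t)"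
  shows "finite U \<and>
         is_prior_conditional GP U (gp_conditional K0 U) \<and>
         factorizes U (gp_conditional K0 U) q \<and>
         gaussian_xu U (marginal_xu U q)"
proof -
  have K: "pos_def_on J K0" if "finite J" for J
    using assms(3,5) that by (rule gaussian_process_pos_def_on)
  interpret gaussian_prior K0 GP
    by standard (fact assms(9), rule K)
  let ?s0 = "(mvn_vec \<mu>0 P0 \<Otimes>\<^sub>M GP, U0)"
  have "gaussian_state K0 GP (snd ?s0) (fst ?s0)"
    using gaussian_state_initial[OF assms(10,6)] by simp
  note corrected = gaussian_state_corrected[OF this assms(7,8)]
  from assms(11) have q: "gaussian_state K0 GP U q"
  proof
    assume "(q, U) = predicted F g Sp Sm y ?s0 t"
    then show ?thesis
      using gaussian_state_predict_step[OF corrected[of F g y t] assms(7), of F]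
      by (metis predicted_def fst_conv snd_conv)
  next
    assume "(q, U) = corrected F g Sp Sm y ?s0 (Suc t)"
    then show ?thesis
      using corrected[of F g y "Suc t"] by (metis fst_conv snd_conv)
  qed
  then have "finite U" by (simp add: gaussian_state_def)
  with q show ?thesis
    using is_prior_conditional_gp_conditional[OF assms(9) _ K] gaussian_state_factorizes gaussian_state_gaussian_xu
    by blast
qed

end
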